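(* Let $S$ be an intermediate Kato surface with one branch and simple Dloussky sequence $[s_{k_0}s_{k_1}\cdots s_{k_{p-1}}r_m]$, $m\ge1$, and let $\mathbf t:=a_1$ be the multiplicity of the tip. Then the slopes $g_j$ and the multiplicity $r(p)$ of the root are given by $$g_j=f(k_0,\dots,k_{j-1})\,\mathbf t-f(k_1,\dots,k_{j-1})\qquad\text{for all } j=0,1,2,\dots,p,$$ $$r(p)=[\mathcal P(k_0,k_1,\dots,k_{p-1})+1]\,\mathbf t-\mathcal P(k_1,k_2,\dots,k_{p-1}).$$
   Context: A Kato surface is a minimal compact complex surface $S$ with $b:=b_2(S)>0$ containing a global spherical shell (an open subset $V$ biholomorphic to a neighbourhood of $S^3\subset\mathbb C^2$ with $S\setminus V$ connected). It contains exactly $b$ rational curves. $S$ is intermediate if its maximal curve $D$ (the sum of these $b$ curves) is connected and consists of one cycle of rational curves together with at least one branch. Then the $b$ curves $D_i$ form a basis of $H^2(S,\mathbb Q)$; the first Chern class of $S$ is denoted $-K$, and $-K=\sum d_iD_i$ with unique $d_i\in\mathbb Q$, called the multiplicities of $-K$. Dloussky sequence: listing the curves in their order of creation (cyclically) gives a sequence of integers $\ge 2$, the opposite self-intersection numbers of the curves (if a curve is nodal, which happens only when the cycle is irreducible, its entry $e$ satisfies $D_i^2=-e+2$). The dual graph has, for each entry with value $e$, one edge joining that curve to the curve $e-1$ places after it in cyclic order. Put $s_k=(k+2,2,\dots,2)$ (length $k\ge1$) and $r_m=(2,\dots,2)$ (length $m\ge 1$). $S$ has one branch exactly when its Dloussky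 sequence is simple: $[s_{k_0}s_{k_1}\cdots s_{k_{p-1}}r_m]$ with $p\ge1$, all $k_i\ge1$, $m\ge1$. Labelling of curves: $\alpha=\sum_{0\le 2i<p}k_{2i}$, $\beta=\sum_{1\le 2i+1<p}k_{2i+1}$. The branch components, from the tip to the root (root excluded), are the chain $A_1,\dots,A_\alpha$; $A_{k_0+k_2+\cdots+k_{2j}}$ has self-intersection $-(k_{2j+1}+2)$ for $2j+1\le p-1$, and the other $A_i$ have self-intersection $-2$. The cycle components in cyclic order are $C_0,\dots,C_{\beta+m-1}$, with $C_{\beta+m}=C_0$; $C_0$ has entry $k_0+2$, $C_{k_1+k_3+\cdots+k_{2j-1}}$ has entry $k_{2j}+2$ for $2\le 2j\le p-1$, and the others have entry $2$. The root is $R=C_{\beta+1}$ (equal to $C_0$ if $m=1$), and $A_\alpha$ meets $R$. Write $-K=\sum_{i=1}^\alpha a_iA_i+\sum_{j=0}^{\beta+m-1}c_jC_j$, $c_{\beta+m}:=c_0$, and let $a_{\alpha+1}=r(p)=c_{\beta+1}$ be the multiplicity of the root. Slopes: $g_0:=a_1$ (which equals $a_2-a_1$ if $k_0>1$); $g_{2j+2}:=a_{k_0+k_2+\cdots+k_{2j}+1}-a_{k_0+k_2+\cdots+k_{2j}}$ for $2\le 2j+2\le p$; $g_1:=c_1-c_0$; $g_{2j+1}:=c_{k_1+k_3+\cdots+k_{2j-1}+1}-c_{k_1+k_3+\cdots+k_{2j-1}}$ for $3\le 2j+1\le p$. Polynomials: $f(X_1)=X_1$, $f(X_1,X_2)=X_1X_2+1$,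 $f(X_1,\dots,X_n)=X_nf(X_1,\dots,X_{n-1})+f(X_1,\dots,X_{n-2})$; $\mathcal P(X_1)=X_1$, $\mathcal P(X_1,X_2)=X_1X_2+X_1$, $\mathcal P(X_1,\dots,X_n)=X_nf(X_1,\dots,X_{n-1})+\mathcal P(X_1,\dots,X_{n-1})$. Conventions: $f$ of the empty list is $1$ and $\mathcal P$ of the empty list is $0$; for $j=0$ the term $f(k_0,\dots,k_{j-1})$ is $1$ and the term $f(k_1,\dots,k_{j-1})$ is $0$. *)

theory Defs
  imports "HOL-Complex_Analysis.Complex_Analysis" "HOL-Homology.Homology"
begin

section \<open>Complex surfaces\<close>

text \<open>Holomorphic functions of two variables: complex-linear Frechet derivative everywhere.\<close>

definition holomorphic2 :: "(complex \<times> complex \<Rightarrow> complex) \<Rightarrow> (complex \<times> complex) set \<Rightarrow> bool" where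
  "holomorphic2 f G \<longleftrightarrow>
     (\<forall>p\<in>G. \<exists>a b. (f has_derivative (\<lambda>v. a * fst v + b * snd v)) (at p))"

definition pd1 :: "(complex \<times> complex \<Rightarrow> complex) \<Rightarrow> complex \<times> complex \<Rightarrow> complex" where
  "pd1 f p = deriv (\<lambda>z. f (z, snd p)) (fst p)"

definition pd2 :: "(complex \<times> complex \<Rightarrow> complex) \<Rightarrow> complex \<times> complex \<Rightarrow> complex" where
  "pd2 f p = deriv (\<lambda>z. f (fst p, z)) (snd p)"

type_synonym 'a chart = "'a set \<times> ('a \<Rightarrow> complex \<times> complex)"

definition is_chart :: "'a topology \<Rightarrow> 'a chart \<Rightarrow> bool" where
  "is_chart X \<kappa> \<longleftrightarrow> openin X (fst \<kappa>) \<and> open (snd \<kappa> ` fst \<kappa>) \<and>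
     homeomorphic_map (subtopology X (fst \<kappa>)) (top_of_set (snd \<kappa> ` fst \<kappa>)) (snd \<kappa>)"

definition chart_inv :: "'a chart \<Rightarrow> complex \<times> complex \<Rightarrow> 'a" where
  "chart_inv \<kappa> = inv_into (fst \<kappa>) (snd \<kappa>)"

text \<open>The coordinate change from \<open>\<kappa>'\<close> to \<open>\<kappa>\<close>, and its Jacobian determinant at the point \<open>x\<close>
  of the surface.\<close>

definition transition :: "'a chart \<Rightarrow> 'a chart \<Rightarrow> complex \<times> complex \<Rightarrow> complex \<times> complex" where
  "transition \<kappa> \<kappa>' = snd \<kappa> \<circ> chart_inv \<kappa>'"

definition jacobian :: "'a chart \<Rightarrow> 'a chart \<Rightarrow> 'a \<Rightarrow> complex" where
  "jacobian \<kappa> \<kappa>' x =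
     (let T = transition \<kappa> \<kappa>'; p = snd \<kappa>' x in
       pd1 (fst \<circ> T) p * pd2 (snd \<circ> T) p - pd2 (fst \<circ> T) p * pd1 (snd \<circ> T) p)"

definition compatible :: "'a chart \<Rightarrow> 'a chart \<Rightarrow> bool" where
  "compatible \<kappa> \<kappa>' \<longleftrightarrow>
     holomorphic2 (fst \<circ> transition \<kappa> \<kappa>') (snd \<kappa>' ` (fst \<kappa> \<inter> fst \<kappa>')) \<and>
     holomorphic2 (snd \<circ> transition \<kappa> \<kappa>') (snd \<kappa>' ` (fst \<kappa> \<inter> fst \<kappa>')) \<and>
     holomorphic2 (fst \<circ> transition \<kappa>' \<kappa>) (snd \<kappa> ` (fst \<kappa> \<inter> fst \<kappa>')) \<and>
     holomorphic2 (snd \<circ> transition \<kappa>' \<kappa>) (snd \<kappa> ` (fst \<kappa> \<inter> fst \<kappa>'))"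

record 'a surface =
  surface_top :: "'a topology"
  charts :: "'a chart set"

text \<open>A complex structure is a maximal holomorphic atlas. Hence the charts of a surface are
  exactly the biholomorphic maps from its open subsets onto open subsets of the space of
  pairs of complex numbers. Second countability is not demanded, as all surfaces below are compact.\<close>

definition complex_surface :: "'a surface \<Rightarrow> bool" where
  "complex_surface S \<longleftrightarrow>
     connected_space (surface_top S) \<and> Hausdorff_space (surface_top S) \<and>
     (\<forall>\<kappa>\<in>charts S. is_chart (surface_top S) \<kappa>) \<and>
     (\<Union>\<kappa>\<in>charts S. fst \<kappa>) = topspace (surface_top S) \<and>
     (\<forall>\<kappa>\<in>charts S. \<forall>\<kappa>'\<in>charts S. compatible \<kappa> \<kappa>') \<and>
     (\<forall>\<kappa>. is_chart (surface_top S) \<kappa> \<and> (\<forall>\<kappa>'\<in>charts S. compatible \<kappa> \<kappa>') \<longrightarrow> \<kappa> \<in> charts S)"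

definition holomorphic_fun :: "'a surface \<Rightarrow> 'a set \<Rightarrow> ('a \<Rightarrow> complex) \<Rightarrow> bool" where
  "holomorphic_fun S W f \<longleftrightarrow>
     (\<forall>\<kappa>\<in>charts S. holomorphic2 (f \<circ> chart_inv \<kappa>) (snd \<kappa> ` (fst \<kappa> \<inter> W)))"


section \<open>Rational curves\<close>

definition holomorphic_path :: "'a surface \<Rightarrow> (complex \<Rightarrow> 'a) \<Rightarrow> bool" where
  "holomorphic_path S u \<longleftrightarrow> continuous_map euclidean (surface_top S) u \<and>
     (\<forall>\<kappa>\<in>charts S. (\<lambda>z. fst (snd \<kappa> (u z))) holomorphic_on (u -` fst \<kappa>) \<and>
                    (\<lambda>z. snd (snd \<kappa> (u z))) holomorphic_on (u -` fst \<kappa>))"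

text \<open>A holomorphic map from the projective line is given by its restrictions \<open>u\<close> and \<open>v\<close> to
  the two standard affine charts; its value at infinity is \<open>v 0\<close>.\<close>

definition holomorphic_sphere :: "'a surface \<Rightarrow> (complex \<Rightarrow> 'a) \<Rightarrow> (complex \<Rightarrow> 'a) \<Rightarrow> bool" where
  "holomorphic_sphere S u v \<longleftrightarrow>
     holomorphic_path S u \<and> holomorphic_path S v \<and> (\<forall>z. z \<noteq> 0 \<longrightarrow> u z = v (1 / z))"

definition normalization :: "'a surface \<Rightarrow> 'a set \<Rightarrow> (complex \<Rightarrow> 'a) \<Rightarrow> (complex \<Rightarrow> 'a) \<Rightarrow> bool" where
  "normalization S C u v \<longleftrightarrow> holomorphic_sphere S u v \<and> C = range u \<union> range v \<and>
     (\<exists>F. finite F \<and> inj_on u (- F))"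

definition rational_curve :: "'a surface \<Rightarrow> 'a set \<Rightarrow> bool" where
  "rational_curve S C \<longleftrightarrow> (\<exists>u v. normalization S C u v)"

definition rational_curves :: "'a surface \<Rightarrow> 'a set set" where
  "rational_curves S = {C. rational_curve S C}"

text \<open>The support of the maximal curve of a Kato surface, all of whose coefficients are 1.\<close>

definition maximal_curve :: "'a surface \<Rightarrow> 'a set" where
  "maximal_curve S = \<Union> (rational_curves S)"

definition smooth_at :: "'a surface \<Rightarrow> 'a set \<Rightarrow> 'a \<Rightarrow> bool" where
  "smooth_at S C p \<longleftrightarrow> (\<exists>\<kappa>\<in>charts S. p \<in> fst \<kappa> \<and> snd \<kappa> p = (0, 0) \<and>
     C \<inter> fst \<kappa> = {x \<in> fst \<kappa>. snd (snd \<kappa> x) = 0})"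

definition node_at :: "'a surface \<Rightarrow> 'a set \<Rightarrow> 'a \<Rightarrow> bool" where
  "node_at S C p \<longleftrightarrow> (\<exists>\<kappa>\<in>charts S. p \<in> fst \<kappa> \<and> snd \<kappa> p = (0, 0) \<and>
     C \<inter> fst \<kappa> = {x \<in> fst \<kappa>. fst (snd \<kappa> x) * snd (snd \<kappa> x) = 0})"

definition smooth_rational_curve :: "'a surface \<Rightarrow> 'a set \<Rightarrow> bool" where
  "smooth_rational_curve S C \<longleftrightarrow>
     (\<exists>u v. normalization S C u v \<and> inj u \<and> v 0 \<notin> range u) \<and> (\<forall>p\<in>C. smooth_at S C p)"

text \<open>A rational curve with one node is the projective line with two points identified;
  they may be taken to be zero and infinity.\<close>

definition nodal_rational_curve :: "'a surface \<Rightarrow> 'a set \<Rightarrow> bool" where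
  "nodal_rational_curve S C \<longleftrightarrow>
     (\<exists>u v. normalization S C u v \<and> inj u \<and> v 0 = u 0 \<and> node_at S C (u 0) \<and>
            (\<forall>p\<in>C - {u 0}. smooth_at S C p))"


section \<open>Intersection numbers\<close>

text \<open>Reduced local equations of a curve \<open>C\<close>: generators of its ideal sheaf over \<open>W\<close>.\<close>

definition local_eq :: "'a surface \<Rightarrow> 'a set \<Rightarrow> 'a set \<Rightarrow> ('a \<Rightarrow> complex) \<Rightarrow> bool" where
  "local_eq S C W h \<longleftrightarrow> openin (surface_top S) W \<and> holomorphic_fun S W h \<and>
     {x \<in> W. h x = 0} = C \<inter> W \<and>
     (\<forall>V f. openin (surface_top S) V \<and> V \<subseteq> W \<and> holomorphic_fun S V f \<and> (\<forall>x\<in>C \<inter> V. f x = 0) \<longrightarrow>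
        (\<exists>k. holomorphic_fun S V k \<and> (\<forall>x\<in>V. f x = k x * h x)))"

text \<open>A nowhere vanishing continuous section over the affine line of the pullback under \<open>u\<close> of
  the line bundle of the divisor \<open>D\<close>. Over \<open>W\<close> this bundle is framed by \<open>1/h\<close>, with \<open>h\<close> a
  local equation of \<open>D\<close>; \<open>s (W, h)\<close> is the coordinate of the section in this frame, and
  \<open>\<epsilon>\<close> is the unit \<open>h/h'\<close>, extended across \<open>D\<close>.\<close>

definition frame_of_divisor ::
  "'a surface \<Rightarrow> 'a set \<Rightarrow> (complex \<Rightarrow> 'a) \<Rightarrow> ('a set \<times> ('a \<Rightarrow> complex) \<Rightarrow> complex \<Rightarrow> complex) \<Rightarrow> bool" where
  "frame_of_divisor S D u s \<longleftrightarrow>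
     (\<forall>W h. local_eq S D W h \<longrightarrow>
        continuous_on (u -` W) (s (W, h)) \<and> (\<forall>z\<in>u -` W. s (W, h) z \<noteq> 0)) \<and>
     (\<forall>W h W' h' \<epsilon>. local_eq S D W h \<and> local_eq S D W' h' \<and>
        continuous_map (subtopology (surface_top S) (W \<inter> W')) euclidean \<epsilon> \<and>
        (\<forall>x\<in>W \<inter> W'. h x = \<epsilon> x * h' x) \<longrightarrow>
        (\<forall>z\<in>u -` (W \<inter> W'). s (W, h) z = \<epsilon> (u z) * s (W', h') z))"

text \<open>The pullback of the line bundle of \<open>D\<close> to the projective line has degree \<open>n\<close>, i.e. it is
  isomorphic to the bundle with transition function \<open>z powi n\<close>. In terms of the sections \<open>\<sigma>\<close>
  and \<open>\<tau>\<close> with coordinates \<open>s\<close> and \<open>t\<close>: the section \<open>\<sigma> = z powi (-n) \<tau>\<close> has no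
  zeros or poles in the affine line and a zero of order \<open>n\<close> at infinity.\<close>

definition pullback_degree ::
  "'a surface \<Rightarrow> 'a set \<Rightarrow> (complex \<Rightarrow> 'a) \<Rightarrow> (complex \<Rightarrow> 'a) \<Rightarrow> int \<Rightarrow> bool" where
  "pullback_degree S D u v n \<longleftrightarrow>
     (\<exists>s t. frame_of_divisor S D u s \<and> frame_of_divisor S D v t \<and>
        (\<forall>W h z. local_eq S D W h \<and> z \<noteq> 0 \<and> u z \<in> W \<longrightarrow> t (W, h) (1 / z) = z powi n * s (W, h) z))"

text \<open>The intersection number of \<open>D\<close> with \<open>C\<close> (possibly \<open>D = C\<close>) is the degree of the line
  bundle of \<open>D\<close> on the normalization of \<open>C\<close>. Normalizations differ by automorphisms of the
  projective line, so the degree does not depend on the choice.\<close>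

definition intersection_number :: "'a surface \<Rightarrow> 'a set \<Rightarrow> 'a set \<Rightarrow> int \<Rightarrow> bool" where
  "intersection_number S D C n \<longleftrightarrow> rational_curve S D \<and> rational_curve S C \<and>
     (\<forall>u v. normalization S C u v \<longrightarrow> pullback_degree S D u v n)"


section \<open>Intermediate Kato surfaces\<close>

definition abelian_rank :: "('g, 'm) monoid_scheme \<Rightarrow> nat" where
  "abelian_rank G = Sup {card B | B. finite B \<and> B \<subseteq> carrier G \<and>
     (\<forall>c :: 'g \<Rightarrow> int. finprod G (\<lambda>b. b [^]\<^bsub>G\<^esub> c b) B = \<one>\<^bsub>G\<^esub> \<longrightarrow> (\<forall>b\<in>B. c b = 0))}"

definition betti :: "nat \<Rightarrow> 'a topology \<Rightarrow> nat" where
  "betti p X = abelian_rank (homology_group (int p) X)"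

text \<open>A chart with domain \<open>V\<close> is a biholomorphic map from \<open>V\<close> onto its image. The
  neighbourhood of the unit sphere is required not to contain the origin: otherwise the
  condition would hold for small coordinate balls on every surface.\<close>

definition has_global_spherical_shell :: "'a surface \<Rightarrow> bool" where
  "has_global_spherical_shell S \<longleftrightarrow>
     (\<exists>(V, \<psi>)\<in>charts S. sphere (0, 0) 1 \<subseteq> \<psi> ` V \<and> (0, 0) \<notin> \<psi> ` V \<and>
        connectedin (surface_top S) (topspace (surface_top S) - V))"

definition minimal_surface :: "'a surface \<Rightarrow> bool" where
  "minimal_surface S \<longleftrightarrow> \<not> (\<exists>C. smooth_rational_curve S C \<and> intersection_number S C C (-1))"

definition Kato_surface :: "'a surface \<Rightarrow> bool" where
  "Kato_surface S \<longleftrightarrow> complex_surface S \<and> compact_space (surface_top S) \<and> minimal_surface S \<and>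
     betti 2 (surface_top S) > 0 \<and> has_global_spherical_shell S"

text \<open>Cycles of rational curves: one nodal curve, two smooth curves meeting twice, or at least
  three smooth curves, each meeting the next one. The cardinality below is the number of edges
  between \<open>i\<close> and \<open>j\<close> in the cyclic graph on \<open>{..<r}\<close>.\<close>

definition cycle_of_curves :: "'a surface \<Rightarrow> nat \<Rightarrow> (nat \<Rightarrow> 'a set) \<Rightarrow> bool" where
  "cycle_of_curves S r C \<longleftrightarrow> r > 0 \<and> inj_on C {..<r} \<and>
     (if r = 1 then nodal_rational_curve S (C 0) else \<forall>i<r. smooth_rational_curve S (C i)) \<and>
     (\<forall>i<r. \<forall>j<r. i \<noteq> j \<longrightarrow>
        intersection_number S (C i) (C j) (int (card {l. l < r \<and> {l, Suc l mod r} = {i, j}})))"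

text \<open>The maximal curve is a connected curve with normal crossings, made up of a cycle and
  further smooth curves. Since its dual graph is connected and contains a cycle, the equality of
  the number of its edges (the nodes of the curve) and of its vertices says that there is
  exactly one cycle; then the remaining curves form the branches.\<close>

definition intermediate_Kato_surface :: "'a surface \<Rightarrow> bool" where
  "intermediate_Kato_surface S \<longleftrightarrow> Kato_surface S \<and>
     (let D = maximal_curve S in
       finite (rational_curves S) \<and> connectedin (surface_top S) D \<and>
       (\<forall>p\<in>D. smooth_at S D p \<or> node_at S D p) \<and>
       card {p. node_at S D p} = card (rational_curves S) \<and>
       (\<exists>r C. cycle_of_curves S r C \<and> C ` {..<r} \<subset> rational_curves S \<and>
          (\<forall>B\<in>rational_curves S - C ` {..<r}. smooth_rational_curve S B)))"


section \<open>Multiplicities of the first Chern class\<close>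

text \<open>The first Chern class of \<open>S\<close> is that of \<open>det T\<close>, the determinant of the tangent bundle.
  The first Chern class identifies topological line bundles with integral cohomology classes
  of degree 2. Thus \<open>c_1(S) = \<Sum> d C * [C]\<close> holds in rational cohomology iff, for some \<open>N > 0\<close>
  such that all \<open>n C = N * d C\<close> are integers, \<open>(det T)^N\<close> and the line bundle of the divisor
  \<open>\<Sum> n C * C\<close> are topologically isomorphic. An isomorphism is a nowhere vanishing
  continuous section \<open>\<tau>\<close> of \<open>(det T)^N\<close> outside the support of the divisor which near the
  support is, up to continuous units, the product of the powers \<open>h C powi n C\<close> of local
  equations. Here \<open>\<tau> \<kappa>\<close> is the coordinate of the section in the frame of the chart \<open>\<kappa>\<close>.\<close>

definition det_tangent_power_has_divisor :: "'a surface \<Rightarrow> nat \<Rightarrow> ('a set \<Rightarrow> int) \<Rightarrow> bool" where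
  "det_tangent_power_has_divisor S N n \<longleftrightarrow>
     (\<exists>\<tau> :: 'a chart \<Rightarrow> 'a \<Rightarrow> complex.
        (\<forall>\<kappa>\<in>charts S. \<forall>\<kappa>'\<in>charts S. \<forall>x\<in>fst \<kappa> \<inter> fst \<kappa>' - maximal_curve S.
           \<tau> \<kappa> x = jacobian \<kappa> \<kappa>' x ^ N * \<tau> \<kappa>' x) \<and>
        (\<forall>p\<in>topspace (surface_top S). \<exists>\<kappa>\<in>charts S. \<exists>W h \<epsilon>. p \<in> W \<and> W \<subseteq> fst \<kappa> \<and>
           openin (surface_top S) W \<and>
           (\<forall>C\<in>rational_curves S. local_eq S C W (h C)) \<and>
           continuous_map (subtopology (surface_top S) W) euclidean \<epsilon> \<and> (\<forall>x\<in>W. \<epsilon> x \<noteq> 0) \<and>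
           (\<forall>x\<in>W - maximal_curve S. \<tau> \<kappa> x = \<epsilon> x * (\<Prod>C\<in>rational_curves S. h C x powi n C))))"

definition anticanonical_multiplicities :: "'a surface \<Rightarrow> ('a set \<Rightarrow> rat) \<Rightarrow> bool" where
  "anticanonical_multiplicities S d \<longleftrightarrow>
     (\<exists>N n. N > 0 \<and> (\<forall>C\<in>rational_curves S. of_int (n C) = of_nat N * d C) \<and>
        det_tangent_power_has_divisor S N n)"


section \<open>Dloussky sequences and labelling\<close>

definition self_intersection_entry :: "'a surface \<Rightarrow> 'a set \<Rightarrow> nat \<Rightarrow> bool" where
  "self_intersection_entry S C e \<longleftrightarrow>
     intersection_number S C C (if nodal_rational_curve S C then 2 - int e else - int e)"

text \<open>\<open>E\<close> lists the curves; curve \<open>l\<close> is joined to the curve \<open>es ! l - 1\<close> places after it.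
  A loop of the dual graph is the node of a nodal curve.\<close>

definition Dloussky_sequence :: "'a surface \<Rightarrow> (nat \<Rightarrow> 'a set) \<Rightarrow> nat list \<Rightarrow> bool" where
  "Dloussky_sequence S E es \<longleftrightarrow>
     (let n = length es; next = (\<lambda>l. (l + (es ! l - 1)) mod n) in
       bij_betw E {..<n} (rational_curves S) \<and> (\<forall>e\<in>set es. e \<ge> 2) \<and>
       (\<forall>i<n. self_intersection_entry S (E i) (es ! i)) \<and>
       (\<forall>i<n. nodal_rational_curve S (E i) \<longleftrightarrow> next i = i) \<and>
       (\<forall>i<n. \<forall>j<n. i \<noteq> j \<longrightarrow>
          intersection_number S (E i) (E j) (int (card {l. l < n \<and> {l, next l} = {i, j}}))))"

definition simple_sequence :: "nat list \<Rightarrow> nat \<Rightarrow> nat list" where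
  "simple_sequence ks m = concat (map (\<lambda>k. (k + 2) # replicate (k - 1) 2) ks) @ replicate m 2"

text \<open>\<open>ksum_even ks i\<close> is \<open>k_0 + k_2 + ... + k_(2i-2)\<close> and
  \<open>ksum_odd ks i\<close> is \<open>k_1 + k_3 + ... + k_(2i-1)\<close>.\<close>

definition ksum_even :: "nat list \<Rightarrow> nat \<Rightarrow> nat" where
  "ksum_even ks i = (\<Sum>l<i. ks ! (2 * l))"

definition ksum_odd :: "nat list \<Rightarrow> nat \<Rightarrow> nat" where
  "ksum_odd ks i = (\<Sum>l<i. ks ! (2 * l + 1))"

definition alpha :: "nat list \<Rightarrow> nat" where
  "alpha ks = (\<Sum>i | i < length ks \<and> even i. ks ! i)"

definition beta :: "nat list \<Rightarrow> nat" where
  "beta ks = (\<Sum>i | i < length ks \<and> odd i. ks ! i)"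

text \<open>The branch is \<open>A 1, ..., A (alpha ks)\<close>, from the tip to the neighbour of the root; the
  cycle is \<open>C 0, ..., C (beta ks + m - 1)\<close>, and the root is \<open>C (beta ks + 1)\<close>.\<close>

definition labelling ::
  "'a surface \<Rightarrow> nat list \<Rightarrow> nat \<Rightarrow> (nat \<Rightarrow> 'a set) \<Rightarrow> (nat \<Rightarrow> 'a set) \<Rightarrow> bool" where
  "labelling S ks m A C \<longleftrightarrow>
     (let p = length ks; \<alpha> = alpha ks; r = beta ks + m; R = C (beta ks + 1) in
       inj_on A {1..\<alpha>} \<and> A ` {1..\<alpha>} \<inter> C ` {..<r} = {} \<and>
       A ` {1..\<alpha>} \<union> C ` {..<r} = rational_curves S \<and>
       cycle_of_curves S r C \<and> C r = C 0 \<and>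
       (\<forall>i\<in>{1..\<alpha>}. smooth_rational_curve S (A i)) \<and>
       (\<forall>i\<in>{1..\<alpha>}. \<forall>j\<in>{1..\<alpha>}. i \<noteq> j \<longrightarrow>
          intersection_number S (A i) (A j) (if i = Suc j \<or> j = Suc i then 1 else 0)) \<and>
       (\<forall>i\<in>{1..\<alpha>}. \<forall>j<r.
          intersection_number S (A i) (C j) (if i = \<alpha> \<and> C j = R then 1 else 0) \<and>
          intersection_number S (C j) (A i) (if i = \<alpha> \<and> C j = R then 1 else 0)) \<and>
       (\<forall>j. 2 * j + 1 < p \<longrightarrow>
          self_intersection_entry S (A (ksum_even ks (Suc j))) (ks ! (2 * j + 1) + 2)) \<and>
       (\<forall>i\<in>{1..\<alpha>}. (\<nexists>j. 2 * j + 1 < p \<and> i = ksum_even ks (Suc j)) \<longrightarrow>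
          self_intersection_entry S (A i) 2) \<and>
       (\<forall>j. 2 * j < p \<longrightarrow> self_intersection_entry S (C (ksum_odd ks j)) (ks ! (2 * j) + 2)) \<and>
       (\<forall>i<r. (\<nexists>j. 2 * j < p \<and> i = ksum_odd ks j) \<longrightarrow> self_intersection_entry S (C i) 2))"


section \<open>Slopes and polynomials\<close>

text \<open>Here \<open>a i\<close> and \<open>c j\<close> are the multiplicities of \<open>A i\<close> and \<open>C j\<close>, and
  \<open>a (alpha ks + 1)\<close> is that of the root.\<close>

definition slope :: "nat list \<Rightarrow> (nat \<Rightarrow> rat) \<Rightarrow> (nat \<Rightarrow> rat) \<Rightarrow> nat \<Rightarrow> rat" where
  "slope ks a c j =
     (if j = 0 then a 1
      else if even j then a (ksum_even ks (j div 2) + 1) - a (ksum_even ks (j div 2))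
      else c (ksum_odd ks (j div 2) + 1) - c (ksum_odd ks (j div 2)))"

text \<open>The polynomials recurse on the last variable, so they are computed on the reversed list.\<close>

fun f_rev :: "'r::comm_semiring_1 list \<Rightarrow> 'r" where
  "f_rev [] = 1"
| "f_rev [x] = x"
| "f_rev (x # y # xs) = x * f_rev (y # xs) + f_rev xs"

fun P_rev :: "'r::comm_semiring_1 list \<Rightarrow> 'r" where
  "P_rev [] = 0"
| "P_rev (x # xs) = x * f_rev xs + P_rev xs"

definition f_poly :: "'r::comm_semiring_1 list \<Rightarrow> 'r" where
  "f_poly xs = f_rev (rev xs)"

definition P_poly :: "'r::comm_semiring_1 list \<Rightarrow> 'r" where
  "P_poly xs = P_rev (rev xs)"

end

theory Submission
  imports Defs
begin

text \<open>The multiplicities of \<open>-K\<close> are pinned down by the adjunction formula, which gives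
  \<open>-K\<cdot>D = D\<^sup>2 + 2\<close> on a smooth rational curve \<open>D\<close> and \<open>-K\<cdot>D = D\<^sup>2\<close> on a nodal one. So the proof has a
  topological and a linear algebraic half.

  The hypothesis on the multiplicities provides a section of \<open>(det T)\<^sup>N\<close> with divisor
  \<open>\<Sum> n C * C\<close>. Near a smooth point of \<open>D\<close> take coordinates \<open>(x, y)\<close> with \<open>D = {y = 0}\<close>. Along a
  parametrization \<open>u\<close> of \<open>D\<close> there are two nowhere vanishing sections of \<open>u\<^sup>*(det T)\<^sup>N\<close>: the given
  section with the local equations replaced by frames of the line bundles of the curves, and the
  \<open>N\<close>-th power of (tangent vector of \<open>u\<close>) \<open>\<and>\<close> (frame of the normal bundle \<open>O(D)\<close>), whose coordinate is
  \<open>(x \<circ> u)'\<close> times the coordinate of the frame of \<open>O(D)\<close> with respect to the equation \<open>y\<close>. Their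
  ratio \<open>\<phi>\<close> does not depend on the coordinates (\<open>ratio_unique\<close>): both sides pick up the \<open>N\<close>-th power
  of the Jacobian determinant. So \<open>\<phi>\<close> is a continuous nowhere vanishing function on each of the two
  affine lines covering the projective line, and the frames and the change of variable \<open>z \<mapsto> 1/z\<close> relate the
  two functions by the power of \<open>z\<close> with exponent \<open>\<Sum> n C * (C\<cdot>D) - N * (D\<^sup>2 + 2)\<close>
  (\<open>\<phi>_at_infinity\<close>). A nowhere vanishing function on the plane has no winding, so this exponent is
  zero (\<open>clutching_exponent_zero\<close>). At each of the two preimages of a node the second section has
  a pole of order \<open>N\<close> (\<open>\<phi>_node\<close>), which removes the summand 2.

  For the second half, at a curve with entry \<open>e\<close> the adjunction formula says that the slope of the
  multiplicities changes by \<open>e - 2\<close> times (multiplicity - 1); at the root it also drops by the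
  multiplicity of the neighbouring branch component. Hence the slopes are constant between curves with
  \<open>e > 2\<close>. Writing value for multiplicity - 1, the chain and the cycle are two systems in which ``value plus \<open>k\<close> times slope'' and
  ``slope plus \<open>k\<close> times value'' alternate, with the same numbers \<open>k\<close> but with the roles of value
  and slope exchanged. The chain starts with value \<open>-1\<close> (the multiplicity 0 before the tip) and slope \<open>t\<close>.
  The two systems have equal final multiplicity and are coupled at the root, which forces them to
  have the same initial data (\<open>recurrence_rigidity\<close>). So all slopes lie on a single sequence with
  \<open>x(n + 2) = k(n) x(n + 1) + x(n)\<close>, \<open>x(0) = -1\<close>, \<open>x(1) = t\<close>, the continuant recursion of \<open>f\<close>.\<close>

section \<open>Holomorphic functions of one and two variables\<close>

lemma has_field_derivative_along_path:
  fixes f :: "complex \<times> complex \<Rightarrow> complex"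
  assumes f: "(f has_derivative (\<lambda>v. a * fst v + b * snd v)) (at (x z, y z))"
    and x: "(x has_field_derivative x') (at z)" and y: "(y has_field_derivative y') (at z)"
  shows "((\<lambda>w. f (x w, y w)) has_field_derivative a * x' + b * y') (at z)"
proof -
  have xy: "((\<lambda>w. (x w, y w)) has_derivative (\<lambda>h. (x' * h, y' * h))) (at z)"
    using x y by (intro has_derivative_Pair) (simp_all add: has_field_derivative_def)
  have "((\<lambda>w. f (x w, y w)) has_derivative (\<lambda>h. a * fst (x' * h, y' * h) + b * snd (x' * h, y' * h))) (at z)"
    by (rule has_derivative_compose[OF xy f])
  then show ?thesis
    unfolding has_field_derivative_def
    by (rule has_derivative_eq_rhs) (auto simp: algebra_simps fun_eq_iff)
qed

lemma pd_unique:
  assumes "(f has_derivative (\<lambda>v. a * fst v + b * snd v)) (at p)"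
  shows "pd1 f p = a" "pd2 f p = b"
proof -
  have "((\<lambda>w. f (w, snd p)) has_field_derivative a * 1 + b * 0) (at (fst p))"
    using assms by (intro has_field_derivative_along_path) (auto intro!: derivative_eq_intros)
  then show "pd1 f p = a" by (simp add: pd1_def DERIV_imp_deriv)
  have "((\<lambda>w. f (fst p, w)) has_field_derivative a * 0 + b * 1) (at (snd p))"
    using assms by (intro has_field_derivative_along_path) (auto intro!: derivative_eq_intros)
  then show "pd2 f p = b" by (simp add: pd2_def DERIV_imp_deriv)
qed

lemma holomorphic2_has_derivative:
  assumes "holomorphic2 f G" "p \<in> G"
  shows "(f has_derivative (\<lambda>v. pd1 f p * fst v + pd2 f p * snd v)) (at p)"
proof -
  obtain a b where "(f has_derivative (\<lambda>v. a * fst v + b * snd v)) (at p)"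
    using assms unfolding holomorphic2_def by blast
  with pd_unique[OF this] show ?thesis by simp
qed

lemma holomorphic2_path:
  assumes "holomorphic2 f G" "(x z, y z) \<in> G"
    and "(x has_field_derivative x') (at z)" "(y has_field_derivative y') (at z)"
  shows "((\<lambda>w. f (x w, y w)) has_field_derivative
            pd1 f (x z, y z) * x' + pd2 f (x z, y z) * y') (at z)"
  using has_field_derivative_along_path[OF holomorphic2_has_derivative[OF assms(1,2)] assms(3,4)] .

lemma holomorphic2_subset: "holomorphic2 f G \<Longrightarrow> H \<subseteq> G \<Longrightarrow> holomorphic2 f H"
  unfolding holomorphic2_def by blast

lemma holomorphic2_isCont: "holomorphic2 f G \<Longrightarrow> p \<in> G \<Longrightarrow> isCont f p"
  using holomorphic2_has_derivative has_derivative_continuous by blast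

lemma holomorphic2_cong:
  assumes "open G" "\<And>p. p \<in> G \<Longrightarrow> f p = g p"
  shows "holomorphic2 f G \<longleftrightarrow> holomorphic2 g G"
proof -
  have "holomorphic2 g G"
    if hol: "holomorphic2 f G" and eq: "\<And>p. p \<in> G \<Longrightarrow> f p = g p" for f g
    unfolding holomorphic2_def
  proof
    fix p assume p: "p \<in> G"
    then obtain a b where "(f has_derivative (\<lambda>v. a * fst v + b * snd v)) (at p)"
      using hol unfolding holomorphic2_def by blast
    then have "(g has_derivative (\<lambda>v. a * fst v + b * snd v)) (at p)"
      using has_derivative_transform_within_open[OF _ assms(1) p] eq by blast
    then show "\<exists>a b. (g has_derivative (\<lambda>v. a * fst v + b * snd v)) (at p)" by blast
  qed
  then show ?thesis using assms(2) by metis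
qed

lemma holomorphic2_swap:
  assumes "holomorphic2 f G"
  shows "holomorphic2 (f \<circ> prod.swap) (prod.swap ` G)"
  unfolding holomorphic2_def
proof
  fix p assume "p \<in> prod.swap ` G"
  then have p: "prod.swap p \<in> G" by auto
  then obtain a b where f: "(f has_derivative (\<lambda>v. a * fst v + b * snd v)) (at (prod.swap p))"
    using assms unfolding holomorphic2_def by blast
  have s: "(prod.swap has_derivative prod.swap) (at p)"
    unfolding prod.swap_def by (intro derivative_intros)
  have "(f \<circ> prod.swap has_derivative (\<lambda>v. a * fst (prod.swap v) + b * snd (prod.swap v))) (at p)"
    unfolding comp_def by (rule has_derivative_compose[OF s f])
  then have "(f \<circ> prod.swap has_derivative (\<lambda>v. b * fst v + a * snd v)) (at p)"
    by (rule has_derivative_eq_rhs) (auto simp: fun_eq_iff)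
  then show "\<exists>a b. (f \<circ> prod.swap has_derivative (\<lambda>v. a * fst v + b * snd v)) (at p)" by blast
qed

text \<open>By the Cauchy estimate the derivatives of two holomorphic functions that are uniformly
  close on a disc are close at its centre.\<close>

lemma holomorphic2_pd1_isCont:
  assumes hol: "holomorphic2 f G" and "open G" and p: "p \<in> G"
  shows "isCont (pd1 f) p"
proof -
  obtain x0 y0 where p_eq: "p = (x0, y0)" by fastforce
  obtain r where r: "r > 0" "cball p (2 * r) \<subseteq> G"
    using open_contains_cball assms(2) p
    by (metis field_sum_of_halves half_gt_zero_iff mult_2)
  have in_G: "(x, y) \<in> G" if "dist x x0 \<le> r" "dist y y0 \<le> r" for x y
  proof -
    have "dist (x, y) (x0, y0) \<le> dist x x0 + dist y y0"
      by (simp add: dist_Pair_Pair sqrt_sum_squares_le_sum)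
    then show ?thesis using that r(2) unfolding p_eq by (auto simp: dist_commute)
  qed
  have slice: "((\<lambda>x. f (x, y)) has_field_derivative pd1 f (x, y)) (at x)"
    if "dist x x0 \<le> r" "dist y y0 \<le> r" for x y
    using holomorphic2_path[OF hol, of "\<lambda>x. x" x "\<lambda>x. y" 1 0] in_G[OF that] by simp
  have holo: "(\<lambda>x. f (x, y)) holomorphic_on cball x0 r" if "dist y y0 \<le> r" for y
    using slice that by (intro holomorphic_onI) (metis dist_commute field_differentiable_at_within
        field_differentiable_def mem_cball)
  have cont: "continuous_on (cball x0 r \<times> cball y0 r) f"
    using in_G by (intro continuous_at_imp_continuous_on)
      (auto intro!: holomorphic2_isCont[OF hol] simp: dist_commute)
  then have unif: "uniformly_continuous_on (cball x0 r \<times> cball y0 r) f"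
    by (intro compact_uniformly_continuous compact_Times compact_cball)
  have g_cont: "isCont (\<lambda>x. pd1 f (x, y0)) x0"
  proof -
    have "deriv (\<lambda>x. f (x, y0)) holomorphic_on ball x0 r"
      using holo[of y0] r by (intro holomorphic_deriv) (auto intro: holomorphic_on_subset)
    then have "isCont (deriv (\<lambda>x. f (x, y0))) x0"
      using r by (metis centre_in_ball continuous_on_eq_continuous_at holomorphic_on_imp_continuous_on
          open_ball)
    then show ?thesis by (simp add: pd1_def)
  qed
  show ?thesis
    unfolding continuous_at_eps_delta p_eq
  proof (intro allI impI)
    fix e :: real assume e: "e > 0"
    \<comment> \<open>The Cauchy estimate on discs of radius \<open>r/2\<close> turns this into a bound \<open>e/4\<close> for derivatives.\<close>
    define B where "B = e * r / 8"
    have "B > 0" using e r by (simp add: B_def)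
    then obtain d1 where d1: "d1 > 0"
      "\<And>q q'. q \<in> cball x0 r \<times> cball y0 r \<Longrightarrow> q' \<in> cball x0 r \<times> cball y0 r \<Longrightarrow> dist q' q < d1
        \<Longrightarrow> dist (f q') (f q) < B"
      using unif unfolding uniformly_continuous_on_def by metis
    obtain d2 where d2: "d2 > 0" "\<And>x. dist x x0 < d2 \<Longrightarrow> dist (pd1 f (x, y0)) (pd1 f (x0, y0)) < e / 2"
      using g_cont e unfolding continuous_at_eps_delta by (metis half_gt_zero)
    define d where "d = min (min d1 d2) (r / 2)"
    have "d > 0" using d1 d2 r by (simp add: d_def)
    moreover have "dist (pd1 f q) (pd1 f (x0, y0)) < e" if q: "dist q (x0, y0) < d" for q
    proof -
      obtain x y where q_eq: "q = (x, y)" by fastforce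
      have x: "dist x x0 < d" and y: "dist y y0 < d"
        using q dist_fst_le[of q "(x0, y0)"] dist_snd_le[of q "(x0, y0)"] by (auto simp: q_eq)
      then have x': "dist x x0 < r / 2" and y': "dist y y0 \<le> r" using r by (auto simp: d_def)
      have sub: "cball x (r / 2) \<subseteq> cball x0 r"
        using x' by (simp add: cball_subset_cball_iff)
      let ?h = "\<lambda>w. f (w, y) - f (w, y0)"
      have hol_h: "?h holomorphic_on cball x0 r"
        using y' r by (intro holomorphic_intros holo) auto
      have "cmod ((deriv ^^ 1) ?h x) \<le> fact 1 * B / (r / 2) ^ 1"
      proof (rule Cauchy_inequality)
        show "?h holomorphic_on ball x (r / 2)"
          using hol_h sub ball_subset_cball holomorphic_on_subset by (metis subset_trans)
        show "continuous_on (cball x (r / 2)) ?h"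
          using hol_h sub holomorphic_on_imp_continuous_on holomorphic_on_subset by blast
        show "0 < r / 2" using r by simp
        fix w assume "norm (x - w) = r / 2"
        then have "w \<in> cball x (r / 2)" by (simp add: dist_norm)
        then have "w \<in> cball x0 r" using sub by blast
        moreover have "y \<in> cball y0 r" "y0 \<in> cball y0 r" using y' r by (auto simp: dist_commute)
        moreover have "dist (w, y) (w, y0) < d1" using y by (simp add: dist_Pair_Pair d_def)
        ultimately show "cmod (?h w) \<le> B"
          using d1(2)[of "(w, y0)" "(w, y)"] by (simp add: dist_norm less_imp_le)
      qed
      moreover have "deriv ?h x = pd1 f (x, y) - pd1 f (x, y0)"
        using x' y' r by (intro DERIV_imp_deriv DERIV_diff slice) auto
      ultimately have "dist (pd1 f (x, y)) (pd1 f (x, y0)) \<le> 2 * B / r"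
        using r by (simp add: dist_norm field_simps)
      also have "2 * B / r = e / 4" using r by (simp add: B_def)
      finally have "dist (pd1 f (x, y)) (pd1 f (x, y0)) \<le> e / 4" .
      moreover have "dist (pd1 f (x, y0)) (pd1 f (x0, y0)) < e / 2"
        using x by (intro d2) (simp add: d_def)
      ultimately show ?thesis
        using dist_triangle[of "pd1 f (x, y)" "pd1 f (x0, y0)" "pd1 f (x, y0)"] e by (simp add: q_eq)
    qed
    ultimately show "\<exists>d>0. \<forall>q. dist q (x0, y0) < d \<longrightarrow> dist (pd1 f q) (pd1 f (x0, y0)) < e" by blast
  qed
qed

lemma holomorphic2_pd2_isCont:
  assumes hol: "holomorphic2 f G" and "open G" and p: "p \<in> G"
  shows "isCont (pd2 f) p"
proof -
  have "prod.swap ` G = prod.swap -` G" by force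
  moreover have "open (prod.swap -` G)"
    using assms(2) by (intro open_vimage) (auto simp: prod.swap_def intro!: continuous_intros)
  ultimately have "isCont (pd1 (f \<circ> prod.swap)) (prod.swap p)"
    using holomorphic2_pd1_isCont[OF holomorphic2_swap[OF hol]] p by auto
  moreover have "isCont prod.swap p"
    unfolding prod.swap_def by (intro continuous_intros continuous_ident)
  ultimately have "isCont (\<lambda>q. pd1 (f \<circ> prod.swap) (prod.swap q)) p"
    by (rule isCont_o2[rotated])
  moreover have "(\<lambda>q. pd1 (f \<circ> prod.swap) (prod.swap q)) = pd2 f"
    by (auto simp: pd1_def pd2_def)
  ultimately show ?thesis by simp
qed

text \<open>A weak form of the Hartogs phenomenon. If \<open>k\<close> vanished at the origin only, then \<open>1/k\<close>
  would be holomorphic on all parallel discs close to the disc through the origin, and bounded on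
  their boundaries, hence bounded near the origin by the maximum principle.\<close>

lemma holomorphic2_no_isolated_zero:
  assumes hol: "holomorphic2 k G" and "open G" and "(0, 0) \<in> G"
    and nz: "\<And>q. q \<in> G \<Longrightarrow> q \<noteq> (0, 0) \<Longrightarrow> k q \<noteq> 0"
  shows "k (0, 0) \<noteq> 0"
proof
  assume k0: "k (0, 0) = 0"
  obtain r where r: "r > 0" "cball (0, 0) (2 * r) \<subseteq> G"
    using open_contains_cball assms(2,3) by (metis field_sum_of_halves half_gt_zero_iff mult_2)
  have in_G: "(x, y) \<in> G" if "cmod x \<le> r" "cmod y \<le> r" for x y
  proof -
    have "dist (x, y) (0, 0) \<le> dist x 0 + dist y 0"
      by (simp add: dist_Pair_Pair sqrt_sum_squares_le_sum)
    then show ?thesis using that r(2) by (auto simp: dist_commute)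
  qed
  have cont: "continuous_on (cball 0 r \<times> cball 0 r) k"
    using in_G by (intro continuous_at_imp_continuous_on) (auto intro!: holomorphic2_isCont[OF hol])
  then have unif: "uniformly_continuous_on (cball 0 r \<times> cball 0 r) k"
    by (intro compact_uniformly_continuous compact_Times compact_cball)
  have "compact ((\<lambda>x. k (x, 0)) ` sphere 0 r)"
    using r by (intro compact_continuous_image continuous_on_compose2[OF cont] continuous_intros) auto
  moreover have "0 \<notin> (\<lambda>x. k (x, 0)) ` sphere 0 r"
    using nz in_G r by force
  ultimately obtain \<mu> where \<mu>: "\<mu> > 0" "\<And>x. cmod x = r \<Longrightarrow> \<mu> \<le> cmod (k (x, 0))"
    using separate_point_closed[of "(\<lambda>x. k (x, 0)) ` sphere 0 r" 0]
    by (auto simp: compact_imp_closed)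
  obtain d where d: "d > 0"
    "\<And>q q'. q \<in> cball 0 r \<times> cball 0 r \<Longrightarrow> q' \<in> cball 0 r \<times> cball 0 r \<Longrightarrow> dist q' q < d
      \<Longrightarrow> dist (k q') (k q) < \<mu> / 2"
    using unif \<mu>(1) unfolding uniformly_continuous_on_def by (metis half_gt_zero)
  define y where "y = complex_of_real (min (d / 2) r)"
  have y: "cmod y \<le> r" "y \<noteq> 0" "cmod y < d" using d(1) r by (auto simp: y_def)
  have "cmod (inverse (k (0, y))) \<le> 2 / \<mu>"
  proof (rule maximum_modulus_frontier[of "\<lambda>x. inverse (k (x, y))" "cball 0 r"])
    have "(\<lambda>x. k (x, y)) holomorphic_on cball 0 r"
    proof (rule holomorphic_onI)
      fix x :: complex assume "x \<in> cball 0 r"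
      then have "((\<lambda>x. k (x, y)) has_field_derivative pd1 k (x, y) * 1 + pd2 k (x, y) * 0) (at x)"
        using in_G y by (intro holomorphic2_path[OF hol]) auto
      then show "(\<lambda>x. k (x, y)) field_differentiable at x within cball 0 r"
        using field_differentiable_at_within field_differentiable_def by blast
    qed
    then have *: "(\<lambda>x. inverse (k (x, y))) holomorphic_on cball 0 r"
      using nz in_G y by (intro holomorphic_intros) auto
    then show "(\<lambda>x. inverse (k (x, y))) holomorphic_on interior (cball 0 r)"
      by (rule holomorphic_on_subset) (rule interior_subset)
    show "continuous_on (closure (cball 0 r)) (\<lambda>x. inverse (k (x, y)))"
      using * holomorphic_on_imp_continuous_on by simp
    show "bounded (cball (0::complex) r)" by simp
    fix x :: complex assume "x \<in> frontier (cball 0 r)"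
    then have x: "cmod x = r" using r by simp
    have "dist (k (x, y)) (k (x, 0)) < \<mu> / 2"
      using x y r by (intro d) (auto simp: dist_Pair_Pair)
    then have "cmod (k (x, y)) \<ge> \<mu> / 2"
      using \<mu>(2)[OF x] norm_triangle_ineq2[of "k (x, 0)" "k (x, y)"]
      by (simp add: dist_norm norm_minus_commute)
    then show "cmod (inverse (k (x, y))) \<le> 2 / \<mu>"
      using \<mu>(1) le_imp_inverse_le[of "\<mu> / 2" "cmod (k (x, y))"] by (simp add: norm_inverse)
  next
    show "(0::complex) \<in> cball 0 r" using r by simp
  qed
  moreover have "dist (k (0, y)) (k (0, 0)) < \<mu> / 2"
    using y r by (intro d) (auto simp: dist_Pair_Pair)
  moreover have "k (0, y) \<noteq> 0" using nz[of "(0, y)"] in_G[of 0 y] y r by simp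
  ultimately show False
    using k0 \<mu>(1) inverse_le_imp_le[of "cmod (k (0, y))" "\<mu> / 2"] by (simp add: norm_inverse)
qed

lemma holomorphic2_mult:
  assumes "holomorphic2 f G" "holomorphic2 g G"
  shows "holomorphic2 (\<lambda>p. f p * g p) G"
  unfolding holomorphic2_def
proof
  fix p assume p: "p \<in> G"
  have "((\<lambda>p. f p * g p) has_derivative
      (\<lambda>v. f p * (pd1 g p * fst v + pd2 g p * snd v) + (pd1 f p * fst v + pd2 f p * snd v) * g p)) (at p)"
    using assms p by (intro has_derivative_mult holomorphic2_has_derivative)
  then have "((\<lambda>p. f p * g p) has_derivative
      (\<lambda>v. (f p * pd1 g p + pd1 f p * g p) * fst v + (f p * pd2 g p + pd2 f p * g p) * snd v)) (at p)"
    by (rule has_derivative_eq_rhs) (auto simp: algebra_simps)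
  then show "\<exists>a b. ((\<lambda>p. f p * g p) has_derivative (\<lambda>v. a * fst v + b * snd v)) (at p)" by blast
qed

text \<open>If the limit of \<open>K\<close> vanished at a zero of \<open>H\<close>, then \<open>K * H\<close> would vanish to higher than first order there.\<close>

lemma quotient_nonzero_at_simple_zero:
  fixes H K :: "complex \<Rightarrow> complex"
  assumes H: "(H has_field_derivative b) (at z)" "H z = 0" and K: "(K \<longlongrightarrow> K0) (at z)"
    and eq: "eventually (\<lambda>w. (w - z) * r = K w * H w) (at z)" and "r \<noteq> 0"
  shows "K0 \<noteq> 0"
proof -
  have "((\<lambda>w. (H w - H z) / (w - z)) \<longlongrightarrow> b) (at z)"
    using H(1) by (simp add: has_field_derivative_iff)
  then have "((\<lambda>w. K w * ((H w - H z) / (w - z))) \<longlongrightarrow> K0 * b) (at z)"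
    by (rule tendsto_mult[OF K])
  moreover have "eventually (\<lambda>w. w \<noteq> z) (at z)" by (simp add: eventually_at_filter)
  then have "eventually (\<lambda>w. K w * ((H w - H z) / (w - z)) = r) (at z)"
    using eq by eventually_elim (use H(2) in \<open>auto simp: divide_simps mult_ac\<close>)
  ultimately have "((\<lambda>w. r) \<longlongrightarrow> K0 * b) (at z)"
    by (rule Lim_transform_eventually)
  then have "r = K0 * b" by (simp add: tendsto_const_iff)
  then show ?thesis using \<open>r \<noteq> 0\<close> by auto
qed

lemma holomorphic_product_zero:
  assumes f: "f holomorphic_on B" and g: "g holomorphic_on B" and B: "open B" "connected B"
    and fg: "\<And>z. z \<in> B \<Longrightarrow> f z * g z = 0"
  shows "(\<forall>z\<in>B. f z = 0) \<or> (\<forall>z\<in>B. g z = 0)"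
proof (rule disjCI, rule ballI)
  fix z assume z: "z \<in> B" and "\<not> (\<forall>z\<in>B. g z = 0)"
  then obtain z0 where z0: "z0 \<in> B" "g z0 \<noteq> 0" by blast
  define U where "U = B \<inter> g -` (- {0})"
  have U: "open U"
    unfolding U_def
    by (rule continuous_open_preimage[OF holomorphic_on_imp_continuous_on[OF g] B(1)]) auto
  show "f z = 0"
  proof (rule analytic_continuation_open[OF U B(1) _ B(2), where f = f and g = "\<lambda>_. 0"])
    show "f w = (\<lambda>_. 0) w" if "w \<in> U" for w using fg[of w] that by (auto simp: U_def)
  qed (use z0 f z in \<open>auto simp: U_def\<close>)
qed

text \<open>Both functions have logarithms on the plane. So on the unit circle \<open>z powi n\<close> is a constant times
  the exponential of a continuous function, which excludes winding.\<close>

lemma clutching_exponent_zero: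
  fixes \<Phi> \<Psi> :: "complex \<Rightarrow> complex" and n :: int
  assumes cont: "continuous_on UNIV \<Phi>" "continuous_on UNIV \<Psi>"
    and nz: "\<And>z. \<Phi> z \<noteq> 0" "\<And>z. \<Psi> z \<noteq> 0"
    and eq: "\<And>z. z \<noteq> 0 \<Longrightarrow> \<Psi> (1 / z) = c * z powi n * \<Phi> z"
  shows "n = 0"
proof -
  obtain F where F: "continuous_on UNIV F" "\<And>z. \<Phi> z = exp (F z)"
    using continuous_logarithm_on_contractible[of UNIV \<Phi>] cont nz contractible_UNIV by auto
  obtain G where G: "continuous_on UNIV G" "\<And>z. \<Psi> z = exp (G z)"
    using continuous_logarithm_on_contractible[of UNIV \<Psi>] cont nz contractible_UNIV by auto
  define \<gamma> :: "real \<Rightarrow> complex" where "\<gamma> t = exp (\<i> * of_real t)" for t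
  define h where "h t = G (1 / \<gamma> t) - F (\<gamma> t) - \<i> * of_real (of_int n * t)" for t
  have "c \<noteq> 0" using eq[of 1] nz by auto
  have exp_h: "exp (h t) = c" for t
  proof -
    have "exp (\<i> * of_real (of_int n * t)) = \<gamma> t powi n"
      unfolding \<gamma>_def exp_power_int by (simp add: mult_ac)
    then show ?thesis
      using eq[of "\<gamma> t"] nz[of "\<gamma> t"]
      by (simp add: h_def exp_diff F(2)[symmetric] G(2)[symmetric] \<gamma>_def)
  qed
  have cont_\<gamma>: "continuous_on UNIV \<gamma>" unfolding \<gamma>_def by (intro continuous_intros)
  have "continuous_on UNIV h"
    unfolding h_def
    by (intro continuous_intros continuous_on_compose2[OF F(1)] continuous_on_compose2[OF G(1)] cont_\<gamma>)
      (auto simp: \<gamma>_def)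
  then have "h constant_on UNIV"
  proof (rule continuous_discrete_range_constant[OF connected_UNIV])
    fix t :: real
    show "\<exists>e>0. \<forall>s. s \<in> UNIV \<and> h s \<noteq> h t \<longrightarrow> e \<le> norm (h s - h t)"
    proof (intro exI[of _ "2 * pi"] conjI allI impI)
      fix s assume s: "s \<in> UNIV \<and> h s \<noteq> h t"
      have "exp (h s) = exp (h t)" by (simp add: exp_h)
      then obtain l :: int where l: "h s = h t + (of_int (2 * l) * pi) * \<i>" unfolding exp_eq by blast
      then have "l \<noteq> 0" using s by auto
      then have "1 \<le> \<bar>l\<bar>" by linarith
      then have "1 \<le> real_of_int \<bar>l\<bar>" by linarith
      moreover have "norm (h s - h t) = 2 * pi * of_int \<bar>l\<bar>"
        using l by (simp add: norm_mult)
      ultimately show "2 * pi \<le> norm (h s - h t)" by simp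
    qed simp
  qed
  then have "h 0 = h (2 * pi)" unfolding constant_on_def by (metis UNIV_I)
  then have "of_int n * pi = 0" by (simp add: h_def \<gamma>_def exp_two_pi_i mult_ac)
  then show ?thesis by simp
qed

lemma prod_power_int:
  fixes z :: complex
  assumes "z \<noteq> 0" "finite A"
  shows "(\<Prod>i\<in>A. z powi f i) = z powi (\<Sum>i\<in>A. f i)"
  using assms(2) by induction (auto simp: power_int_add assms(1))

section \<open>Charts and local equations of curves\<close>

locale charted_surface =
  fixes S :: "'a surface"
  assumes surface: "complex_surface S"
begin

abbreviation X where "X \<equiv> surface_top S"

lemma chart_open: "\<kappa> \<in> charts S \<Longrightarrow> openin X (fst \<kappa>)"
  using surface unfolding complex_surface_def is_chart_def by blast

lemma chart_homeo:
  "\<kappa> \<in> charts S \<Longrightarrow> homeomorphic_map (subtopology X (fst \<kappa>)) (top_of_set (snd \<kappa> ` fst \<kappa>)) (snd \<kappa>)"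
  using surface unfolding complex_surface_def is_chart_def by blast

lemma chart_compatible: "\<kappa> \<in> charts S \<Longrightarrow> \<kappa>' \<in> charts S \<Longrightarrow> compatible \<kappa> \<kappa>'"
  using surface unfolding complex_surface_def by blast

lemma topspace_chart: "\<kappa> \<in> charts S \<Longrightarrow> topspace (subtopology X (fst \<kappa>)) = fst \<kappa>"
  using openin_subset[OF chart_open] by (simp add: inf.absorb2)

lemma chart_inj: "\<kappa> \<in> charts S \<Longrightarrow> inj_on (snd \<kappa>) (fst \<kappa>)"
  using homeomorphic_imp_injective_map[OF chart_homeo] topspace_chart by metis

lemma chart_inv_chart [simp]: "\<kappa> \<in> charts S \<Longrightarrow> x \<in> fst \<kappa> \<Longrightarrow> chart_inv \<kappa> (snd \<kappa> x) = x"
  unfolding chart_inv_def by (rule inv_into_f_f[OF chart_inj])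

lemma chart_continuous:
  "\<kappa> \<in> charts S \<Longrightarrow> continuous_map (subtopology X (fst \<kappa>)) euclidean (snd \<kappa>)"
  using homeomorphic_imp_continuous_map[OF chart_homeo] by (simp add: continuous_map_in_subtopology)

lemma chart_open_image:
  assumes "\<kappa> \<in> charts S" "openin X W" "W \<subseteq> fst \<kappa>"
  shows "open (snd \<kappa> ` W)"
proof -
  have "openin (subtopology X (fst \<kappa>)) W"
    using assms by (metis inf.absorb_iff2 inf_commute openin_subtopology)
  then have "openin (top_of_set (snd \<kappa> ` fst \<kappa>)) (snd \<kappa> ` W)"
    using homeomorphic_map_openness[OF chart_homeo[OF assms(1)], of W] topspace_chart[OF assms(1)] assms(3)
    by metis
  moreover have "open (snd \<kappa> ` fst \<kappa>)"
    using surface assms(1) unfolding complex_surface_def is_chart_def by blast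
  ultimately show ?thesis using openin_open_eq by blast
qed

lemma limitin_chart_inv:
  assumes "\<kappa> \<in> charts S" "p \<in> fst \<kappa>" and q: "(q \<longlongrightarrow> snd \<kappa> p) F"
  shows "limitin X (\<lambda>t. chart_inv \<kappa> (q t)) p F"
  unfolding limitin_def
proof (intro conjI allI impI)
  show "p \<in> topspace X" using assms chart_open openin_subset by blast
  fix U assume U: "openin X U \<and> p \<in> U"
  have "open (snd \<kappa> ` (U \<inter> fst \<kappa>))"
    using assms(1) U chart_open by (intro chart_open_image) (auto simp: openin_Int)
  then have "eventually (\<lambda>t. q t \<in> snd \<kappa> ` (U \<inter> fst \<kappa>)) F"
    using q U assms(2) topological_tendstoD by blast
  then show "eventually (\<lambda>t. chart_inv \<kappa> (q t) \<in> U) F"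
    by eventually_elim (use assms(1) in auto)
qed

lemma limitin_imp_eventually: "limitin X \<gamma> p F \<Longrightarrow> openin X W \<Longrightarrow> p \<in> W \<Longrightarrow> eventually (\<lambda>t. \<gamma> t \<in> W) F"
  unfolding limitin_def by blast

lemma continuous_map_tendsto:
  assumes "continuous_map (subtopology X W) euclidean f" "openin X W" "p \<in> W" "limitin X \<gamma> p F"
  shows "((\<lambda>t. f (\<gamma> t)) \<longlongrightarrow> f p) F"
proof -
  have "limitin (subtopology X W) \<gamma> p F"
    using assms limitin_imp_eventually by (auto simp: limitin_subtopology)
  then have "limitin euclidean (f \<circ> \<gamma>) (f p) F" by (rule continuous_map_limit[OF assms(1)])
  then show ?thesis by (simp add: comp_def)
qed

lemma continuous_map_chart:
  assumes "\<kappa> \<in> charts S" "openin X W" "W \<subseteq> fst \<kappa>"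
    and g: "\<And>x. x \<in> W \<Longrightarrow> isCont g (snd \<kappa> x)" and f: "\<And>x. x \<in> W \<Longrightarrow> f x = g (snd \<kappa> x)"
  shows "continuous_map (subtopology X W) euclidean f"
proof -
  have "continuous_map (subtopology X W) euclidean (snd \<kappa>)"
    using continuous_map_from_subtopology_mono[OF chart_continuous] assms by blast
  then have "continuous_map (subtopology X W) (top_of_set (snd \<kappa> ` W)) (snd \<kappa>)"
    by (auto simp: continuous_map_in_subtopology)
  moreover have "continuous_map (top_of_set (snd \<kappa> ` W)) euclidean g"
    using g by (auto intro!: continuous_at_imp_continuous_on)
  ultimately have "continuous_map (subtopology X W) euclidean (g \<circ> snd \<kappa>)"
    by (rule continuous_map_compose)
  then show ?thesis
    by (rule continuous_map_eq) (use f in auto)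
qed

lemma holomorphic_fun_subset: "holomorphic_fun S W f \<Longrightarrow> V \<subseteq> W \<Longrightarrow> holomorphic_fun S V f"
  unfolding holomorphic_fun_def by (meson Int_mono holomorphic2_subset image_mono order_refl)

lemma holomorphic_fun_chart:
  assumes "holomorphic_fun S W f" "\<kappa> \<in> charts S" "W \<subseteq> fst \<kappa>"
  shows "holomorphic2 (f \<circ> chart_inv \<kappa>) (snd \<kappa> ` W)"
  using assms unfolding holomorphic_fun_def by (metis inf.absorb_iff2)

lemma holomorphic_fun_continuous:
  assumes "holomorphic_fun S W f" "\<kappa> \<in> charts S" "openin X W" "W \<subseteq> fst \<kappa>"
  shows "continuous_map (subtopology X W) euclidean f"
  by (rule continuous_map_chart[OF assms(2-4), where g = "f \<circ> chart_inv \<kappa>"])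
    (use holomorphic2_isCont[OF holomorphic_fun_chart[OF assms(1,2,4)]] assms in auto)

lemma transition_chart:
  "\<kappa>' \<in> charts S \<Longrightarrow> x \<in> fst \<kappa>' \<Longrightarrow> transition \<kappa> \<kappa>' (snd \<kappa>' x) = snd \<kappa> x"
  unfolding transition_def by simp

lemma transition_holomorphic:
  assumes "\<kappa> \<in> charts S" "\<kappa>' \<in> charts S"
  shows "holomorphic2 (fst \<circ> transition \<kappa> \<kappa>') (snd \<kappa>' ` (fst \<kappa> \<inter> fst \<kappa>'))"
    "holomorphic2 (snd \<circ> transition \<kappa> \<kappa>') (snd \<kappa>' ` (fst \<kappa> \<inter> fst \<kappa>'))"
  using chart_compatible[OF assms] unfolding compatible_def by auto

lemma overlap_open:
  assumes "\<kappa> \<in> charts S" "\<kappa>' \<in> charts S"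
  shows "open (snd \<kappa>' ` (fst \<kappa> \<inter> fst \<kappa>'))"
  by (rule chart_open_image) (use assms chart_open in \<open>auto simp: openin_Int\<close>)

lemma holomorphic_fun_coordinates:
  assumes "\<kappa> \<in> charts S" "W \<subseteq> fst \<kappa>"
  shows "holomorphic_fun S W (\<lambda>x. fst (snd \<kappa> x))" "holomorphic_fun S W (\<lambda>x. snd (snd \<kappa> x))"
proof -
  have "(\<lambda>x. fst (snd \<kappa> x)) \<circ> chart_inv \<kappa>' = fst \<circ> transition \<kappa> \<kappa>'"
    "(\<lambda>x. snd (snd \<kappa> x)) \<circ> chart_inv \<kappa>' = snd \<circ> transition \<kappa> \<kappa>'" for \<kappa>'
    by (auto simp: transition_def)
  then show "holomorphic_fun S W (\<lambda>x. fst (snd \<kappa> x))" "holomorphic_fun S W (\<lambda>x. snd (snd \<kappa> x))"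
    unfolding holomorphic_fun_def
    using transition_holomorphic[OF assms(1)] holomorphic2_subset assms(2)
    by (metis (no_types, lifting) Int_commute Int_mono image_mono order_refl)+
qed

lemma jacobian_continuous:
  assumes "\<kappa> \<in> charts S" "\<kappa>' \<in> charts S" "openin X W" "W \<subseteq> fst \<kappa> \<inter> fst \<kappa>'"
  shows "continuous_map (subtopology X W) euclidean (jacobian \<kappa> \<kappa>')"
proof (rule continuous_map_chart[OF assms(2,3)])
  let ?T = "transition \<kappa> \<kappa>'"
  let ?g = "\<lambda>p. pd1 (fst \<circ> ?T) p * pd2 (snd \<circ> ?T) p - pd2 (fst \<circ> ?T) p * pd1 (snd \<circ> ?T) p"
  show "W \<subseteq> fst \<kappa>'" using assms by auto
  fix x assume "x \<in> W"
  then have x: "snd \<kappa>' x \<in> snd \<kappa>' ` (fst \<kappa> \<inter> fst \<kappa>')" using assms by auto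
  show "isCont ?g (snd \<kappa>' x)"
    using overlap_open[OF assms(1,2)] x transition_holomorphic[OF assms(1,2)]
    by (intro continuous_intros holomorphic2_pd1_isCont holomorphic2_pd2_isCont)
  show "jacobian \<kappa> \<kappa>' x = ?g (snd \<kappa>' x)" by (simp add: jacobian_def Let_def)
qed

text \<open>The Jacobian matrices of mutually inverse coordinate changes are mutually inverse.\<close>

lemma jacobian_nonzero:
  assumes \<kappa>: "\<kappa> \<in> charts S" and \<kappa>': "\<kappa>' \<in> charts S" and x: "x \<in> fst \<kappa> \<inter> fst \<kappa>'"
  shows "jacobian \<kappa> \<kappa>' x \<noteq> 0"
proof -
  define T T' where "T = transition \<kappa> \<kappa>'" and "T' = transition \<kappa>' \<kappa>"
  obtain x0 y0 where p: "snd \<kappa>' x = (x0, y0)" by fastforce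
  define G where "G = snd \<kappa>' ` (fst \<kappa> \<inter> fst \<kappa>')"
  have G: "open G" "(x0, y0) \<in> G"
    using overlap_open[OF \<kappa> \<kappa>'] x p by (auto simp: G_def intro!: image_eqI[of _ _ x])
  have T: "holomorphic2 (fst \<circ> T) G" "holomorphic2 (snd \<circ> T) G"
    using transition_holomorphic[OF \<kappa> \<kappa>'] by (auto simp: T_def G_def)
  have Tp: "T (x0, y0) = snd \<kappa> x" using transition_chart[OF \<kappa>'] x p by (metis IntD2 T_def)
  have "snd \<kappa> x \<in> snd \<kappa> ` (fst \<kappa>' \<inter> fst \<kappa>)" using x by auto
  then have T': "holomorphic2 (fst \<circ> T') {snd \<kappa> x}" "holomorphic2 (snd \<circ> T') {snd \<kappa> x}"
    using transition_holomorphic[OF \<kappa>' \<kappa>] holomorphic2_subset by (auto simp: T'_def)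
  have inv: "T' (T q) = q" if "q \<in> G" for q
    using that \<kappa> \<kappa>' by (auto simp: G_def T_def T'_def transition_chart)
  define a b c d where "a = pd1 (fst \<circ> T) (x0, y0)" and "b = pd2 (fst \<circ> T) (x0, y0)"
    and "c = pd1 (snd \<circ> T) (x0, y0)" and "d = pd2 (snd \<circ> T) (x0, y0)"
  define a' b' c' d' where "a' = pd1 (fst \<circ> T') (snd \<kappa> x)" and "b' = pd2 (fst \<circ> T') (snd \<kappa> x)"
    and "c' = pd1 (snd \<circ> T') (snd \<kappa> x)" and "d' = pd2 (snd \<circ> T') (snd \<kappa> x)"
  have chain: "f' = pd1 g (snd \<kappa> x) * x' + pd2 g (snd \<kappa> x) * y'"
    if g: "holomorphic2 g {snd \<kappa> x}" and q: "continuous_on UNIV q" "q z = (x0, y0)"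
      and x': "((\<lambda>w. fst (T (q w))) has_field_derivative x') (at z)"
      and y': "((\<lambda>w. snd (T (q w))) has_field_derivative y') (at z)"
      and f: "(f has_field_derivative f') (at z)" "\<And>w. q w \<in> G \<Longrightarrow> g (T (q w)) = f w"
    for f g f' x' y' q and z :: complex
  proof -
    have "((\<lambda>w. g (fst (T (q w)), snd (T (q w)))) has_field_derivative
        pd1 g (fst (T (q z)), snd (T (q z))) * x' + pd2 g (fst (T (q z)), snd (T (q z))) * y') (at z)"
      using q Tp by (intro holomorphic2_path[OF g _ x' y']) auto
    then have 1: "((\<lambda>w. g (T (q w))) has_field_derivative
        pd1 g (snd \<kappa> x) * x' + pd2 g (snd \<kappa> x) * y') (at z)"
      using q Tp by simp
    have "open (q -` G)" using G(1) q(1) by (simp add: open_vimage)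
    then have "(f has_field_derivative pd1 g (snd \<kappa> x) * x' + pd2 g (snd \<kappa> x) * y') (at z)"
      by (rule has_field_derivative_transform_within_open[OF 1]) (use q G f in auto)
    then show ?thesis using DERIV_unique f(1) by blast
  qed
  have 1: "((\<lambda>w. (fst \<circ> T) (w, y0)) has_field_derivative a * 1 + b * 0) (at x0)"
    unfolding a_def b_def
    by (rule holomorphic2_path[OF T(1)]) (use G in \<open>auto intro!: derivative_eq_intros\<close>)
  have 2: "((\<lambda>w. (snd \<circ> T) (w, y0)) has_field_derivative c * 1 + d * 0) (at x0)"
    unfolding c_def d_def
    by (rule holomorphic2_path[OF T(2)]) (use G in \<open>auto intro!: derivative_eq_intros\<close>)
  have 3: "((\<lambda>w. (fst \<circ> T) (x0, w)) has_field_derivative a * 0 + b * 1) (at y0)"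
    unfolding a_def b_def
    by (rule holomorphic2_path[OF T(1)]) (use G in \<open>auto intro!: derivative_eq_intros\<close>)
  have 4: "((\<lambda>w. (snd \<circ> T) (x0, w)) has_field_derivative c * 0 + d * 1) (at y0)"
    unfolding c_def d_def
    by (rule holomorphic2_path[OF T(2)]) (use G in \<open>auto intro!: derivative_eq_intros\<close>)
  have e1: "1 = a' * a + b' * c" unfolding a'_def b'_def
    by (rule chain[OF T'(1), of "\<lambda>w. (w, y0)" x0 _ _ "\<lambda>w. w"])
      (use 1 2 inv in \<open>auto intro!: continuous_intros\<close>)
  have e2: "0 = c' * a + d' * c" unfolding c'_def d'_def
    by (rule chain[OF T'(2), of "\<lambda>w. (w, y0)" x0 _ _ "\<lambda>w. y0"])
      (use 1 2 inv in \<open>auto intro!: continuous_intros\<close>)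
  have e3: "0 = a' * b + b' * d" unfolding a'_def b'_def
    by (rule chain[OF T'(1), of "\<lambda>w. (x0, w)" y0 _ _ "\<lambda>w. x0"])
      (use 3 4 inv in \<open>auto intro!: continuous_intros\<close>)
  have e4: "1 = c' * b + d' * d" unfolding c'_def d'_def
    by (rule chain[OF T'(2), of "\<lambda>w. (x0, w)" y0 _ _ "\<lambda>w. w"])
      (use 3 4 inv in \<open>auto intro!: continuous_intros\<close>)
  have "(a' * d' - b' * c') * (a * d - b * c)
      = (a' * a + b' * c) * (c' * b + d' * d) - (a' * b + b' * d) * (c' * a + d' * c)"
    by (simp add: algebra_simps)
  also have "\<dots> = 1" by (simp flip: e1 e2 e3 e4)
  finally have "a * d - b * c \<noteq> 0" by auto
  then show ?thesis
    by (simp add: jacobian_def Let_def a_def b_def c_def d_def T_def p mult_ac)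
qed

text \<open>At a node this exchanges the two branches. The atlas contains the swapped chart by maximality.\<close>

lemma swapped_chart:
  assumes \<kappa>: "\<kappa> \<in> charts S"
  shows "(fst \<kappa>, prod.swap \<circ> snd \<kappa>) \<in> charts S" (is "?\<kappa> \<in> _")
proof -
  have img: "snd ?\<kappa> ` U = prod.swap ` (snd \<kappa> ` U)" for U by auto
  have sw: "prod.swap ` U = prod.swap -` U" for U :: "(complex \<times> complex) set" by force
  have cont_sw: "continuous_on A (prod.swap :: complex \<times> complex \<Rightarrow> _)" for A
    unfolding prod.swap_def by (intro continuous_intros)
  have open_sw: "open (prod.swap ` U)" if "open U" for U :: "(complex \<times> complex) set"
    unfolding sw using that cont_sw by (simp add: open_vimage)
  have hsw: "homeomorphic_map (top_of_set U) (top_of_set (prod.swap ` U)) (prod.swap)"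
    for U :: "(complex \<times> complex) set"
    by (rule homeomorphic_maps_imp_map[of _ _ _ prod.swap])
      (auto simp: homeomorphic_maps_def cont_sw)
  have "is_chart X ?\<kappa>"
    unfolding is_chart_def
  proof (intro conjI)
    show "openin X (fst ?\<kappa>)" using chart_open[OF \<kappa>] by simp
    show "open (snd ?\<kappa> ` fst ?\<kappa>)"
      unfolding img using open_sw chart_open_image[OF \<kappa> chart_open[OF \<kappa>]] by simp
    show "homeomorphic_map (subtopology X (fst ?\<kappa>)) (top_of_set (snd ?\<kappa> ` fst ?\<kappa>)) (snd ?\<kappa>)"
      unfolding img using homeomorphic_map_compose[OF chart_homeo[OF \<kappa>] hsw] by simp
  qed
  moreover have "compatible ?\<kappa> \<kappa>'" if \<kappa>': "\<kappa>' \<in> charts S" for \<kappa>'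
  proof -
    have c: "compatible \<kappa> \<kappa>'" by (rule chart_compatible[OF \<kappa> \<kappa>'])
    have inv: "chart_inv ?\<kappa> p = chart_inv \<kappa> (prod.swap p)" if p: "p \<in> snd ?\<kappa> ` fst \<kappa>" for p
    proof -
      obtain x where x: "x \<in> fst \<kappa>" "p = prod.swap (snd \<kappa> x)" using p by auto
      have "inj_on (snd ?\<kappa>) (fst ?\<kappa>)"
        using chart_inj[OF \<kappa>] by (simp add: comp_inj_on inj_on_subset[OF inj_swap])
      then have "chart_inv ?\<kappa> p = x"
        unfolding chart_inv_def using inv_into_f_f[of "snd ?\<kappa>" "fst ?\<kappa>" x] x by auto
      then show ?thesis using x \<kappa> by simp
    qed
    let ?G = "snd \<kappa> ` (fst \<kappa> \<inter> fst \<kappa>')"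
    have eq: "transition \<kappa>' ?\<kappa> p = transition \<kappa>' \<kappa> (prod.swap p)" if "p \<in> prod.swap ` ?G" for p
      using inv[of p] that by (auto simp: transition_def)
    have op: "open (prod.swap ` ?G)"
      using open_sw overlap_open[OF \<kappa>' \<kappa>] by (simp add: Int_commute)
    have "holomorphic2 (g \<circ> transition \<kappa>' ?\<kappa>) (prod.swap ` ?G)"
      if "holomorphic2 (g \<circ> transition \<kappa>' \<kappa>) ?G" for g :: "complex \<times> complex \<Rightarrow> complex"
      using holomorphic2_swap[OF that] holomorphic2_cong[OF op, of "g \<circ> transition \<kappa>' ?\<kappa>"
          "(g \<circ> transition \<kappa>' \<kappa>) \<circ> prod.swap"] eq by simp
    moreover have "fst \<circ> transition ?\<kappa> \<kappa>' = snd \<circ> transition \<kappa> \<kappa>'"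
      "snd \<circ> transition ?\<kappa> \<kappa>' = fst \<circ> transition \<kappa> \<kappa>'"
      by (auto simp: transition_def)
    ultimately show ?thesis
      using c unfolding compatible_def img by simp
  qed
  ultimately show ?thesis
    using surface unfolding complex_surface_def by blast
qed

lemma local_eq_subset:
  assumes "local_eq S C W h" "openin X V" "V \<subseteq> W"
  shows "local_eq S C V h"
proof -
  have "{x \<in> V. h x = 0} = {x \<in> W. h x = 0} \<inter> V" using assms(3) by blast
  also have "\<dots> = C \<inter> V" using assms unfolding local_eq_def by blast
  finally show ?thesis
    using assms unfolding local_eq_def by (meson holomorphic_fun_subset subset_trans)
qed

lemma local_eq_divides:
  assumes "local_eq S C W h" "openin X V" "V \<subseteq> W" "holomorphic_fun S V f" "\<And>x. x \<in> C \<inter> V \<Longrightarrow> f x = 0"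
    and "\<kappa> \<in> charts S" "V \<subseteq> fst \<kappa>"
  obtains k where "holomorphic_fun S V k" "continuous_map (subtopology X V) euclidean k"
    "\<And>x. x \<in> V \<Longrightarrow> f x = k x * h x"
proof -
  obtain k where k: "holomorphic_fun S V k" "\<forall>x\<in>V. f x = k x * h x"
    using assms(1-5) unfolding local_eq_def by blast
  moreover have "continuous_map (subtopology X V) euclidean k"
    using holomorphic_fun_continuous k(1) assms by blast
  ultimately show thesis using that by blast
qed

lemma limitin_chart_path:
  assumes "\<kappa> \<in> charts S" "p \<in> fst \<kappa>" "isCont q z" "q z = snd \<kappa> p"
  shows "limitin X (\<lambda>t. chart_inv \<kappa> (q t)) p (at z)"
  by (rule limitin_chart_inv) (use assms in \<open>auto simp: isCont_def\<close>)

lemma path_limitin: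
  assumes "holomorphic_path S u"
  shows "limitin X u (u z) (at z)"
proof -
  have c: "continuous_map euclidean X u" using assms by (simp add: holomorphic_path_def)
  have "limitin euclidean (\<lambda>x. x) z (at z)" by simp
  from continuous_map_limit[OF c this] show ?thesis by (simp add: comp_def)
qed

lemma path_open_vimage:
  assumes "holomorphic_path S u" "openin X W"
  shows "open (u -` W)"
  using assms openin_continuous_map_preimage[of euclidean X u W]
  by (simp add: holomorphic_path_def vimage_def)

lemma path_coordinates_holomorphic:
  assumes "holomorphic_path S u" "\<kappa> \<in> charts S" "W \<subseteq> fst \<kappa>"
  shows "(\<lambda>z. fst (snd \<kappa> (u z))) holomorphic_on u -` W"
    "(\<lambda>z. snd (snd \<kappa> (u z))) holomorphic_on u -` W"
  using assms unfolding holomorphic_path_def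
  by (meson holomorphic_on_subset vimage_mono)+

text \<open>Leaving a normal crossing along the diagonal of a chart shows that the complement of such
  a curve is dense.\<close>

lemma complement_approach:
  assumes nc: "\<And>p. p \<in> M \<Longrightarrow> smooth_at S M p \<or> node_at S M p" and p: "p \<in> topspace X"
  obtains \<gamma> :: "complex \<Rightarrow> 'a" where "limitin X \<gamma> p (at 0)" "eventually (\<lambda>t. \<gamma> t \<notin> M) (at 0)"
proof (cases "p \<in> M")
  case False
  show ?thesis by (rule that[of "\<lambda>_. p"]) (use False p in auto)
next
  case True
  then obtain \<kappa> where \<kappa>: "\<kappa> \<in> charts S" "p \<in> fst \<kappa>" "snd \<kappa> p = (0, 0)"
    and M: "M \<inter> fst \<kappa> = {x \<in> fst \<kappa>. snd (snd \<kappa> x) = 0} \<or>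
            M \<inter> fst \<kappa> = {x \<in> fst \<kappa>. fst (snd \<kappa> x) * snd (snd \<kappa> x) = 0}"
    using nc[OF True] unfolding smooth_at_def node_at_def by blast
  define \<gamma> where "\<gamma> t = chart_inv \<kappa> (t, t)" for t
  have lim: "limitin X \<gamma> p (at 0)"
    unfolding \<gamma>_def using \<kappa> by (intro limitin_chart_path) (auto intro!: continuous_intros)
  have "open (snd \<kappa> ` fst \<kappa>)" using \<kappa> chart_open chart_open_image by blast
  moreover have "((\<lambda>t. (t, t)) \<longlongrightarrow> snd \<kappa> p) (at (0::complex))"
    unfolding \<kappa>(3) by (intro tendsto_intros)
  moreover have "snd \<kappa> p \<in> snd \<kappa> ` fst \<kappa>" using \<kappa>(2) by blast
  ultimately have "eventually (\<lambda>t. (t, t) \<in> snd \<kappa> ` fst \<kappa>) (at (0::complex))"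
    using topological_tendstoD by blast
  moreover have "eventually (\<lambda>t. t \<noteq> 0) (at (0::complex))"
    by (simp add: eventually_at_filter)
  ultimately have "eventually (\<lambda>t. \<gamma> t \<notin> M) (at 0)"
  proof eventually_elim
    case (elim t)
    then obtain x where x: "x \<in> fst \<kappa>" "snd \<kappa> x = (t, t)" by auto
    then have "\<gamma> t = x" unfolding \<gamma>_def using \<kappa>(1) chart_inv_chart by metis
    have "x \<notin> M"
    proof
      assume "x \<in> M"
      then have "x \<in> M \<inter> fst \<kappa>" using x by blast
      then have "snd (snd \<kappa> x) = 0 \<or> fst (snd \<kappa> x) * snd (snd \<kappa> x) = 0" using M by blast
      then show False using x elim by simp
    qed
    then show ?case using \<open>\<gamma> t = x\<close> by simp
  qed
  then show ?thesis using that lim by blast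
qed

text \<open>Along a path crossing the curve the product \<open>k * h\<close> has a simple zero, which is
  already taken up by \<open>h\<close>.\<close>

lemma quotient_of_local_eq_nonzero:
  assumes h: "local_eq S C W h" and \<kappa>: "\<kappa> \<in> charts S" "W \<subseteq> fst \<kappa>"
    and k: "continuous_map (subtopology X W) euclidean k" and p: "p \<in> C \<inter> W"
    and x: "(x has_field_derivative x') (at z)" and y: "(y has_field_derivative y') (at z)"
    and xy: "(x z, y z) = snd \<kappa> p"
    and eq: "\<And>q w. q \<in> W \<Longrightarrow> snd \<kappa> q = (x w, y w) \<Longrightarrow> k q * h q = (w - z) * r" and "r \<noteq> 0"
  shows "k p \<noteq> 0"
proof -
  have W: "openin X W" and hW: "holomorphic_fun S W h" and "h p = 0"
    using h p unfolding local_eq_def by auto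
  let ?q = "\<lambda>w. chart_inv \<kappa> (x w, y w)"
  have p\<kappa>: "p \<in> fst \<kappa>" using p \<kappa> by auto
  have cont: "isCont (\<lambda>w. (x w, y w)) z"
    using x y by (intro isCont_Pair DERIV_isCont)
  have lim: "limitin X ?q p (at z)"
    using limitin_chart_path[OF \<kappa>(1) p\<kappa> cont xy] .
  have G: "open (snd \<kappa> ` W)" by (rule chart_open_image[OF \<kappa>(1) W \<kappa>(2)])
  have "((\<lambda>w. (h \<circ> chart_inv \<kappa>) (x w, y w)) has_field_derivative
      pd1 (h \<circ> chart_inv \<kappa>) (x z, y z) * x' + pd2 (h \<circ> chart_inv \<kappa>) (x z, y z) * y') (at z)"
    by (rule holomorphic2_path[OF holomorphic_fun_chart[OF hW \<kappa>] _ x y]) (use p xy in auto)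
  moreover have "(h \<circ> chart_inv \<kappa>) (x z, y z) = 0" using xy \<kappa>(1) p\<kappa> \<open>h p = 0\<close> by simp
  moreover have "((\<lambda>w. k (?q w)) \<longlongrightarrow> k p) (at z)"
    using continuous_map_tendsto[OF k W _ lim] p by blast
  moreover have "eventually (\<lambda>w. (x w, y w) \<in> snd \<kappa> ` W) (at z)"
    using cont G p xy unfolding isCont_def by (intro topological_tendstoD) auto
  then have "eventually (\<lambda>w. (w - z) * r = k (?q w) * (h \<circ> chart_inv \<kappa>) (x w, y w)) (at z)"
  proof eventually_elim
    case (elim w)
    then obtain q where q: "q \<in> W" "snd \<kappa> q = (x w, y w)" by auto
    then have "?q w = q" using \<kappa> chart_inv_chart by (metis subsetD)
    then show ?case using eq[OF q] by simp
  qed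
  ultimately show ?thesis
    using \<open>r \<noteq> 0\<close> by (rule quotient_nonzero_at_simple_zero)
qed

lemma quotient_nonzero_on_axis:
  assumes h: "local_eq S D W h" and \<kappa>: "\<kappa> \<in> charts S" "W \<subseteq> fst \<kappa>"
    and k: "continuous_map (subtopology X W) euclidean k" and p: "p \<in> D \<inter> W"
  shows "\<lbrakk>snd (snd \<kappa> p) = 0; g (fst (snd \<kappa> p)) \<noteq> 0;
      \<And>x. x \<in> W \<Longrightarrow> k x * h x = g (fst (snd \<kappa> x)) * snd (snd \<kappa> x)\<rbrakk> \<Longrightarrow> k p \<noteq> 0"
    and "\<lbrakk>fst (snd \<kappa> p) = 0; g (snd (snd \<kappa> p)) \<noteq> 0;
      \<And>x. x \<in> W \<Longrightarrow> k x * h x = fst (snd \<kappa> x) * g (snd (snd \<kappa> x))\<rbrakk> \<Longrightarrow> k p \<noteq> 0"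
proof -
  assume *: "snd (snd \<kappa> p) = 0" "g (fst (snd \<kappa> p)) \<noteq> 0"
    "\<And>x. x \<in> W \<Longrightarrow> k x * h x = g (fst (snd \<kappa> x)) * snd (snd \<kappa> x)"
  show "k p \<noteq> 0"
    by (rule quotient_of_local_eq_nonzero[OF h \<kappa> k p, of "\<lambda>w. fst (snd \<kappa> p)" 0 0 "\<lambda>w. w" 1 "g (fst (snd \<kappa> p))"])
      (use * in \<open>auto simp: prod_eq_iff mult_ac\<close>)
next
  assume *: "fst (snd \<kappa> p) = 0" "g (snd (snd \<kappa> p)) \<noteq> 0"
    "\<And>x. x \<in> W \<Longrightarrow> k x * h x = fst (snd \<kappa> x) * g (snd (snd \<kappa> x))"
  show "k p \<noteq> 0"
    by (rule quotient_of_local_eq_nonzero[OF h \<kappa> k p, of "\<lambda>w. w" 1 0 "\<lambda>w. snd (snd \<kappa> p)" 0 "g (snd (snd \<kappa> p))"])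
      (use * in \<open>auto simp: prod_eq_iff mult_ac\<close>)
qed

lemma holomorphic_fun_mult:
  assumes "holomorphic_fun S W f" "holomorphic_fun S W g"
  shows "holomorphic_fun S W (\<lambda>x. f x * g x)"
  using assms holomorphic2_mult unfolding holomorphic_fun_def comp_def by blast

text \<open>Off the node this is the case of an axis. The node itself would be an isolated zero
  of \<open>k\<close>, which a holomorphic function of two variables does not have.\<close>

lemma node_quotient_nonzero:
  assumes \<kappa>: "\<kappa> \<in> charts S" "W \<subseteq> fst \<kappa>" and h: "local_eq S D W h"
    and D: "D \<inter> W = {x \<in> W. fst (snd \<kappa> x) * snd (snd \<kappa> x) = 0}"
    and k: "holomorphic_fun S W k" "\<And>x. x \<in> W \<Longrightarrow> fst (snd \<kappa> x) * snd (snd \<kappa> x) = k x * h x"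
    and q: "q \<in> W"
  shows "k q \<noteq> 0"
proof -
  have W: "openin X W" using h by (simp add: local_eq_def)
  note axis = quotient_nonzero_on_axis[OF h \<kappa> holomorphic_fun_continuous[OF k(1) \<kappa>(1) W \<kappa>(2)]]
  have off_node: "k x \<noteq> 0" if x: "x \<in> W" and x0: "snd \<kappa> x \<noteq> (0, 0)" for x
  proof (cases "x \<in> D")
    case True
    then have "x \<in> {x \<in> W. fst (snd \<kappa> x) * snd (snd \<kappa> x) = 0}" using D x by blast
    then consider "snd (snd \<kappa> x) = 0" "fst (snd \<kappa> x) \<noteq> 0" | "fst (snd \<kappa> x) = 0" "snd (snd \<kappa> x) \<noteq> 0"
      using x0 by (auto simp: prod_eq_iff)
    then show ?thesis
    proof cases
      case 1
      show ?thesis by (rule axis(1)[where g = "\<lambda>z. z"]) (use True x 1 k(2)[symmetric] in simp_all)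
    next
      case 2
      show ?thesis by (rule axis(2)[where g = "\<lambda>z. z"]) (use True x 2 k(2)[symmetric] in simp_all)
    qed
  next
    case False
    then have "fst (snd \<kappa> x) * snd (snd \<kappa> x) \<noteq> 0" using D x by blast
    then show ?thesis using k(2)[OF x] by auto
  qed
  show ?thesis
  proof (cases "snd \<kappa> q = (0, 0)")
    case True
    let ?k = "k \<circ> chart_inv \<kappa>"
    have "?k (0, 0) \<noteq> 0"
    proof (rule holomorphic2_no_isolated_zero[OF holomorphic_fun_chart[OF k(1) \<kappa>]])
      show "open (snd \<kappa> ` W)" by (rule chart_open_image[OF \<kappa>(1) W \<kappa>(2)])
      show "(0, 0) \<in> snd \<kappa> ` W" using q True by (intro image_eqI[of _ _ q]) auto
      fix y assume "y \<in> snd \<kappa> ` W" "y \<noteq> (0, 0)"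
      then obtain x where x: "x \<in> W" "y = snd \<kappa> x" "snd \<kappa> x \<noteq> (0, 0)" by blast
      then have "?k y = k x" using chart_inv_chart[OF \<kappa>(1)] \<kappa>(2) by auto
      then show "?k y \<noteq> 0" using off_node x by simp
    qed
    moreover have "chart_inv \<kappa> (0, 0) = q" using chart_inv_chart[OF \<kappa>(1), of q] \<kappa>(2) q True by auto
    ultimately show ?thesis by simp
  qed (use off_node q in blast)
qed

end

section \<open>Sections of powers of the determinant of the tangent bundle\<close>

text \<open>The data behind the equation \<open>- K = \<Sum> (n C / N) * C\<close>: a section \<open>\<tau>\<close> of \<open>(det T)\<^sup>N\<close> with
  divisor \<open>\<Sum> n C * C\<close>. Normal crossings make the complement of the maximal curve dense.\<close>

locale det_tangent_section = charted_surface S for S :: "'a surface" +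
  fixes N :: nat and n :: "'a set \<Rightarrow> int" and \<tau> :: "'a chart \<Rightarrow> 'a \<Rightarrow> complex"
  assumes finite_curves: "finite (rational_curves S)"
    and normal_crossing: "\<And>p. p \<in> maximal_curve S \<Longrightarrow>
          smooth_at S (maximal_curve S) p \<or> node_at S (maximal_curve S) p"
    and section_change: "\<And>\<kappa> \<kappa>' x. \<kappa> \<in> charts S \<Longrightarrow> \<kappa>' \<in> charts S \<Longrightarrow>
          x \<in> fst \<kappa> \<inter> fst \<kappa>' - maximal_curve S \<Longrightarrow> \<tau> \<kappa> x = jacobian \<kappa> \<kappa>' x ^ N * \<tau> \<kappa>' x"
    and section_local: "\<And>p. p \<in> topspace (surface_top S) \<Longrightarrow>
          \<exists>\<kappa>\<in>charts S. \<exists>W h \<epsilon>. p \<in> W \<and> W \<subseteq> fst \<kappa> \<and>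
           openin (surface_top S) W \<and>
           (\<forall>C\<in>rational_curves S. local_eq S C W (h C)) \<and>
           continuous_map (subtopology (surface_top S) W) euclidean \<epsilon> \<and> (\<forall>x\<in>W. \<epsilon> x \<noteq> 0) \<and>
           (\<forall>x\<in>W - maximal_curve S. \<tau> \<kappa> x = \<epsilon> x * (\<Prod>C\<in>rational_curves S. h C x powi n C))"
begin

abbreviation RC where "RC \<equiv> rational_curves S"
abbreviation M where "M \<equiv> maximal_curve S"

definition trivializes ::
  "'a chart \<Rightarrow> 'a set \<Rightarrow> ('a set \<Rightarrow> 'a \<Rightarrow> complex) \<Rightarrow> ('a \<Rightarrow> complex) \<Rightarrow> bool" where
  "trivializes \<kappa> W h \<epsilon> \<longleftrightarrow> \<kappa> \<in> charts S \<and> W \<subseteq> fst \<kappa> \<and> openin X W \<and>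
     (\<forall>C\<in>RC. local_eq S C W (h C)) \<and>
     continuous_map (subtopology X W) euclidean \<epsilon> \<and> (\<forall>x\<in>W. \<epsilon> x \<noteq> 0) \<and>
     (\<forall>x\<in>W - M. \<tau> \<kappa> x = \<epsilon> x * (\<Prod>C\<in>RC. h C x powi n C))"

lemma trivializes_subset:
  assumes "trivializes \<kappa> W h \<epsilon>" "openin X V" "V \<subseteq> W"
  shows "trivializes \<kappa> V h \<epsilon>"
  using assms local_eq_subset continuous_map_from_subtopology_mono unfolding trivializes_def by blast

text \<open>The chart in which \<open>\<tau>\<close> is known to be a unit times a product of local equations can be exchanged
  for any other one, because the Jacobian determinant is a unit.\<close>

lemma trivializes_in_chart:
  assumes \<kappa>: "\<kappa> \<in> charts S" and p: "p \<in> fst \<kappa>"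
  obtains W h \<epsilon> where "p \<in> W" "trivializes \<kappa> W h \<epsilon>"
proof -
  have "p \<in> topspace X" using openin_subset[OF chart_open[OF \<kappa>]] p by blast
  from section_local[OF this] obtain \<kappa>0 W0 h \<epsilon>0 where *: "p \<in> W0" "trivializes \<kappa>0 W0 h \<epsilon>0"
    unfolding trivializes_def by blast
  define W where "W = W0 \<inter> fst \<kappa>"
  define \<epsilon> where "\<epsilon> x = jacobian \<kappa> \<kappa>0 x ^ N * \<epsilon>0 x" for x
  have W: "openin X W" "W \<subseteq> W0"
    using * chart_open[OF \<kappa>] unfolding W_def trivializes_def by (auto simp: openin_Int)
  have W0: "trivializes \<kappa>0 W h \<epsilon>0" using trivializes_subset[OF *(2) W] .
  then have \<kappa>0: "\<kappa>0 \<in> charts S" and sub: "W \<subseteq> fst \<kappa> \<inter> fst \<kappa>0"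
    by (auto simp: trivializes_def W_def)
  have "continuous_map (subtopology X W) euclidean \<epsilon>"
    using jacobian_continuous[OF \<kappa> \<kappa>0 W(1) sub] W0
    unfolding continuous_map_atin \<epsilon>_def trivializes_def by (auto intro!: tendsto_intros)
  moreover have "\<epsilon> x \<noteq> 0" if "x \<in> W" for x
    using that W0 jacobian_nonzero[OF \<kappa> \<kappa>0, of x] sub unfolding \<epsilon>_def trivializes_def by auto
  moreover have "\<tau> \<kappa> x = \<epsilon> x * (\<Prod>C\<in>RC. h C x powi n C)" if "x \<in> W - M" for x
  proof -
    have "\<tau> \<kappa> x = jacobian \<kappa> \<kappa>0 x ^ N * \<tau> \<kappa>0 x"
      using that sub by (intro section_change \<kappa> \<kappa>0) auto
    then show ?thesis using that W0 by (simp add: \<epsilon>_def trivializes_def)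
  qed
  ultimately have "trivializes \<kappa> W h \<epsilon>"
    using W0 \<kappa> sub unfolding trivializes_def by auto
  then show thesis using * p by (intro that[of W h \<epsilon>]) (auto simp: W_def)
qed

text \<open>The functions \<open>e C\<close> are the quotients of the local equations. The relation between the units
  holds off the maximal curve, and extends to it because its complement is dense.\<close>

lemma trivializes_change:
  assumes 1: "trivializes \<kappa> W h \<epsilon>" and 2: "trivializes \<kappa>' W' h' \<epsilon>'" and p: "p \<in> W \<inter> W'"
  obtains e where "\<And>C. C \<in> RC \<Longrightarrow> continuous_map (subtopology X (W \<inter> W')) euclidean (e C)"
    "\<And>C x. C \<in> RC \<Longrightarrow> x \<in> W \<inter> W' \<Longrightarrow> h C x = e C x * h' C x"
    "(\<And>C. C \<in> RC \<Longrightarrow> e C p \<noteq> 0) \<Longrightarrow>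
       \<epsilon> p * (\<Prod>C\<in>RC. e C p powi n C) = jacobian \<kappa> \<kappa>' p ^ N * \<epsilon>' p"
proof -
  define V where "V = W \<inter> W'"
  have \<kappa>: "\<kappa> \<in> charts S" and \<kappa>': "\<kappa>' \<in> charts S" and V: "openin X V" "V \<subseteq> fst \<kappa> \<inter> fst \<kappa>'"
    using 1 2 by (auto simp: trivializes_def V_def openin_Int)
  have "\<exists>k. continuous_map (subtopology X V) euclidean k \<and> (\<forall>x\<in>V. h C x = k x * h' C x)"
    if C: "C \<in> RC" for C
  proof -
    have h: "local_eq S C W (h C)" and h': "local_eq S C W' (h' C)"
      using 1 2 C by (auto simp: trivializes_def)
    obtain k where "holomorphic_fun S V k" "continuous_map (subtopology X V) euclidean k"
      "\<And>x. x \<in> V \<Longrightarrow> h C x = k x * h' C x"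
    proof (rule local_eq_divides[OF h' V(1), of "h C" \<kappa>])
      show "V \<subseteq> W'" by (simp add: V_def)
      show "holomorphic_fun S V (h C)"
        using h holomorphic_fun_subset[of W "h C" V] by (auto simp: local_eq_def V_def)
      show "h C x = 0" if "x \<in> C \<inter> V" for x
        using h that unfolding local_eq_def V_def by blast
    qed (use \<kappa> V in auto)
    then show ?thesis by blast
  qed
  then obtain e where e: "\<And>C. C \<in> RC \<Longrightarrow> continuous_map (subtopology X V) euclidean (e C)"
    "\<And>C x. C \<in> RC \<Longrightarrow> x \<in> V \<Longrightarrow> h C x = e C x * h' C x"
    by metis
  have "\<epsilon> p * (\<Prod>C\<in>RC. e C p powi n C) = jacobian \<kappa> \<kappa>' p ^ N * \<epsilon>' p"
    if nz: "\<And>C. C \<in> RC \<Longrightarrow> e C p \<noteq> 0"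
  proof -
    have pV: "p \<in> V" using p by (simp add: V_def)
    then have "p \<in> topspace X" using openin_subset[OF V(1)] by blast
    then obtain \<gamma> :: "complex \<Rightarrow> 'a" where
      \<gamma>: "limitin X \<gamma> p (at 0)" "eventually (\<lambda>t. \<gamma> t \<notin> M) (at 0)"
      using complement_approach[OF normal_crossing] by blast
    have ct: "continuous_map (subtopology X V) euclidean f \<Longrightarrow> ((\<lambda>t. f (\<gamma> t)) \<longlongrightarrow> f p) (at 0)"
      for f :: "'a \<Rightarrow> complex"
      using continuous_map_tendsto[OF _ V(1) pV \<gamma>(1)] .
    have \<epsilon>: "continuous_map (subtopology X V) euclidean \<epsilon>" "continuous_map (subtopology X V) euclidean \<epsilon>'"
      using continuous_map_from_subtopology_mono[of X W euclidean \<epsilon> V]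
        continuous_map_from_subtopology_mono[of X W' euclidean \<epsilon>' V] 1 2
      by (simp_all add: trivializes_def V_def)
    have L: "((\<lambda>t. \<epsilon> (\<gamma> t) * (\<Prod>C\<in>RC. e C (\<gamma> t) powi n C)) \<longlongrightarrow>
        \<epsilon> p * (\<Prod>C\<in>RC. e C p powi n C)) (at 0)"
      using nz by (intro tendsto_intros tendsto_prod ct \<epsilon> e(1))
    have R: "((\<lambda>t. jacobian \<kappa> \<kappa>' (\<gamma> t) ^ N * \<epsilon>' (\<gamma> t)) \<longlongrightarrow> jacobian \<kappa> \<kappa>' p ^ N * \<epsilon>' p) (at 0)"
      by (intro tendsto_intros ct \<epsilon> jacobian_continuous \<kappa> \<kappa>' V)
    have "eventually (\<lambda>t. \<gamma> t \<in> V) (at 0)" using limitin_imp_eventually[OF \<gamma>(1) V(1) pV] .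
    with \<gamma>(2) have "eventually (\<lambda>t. \<epsilon> (\<gamma> t) * (\<Prod>C\<in>RC. e C (\<gamma> t) powi n C) =
        jacobian \<kappa> \<kappa>' (\<gamma> t) ^ N * \<epsilon>' (\<gamma> t)) (at 0)"
    proof eventually_elim
      case (elim t)
      define q where "q = \<gamma> t"
      have q: "q \<in> W - M" "q \<in> W' - M" "q \<in> V" using elim by (auto simp: V_def q_def)
      have h'q: "h' C q \<noteq> 0" if "C \<in> RC" for C
        using 2 q that unfolding trivializes_def local_eq_def maximal_curve_def by blast
      have "\<epsilon> q * (\<Prod>C\<in>RC. h C q powi n C) = jacobian \<kappa> \<kappa>' q ^ N * (\<epsilon>' q * (\<Prod>C\<in>RC. h' C q powi n C))"
        using section_change[OF \<kappa> \<kappa>', of q] 1 2 q V(2) unfolding trivializes_def by auto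
      also have "(\<Prod>C\<in>RC. h C q powi n C) = (\<Prod>C\<in>RC. e C q powi n C) * (\<Prod>C\<in>RC. h' C q powi n C)"
        unfolding prod.distrib[symmetric] using e(2) q(3)
        by (intro prod.cong) (auto simp: power_int_mult_distrib)
      finally have "\<epsilon> q * (\<Prod>C\<in>RC. e C q powi n C) * (\<Prod>C\<in>RC. h' C q powi n C) =
          jacobian \<kappa> \<kappa>' q ^ N * \<epsilon>' q * (\<Prod>C\<in>RC. h' C q powi n C)" by (simp add: mult_ac)
      moreover have "(\<Prod>C\<in>RC. h' C q powi n C) \<noteq> 0"
        using h'q finite_curves by (simp add: prod_zero_iff)
      ultimately show ?case unfolding q_def[symmetric] by simp
    qed
    then have "((\<lambda>t. jacobian \<kappa> \<kappa>' (\<gamma> t) ^ N * \<epsilon>' (\<gamma> t)) \<longlongrightarrow> \<epsilon> p * (\<Prod>C\<in>RC. e C p powi n C)) (at 0)"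
      by (rule Lim_transform_eventually[OF L])
    then show ?thesis using tendsto_unique[OF _ _ R] by simp
  qed
  with e show thesis using that unfolding V_def by blast
qed

text \<open>The unit \<open>k\<close> converts coordinates of sections of \<open>O(D)\<close> with respect to the local equation \<open>h D\<close> into
  coordinates with respect to the equation given by the second coordinate of the chart.\<close>

definition adapted ::
  "'a set \<Rightarrow> 'a chart \<Rightarrow> 'a set \<Rightarrow> ('a set \<Rightarrow> 'a \<Rightarrow> complex) \<Rightarrow> ('a \<Rightarrow> complex) \<Rightarrow> ('a \<Rightarrow> complex) \<Rightarrow> bool" where
  "adapted D \<kappa> W h \<epsilon> k \<longleftrightarrow> trivializes \<kappa> W h \<epsilon> \<and> D \<inter> W = {x \<in> W. snd (snd \<kappa> x) = 0} \<and>
     continuous_map (subtopology X W) euclidean k \<and>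
     (\<forall>x\<in>W. k x \<noteq> 0 \<and> snd (snd \<kappa> x) = k x * h D x)"

lemma adaptedD:
  assumes "adapted D \<kappa> W h \<epsilon> k"
  shows "\<kappa> \<in> charts S" "W \<subseteq> fst \<kappa>" "openin X W" "trivializes \<kappa> W h \<epsilon>"
    "\<And>C. C \<in> RC \<Longrightarrow> local_eq S C W (h C)" "continuous_map (subtopology X W) euclidean \<epsilon>"
    "\<And>x. x \<in> W \<Longrightarrow> \<epsilon> x \<noteq> 0" "\<And>x. x \<in> W \<Longrightarrow> x \<in> D \<longleftrightarrow> snd (snd \<kappa> x) = 0"
    "continuous_map (subtopology X W) euclidean k" "\<And>x. x \<in> W \<Longrightarrow> k x \<noteq> 0"
    "\<And>x. x \<in> W \<Longrightarrow> snd (snd \<kappa> x) = k x * h D x"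
  using assms unfolding adapted_def trivializes_def by blast+

lemma adapted_exists:
  assumes D: "D \<in> RC" and p: "p \<in> D" and sm: "smooth_at S D p"
  obtains \<kappa> W h \<epsilon> k where "p \<in> W" "adapted D \<kappa> W h \<epsilon> k"
proof -
  obtain \<kappa> where \<kappa>: "\<kappa> \<in> charts S" "p \<in> fst \<kappa>" "D \<inter> fst \<kappa> = {x \<in> fst \<kappa>. snd (snd \<kappa> x) = 0}"
    using sm unfolding smooth_at_def by blast
  obtain W h \<epsilon> where W: "p \<in> W" "trivializes \<kappa> W h \<epsilon>" using trivializes_in_chart[OF \<kappa>(1,2)] by blast
  then have W': "openin X W" "W \<subseteq> fst \<kappa>" and h: "local_eq S D W (h D)"
    using D by (auto simp: trivializes_def)
  have DW: "D \<inter> W = {x \<in> W. snd (snd \<kappa> x) = 0}" using \<kappa>(3) W'(2) by blast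
  obtain k where k: "holomorphic_fun S W k" "continuous_map (subtopology X W) euclidean k"
    "\<And>x. x \<in> W \<Longrightarrow> snd (snd \<kappa> x) = k x * h D x"
    by (rule local_eq_divides[OF h W'(1) _ holomorphic_fun_coordinates(2)[OF \<kappa>(1) W'(2)] _ \<kappa>(1) W'(2)])
      (use DW in auto)
  have "k x \<noteq> 0" if x: "x \<in> W" for x
  proof (cases "x \<in> D")
    case True
    then have "snd (snd \<kappa> x) = 0" using x DW by blast
    then show ?thesis
      by (intro quotient_nonzero_on_axis(1)[OF h \<kappa>(1) W'(2) k(2), of x "\<lambda>_. 1"])
        (simp_all add: x True k(3)[symmetric])
  next
    case False
    then have "snd (snd \<kappa> x) \<noteq> 0" using DW x by blast
    then show ?thesis using k(3)[OF x] by auto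
  qed
  then have "adapted D \<kappa> W h \<epsilon> k"
    using W DW k by (simp add: adapted_def)
  then show thesis using that W by blast
qed

end

section \<open>Comparison with the conormal frame along a parametrized curve\<close>

text \<open>One affine half of the normalization of \<open>D\<close>, with frames of the pulled back line bundles.\<close>

locale parametrized_curve = det_tangent_section S N n \<tau>
  for S :: "'a surface" and N n \<tau> +
  fixes D :: "'a set" and u :: "complex \<Rightarrow> 'a"
    and s :: "'a set \<Rightarrow> 'a set \<times> ('a \<Rightarrow> complex) \<Rightarrow> complex \<Rightarrow> complex"
  assumes curve: "D \<in> rational_curves S" and path: "holomorphic_path S u" and inj: "inj u"
    and range_u: "range u \<subseteq> D"
    and frames: "\<And>C. C \<in> rational_curves S \<Longrightarrow> frame_of_divisor S C u (s C)"
begin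

lemma frame_nonzero: "C \<in> RC \<Longrightarrow> local_eq S C W h \<Longrightarrow> u z \<in> W \<Longrightarrow> s C (W, h) z \<noteq> 0"
  using frames unfolding frame_of_divisor_def by blast

lemma frame_continuous: "C \<in> RC \<Longrightarrow> local_eq S C W h \<Longrightarrow> continuous_on (u -` W) (s C (W, h))"
  using frames unfolding frame_of_divisor_def by blast

lemma frame_change:
  assumes "C \<in> RC" "local_eq S C W h" "local_eq S C W' h'"
    "continuous_map (subtopology X (W \<inter> W')) euclidean e"
    "\<And>x. x \<in> W \<inter> W' \<Longrightarrow> h x = e x * h' x" "u z \<in> W \<inter> W'"
  shows "s C (W, h) z = e (u z) * s C (W', h') z"
  using frames[OF assms(1)] assms(2-) unfolding frame_of_divisor_def by blast

text \<open>Where \<open>u\<close> runs in the first axis, its first coordinate inherits injectivity, and an injective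
  holomorphic function is an immersion.\<close>

lemma first_coordinate_deriv_nonzero:
  assumes \<kappa>: "\<kappa> \<in> charts S" "B \<subseteq> u -` fst \<kappa>" "open B" "z \<in> B"
    and y0: "\<And>w. w \<in> B \<Longrightarrow> snd (snd \<kappa> (u w)) = 0"
  shows "deriv (\<lambda>w. fst (snd \<kappa> (u w))) z \<noteq> 0" "inj_on (\<lambda>w. fst (snd \<kappa> (u w))) B"
proof -
  show inj': "inj_on (\<lambda>w. fst (snd \<kappa> (u w))) B"
  proof (rule inj_onI)
    fix v w assume "v \<in> B" "w \<in> B" "fst (snd \<kappa> (u v)) = fst (snd \<kappa> (u w))"
    then have "snd \<kappa> (u v) = snd \<kappa> (u w)" "u v \<in> fst \<kappa>" "u w \<in> fst \<kappa>"
      using y0 \<kappa>(2) by (auto simp: prod_eq_iff)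
    then have "u v = u w" using inj_onD[OF chart_inj[OF \<kappa>(1)]] by blast
    then show "v = w" using inj by (simp add: inj_eq)
  qed
  have "(\<lambda>w. fst (snd \<kappa> (u w))) holomorphic_on B"
    using path_coordinates_holomorphic(1)[OF path \<kappa>(1) order_refl] \<kappa>(2) holomorphic_on_subset by blast
  then show "deriv (\<lambda>w. fst (snd \<kappa> (u w))) z \<noteq> 0"
    using holomorphic_injective_imp_regular \<kappa> inj' by blast
qed

lemma frame_isCont:
  assumes "C \<in> RC" "local_eq S C W h" "u z \<in> W"
  shows "isCont (s C (W, h)) z"
proof -
  have "open (u -` W)" using path_open_vimage[OF path] assms(2) by (simp add: local_eq_def)
  then show ?thesis
    using frame_continuous[OF assms(1,2)] assms(3) by (simp add: continuous_on_eq_continuous_at)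
qed

lemma function_isCont:
  fixes f :: "'a \<Rightarrow> complex"
  assumes "continuous_map (subtopology X W) euclidean f" "openin X W" "u z \<in> W"
  shows "isCont (\<lambda>w. f (u w)) z"
  unfolding isCont_def by (rule continuous_map_tendsto[OF assms path_limitin[OF path]])

lemma frames_prod_isCont:
  assumes "trivializes \<kappa> W h \<epsilon>" "u z \<in> W"
  shows "isCont (\<lambda>z. \<Prod>C\<in>RC. s C (W, h C) z powi n C) z"
proof -
  have "isCont (s C (W, h C)) z" "s C (W, h C) z \<noteq> 0" if "C \<in> RC" for C
    using frame_isCont frame_nonzero that assms unfolding trivializes_def by blast+
  then show ?thesis
    unfolding isCont_def by (intro tendsto_prod tendsto_power_int) (auto simp: isCont_def)
qed

lemma first_coordinate_deriv_isCont:
  assumes "\<kappa> \<in> charts S" "u z \<in> fst \<kappa>"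
  shows "isCont (deriv (\<lambda>w. fst (snd \<kappa> (u w)))) z"
proof -
  have o: "open (u -` fst \<kappa>)" by (rule path_open_vimage[OF path chart_open[OF assms(1)]])
  have "deriv (\<lambda>w. fst (snd \<kappa> (u w))) holomorphic_on u -` fst \<kappa>"
    by (rule holomorphic_deriv[OF path_coordinates_holomorphic(1)[OF path assms(1) order_refl] o])
  then show ?thesis
    using o assms(2) continuous_on_eq_continuous_at holomorphic_on_imp_continuous_on by blast
qed

text \<open>The numerator is the coordinate of the section of \<open>(det T)\<^sup>N\<close> that is obtained from \<open>\<tau>\<close> by replacing local
  equations with frames. In the denominator, \<open>k * s D\<close> is the coordinate of the frame
  of the normal bundle of \<open>D\<close> with respect to the equation given by the second coordinate; its
  product with the derivative of the first coordinate is the coordinate of a section of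
  \<open>det T = TD \<otimes> O(D)\<close> along \<open>D\<close>.\<close>

definition ratio ::
  "'a chart \<Rightarrow> 'a set \<Rightarrow> ('a set \<Rightarrow> 'a \<Rightarrow> complex) \<Rightarrow> ('a \<Rightarrow> complex) \<Rightarrow> ('a \<Rightarrow> complex) \<Rightarrow> complex \<Rightarrow> complex" where
  "ratio \<kappa> W h \<epsilon> k z = \<epsilon> (u z) * (\<Prod>C\<in>RC. s C (W, h C) z powi n C) /
     (deriv (\<lambda>w. fst (snd \<kappa> (u w))) z * k (u z) * s D (W, h D) z) ^ N"

lemma adapted_path:
  assumes "adapted D \<kappa> W h \<epsilon> k"
  shows "open (u -` W)" "(\<lambda>w. fst (snd \<kappa> (u w))) holomorphic_on u -` W"
    "u z \<in> W \<Longrightarrow> snd (snd \<kappa> (u z)) = 0"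
    "u z \<in> W \<Longrightarrow> deriv (\<lambda>w. fst (snd \<kappa> (u w))) z \<noteq> 0"
proof -
  note a = adaptedD[OF assms]
  show o: "open (u -` W)" by (rule path_open_vimage[OF path a(3)])
  show "(\<lambda>w. fst (snd \<kappa> (u w))) holomorphic_on u -` W"
    using path_coordinates_holomorphic(1)[OF path] a by blast
  have y: "snd (snd \<kappa> (u z)) = 0" if "u z \<in> W" for z
    using a(8)[OF that] range_u by blast
  then show "u z \<in> W \<Longrightarrow> snd (snd \<kappa> (u z)) = 0" .
  show "deriv (\<lambda>w. fst (snd \<kappa> (u w))) z \<noteq> 0" if "u z \<in> W"
    by (rule first_coordinate_deriv_nonzero[OF a(1) _ o]) (use that a(2) y in auto)
qed

lemma ratio_nonzero:
  assumes ad: "adapted D \<kappa> W h \<epsilon> k" and z: "u z \<in> W"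
  shows "ratio \<kappa> W h \<epsilon> k z \<noteq> 0"
  using adaptedD[OF ad] adapted_path[OF ad] frame_nonzero z finite_curves curve
  by (auto simp: ratio_def prod_zero_iff)

lemma ratio_isCont:
  assumes ad: "adapted D \<kappa> W h \<epsilon> k" and z: "u z \<in> W"
  shows "isCont (ratio \<kappa> W h \<epsilon> k) z"
proof -
  note a = adaptedD[OF ad] and b = adapted_path[OF ad]
  show ?thesis
    unfolding ratio_def
    using a(10)[OF z] b(4)[OF z] frame_nonzero[OF curve a(5)[OF curve] z]
    by (intro continuous_intros frames_prod_isCont[OF a(4) z] function_isCont[OF a(6,3) z]
        function_isCont[OF a(9,3) z] first_coordinate_deriv_isCont[OF a(1)]
        frame_isCont[OF curve a(5)[OF curve] z]) (use z a(2) in auto)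
qed

text \<open>Along \<open>D\<close> the Jacobian matrix is triangular, so its determinant is the product of the factor by
  which tangent vectors of \<open>D\<close> change and the factor by which normal vectors change.\<close>

lemma conormal_change:
  assumes 1: "adapted D \<kappa> W h \<epsilon> k" and 2: "adapted D \<kappa>' W' h' \<epsilon>' k'" and z: "u z \<in> W \<inter> W'"
    and e: "continuous_map (subtopology X (W \<inter> W')) euclidean e"
      "\<And>x. x \<in> W \<inter> W' \<Longrightarrow> h D x = e x * h' D x"
  shows "deriv (\<lambda>w. fst (snd \<kappa> (u w))) z * k (u z) * e (u z) =
    jacobian \<kappa> \<kappa>' (u z) * (deriv (\<lambda>w. fst (snd \<kappa>' (u w))) z * k' (u z))"
proof -
  note a1 = adaptedD[OF 1] and a2 = adaptedD[OF 2]
  note b1 = adapted_path[OF 1] and b2 = adapted_path[OF 2]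
  define V where "V = W \<inter> W'"
  have V: "openin X V" "V \<subseteq> fst \<kappa>" "V \<subseteq> fst \<kappa>'" "u z \<in> V"
    using a1(2,3) a2(2,3) z by (auto simp: V_def openin_Int)
  define T where "T = transition \<kappa> \<kappa>'"
  define p where "p = u z"
  obtain x0 where x0: "snd \<kappa>' p = (x0, 0)"
    using b2(3)[of z] z by (metis IntD2 p_def prod.collapse)
  define G where "G = snd \<kappa>' ` V"
  have G: "open G" "(x0, 0) \<in> G"
    using chart_open_image[OF a2(1) V(1,3)] V(4) x0 by (auto simp: G_def p_def intro!: image_eqI[of _ _ p])
  have T: "holomorphic2 (fst \<circ> T) G" "holomorphic2 (snd \<circ> T) G"
    using transition_holomorphic[OF a1(1) a2(1)] V holomorphic2_subset
    by (auto simp: T_def G_def intro!: holomorphic2_subset[where H = "snd \<kappa>' ` V"] image_mono)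
  have TV: "T (snd \<kappa>' q) = snd \<kappa> q" if "q \<in> V" for q
    unfolding T_def using transition_chart[OF a2(1)] V(3) that by blast
  define a b c d where "a = pd1 (fst \<circ> T) (x0, 0)" and "b = pd2 (fst \<circ> T) (x0, 0)"
    and "c = pd1 (snd \<circ> T) (x0, 0)" and "d = pd2 (snd \<circ> T) (x0, 0)"
  \<comment> \<open>The coordinate change preserves the curve, given by the vanishing of the second coordinate.\<close>
  have "c = 0"
  proof -
    have "((\<lambda>w. (snd \<circ> T) (w, 0)) has_field_derivative c * 1 + d * 0) (at x0)"
      unfolding c_def d_def
      by (rule holomorphic2_path[OF T(2)]) (use G in \<open>auto intro!: derivative_eq_intros\<close>)
    moreover have "open ((\<lambda>w. (w, 0)) -` G)"
      using G(1) by (intro open_vimage) (auto intro!: continuous_intros)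
    moreover have "(snd \<circ> T) (w, 0) = 0" if "w \<in> (\<lambda>w. (w, 0)) -` G" for w
    proof -
      obtain q where q: "q \<in> V" "snd \<kappa>' q = (w, 0)" using \<open>w \<in> _\<close> by (auto simp: G_def)
      then have "q \<in> D" using a2(8)[of q] by (simp add: V_def)
      then show ?thesis using a1(8)[of q] TV[OF q(1)] q by (simp add: V_def)
    qed
    ultimately have "((\<lambda>w. 0) has_field_derivative c * 1 + d * 0) (at x0)"
      using has_field_derivative_transform_within_open[of "\<lambda>w. (snd \<circ> T) (w, 0)" _ x0 "(\<lambda>w. (w, 0)) -` G" "\<lambda>w. 0"] G(2)
      by auto
    from DERIV_unique[OF this DERIV_const] show ?thesis by simp
  qed
  define x' where "x' = deriv (\<lambda>w. fst (snd \<kappa>' (u w))) z"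
  have x'_der: "((\<lambda>w. fst (snd \<kappa>' (u w))) has_field_derivative x') (at z)"
    unfolding x'_def using b2(1,2) z by (intro holomorphic_derivI) auto
  have "deriv (\<lambda>w. fst (snd \<kappa> (u w))) z = a * x'"
  proof -
    have xz: "fst (snd \<kappa>' (u z)) = x0" using x0 by (simp add: p_def)
    have "((\<lambda>w. (fst \<circ> T) (fst (snd \<kappa>' (u w)), 0)) has_field_derivative
        pd1 (fst \<circ> T) (fst (snd \<kappa>' (u z)), 0) * x' + pd2 (fst \<circ> T) (fst (snd \<kappa>' (u z)), 0) * 0) (at z)"
      by (rule holomorphic2_path[OF T(1) _ x'_der]) (use G xz in auto)
    then have "((\<lambda>w. (fst \<circ> T) (fst (snd \<kappa>' (u w)), 0)) has_field_derivative a * x') (at z)"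
      by (simp add: xz a_def)
    then have "((\<lambda>w. fst (snd \<kappa> (u w))) has_field_derivative a * x') (at z)"
    proof (rule has_field_derivative_transform_within_open[of _ _ _ "u -` V"])
      show "open (u -` V)" by (rule path_open_vimage[OF path V(1)])
      show "z \<in> u -` V" using V(4) by simp
      fix w assume "w \<in> u -` V"
      then have w: "u w \<in> V" by simp
      then have "snd \<kappa>' (u w) = (fst (snd \<kappa>' (u w)), 0)"
        using b2(3)[of w] by (simp add: V_def prod_eq_iff)
      then show "(fst \<circ> T) (fst (snd \<kappa>' (u w)), 0) = fst (snd \<kappa> (u w))"
        using TV[OF w] by (metis comp_apply)
    qed
    then show ?thesis by (rule DERIV_imp_deriv)
  qed
  moreover have "d * k' p = k p * e p"
  proof -
    have der: "((\<lambda>w. (snd \<circ> T) (x0, w)) has_field_derivative c * 0 + d * 1) (at 0)"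
      unfolding c_def d_def
      by (rule holomorphic2_path[OF T(2)]) (use G in \<open>auto intro!: derivative_eq_intros\<close>)
    define Y where "Y w = snd (T (x0, w))" for w
    have "Y 0 = 0" using TV[OF V(4)] x0 b1(3)[of z] z by (simp add: Y_def p_def)
    then have Ylim: "((\<lambda>w. Y w / w) \<longlongrightarrow> d) (at 0)"
      using der by (simp add: has_field_derivative_iff Y_def)
    let ?q = "\<lambda>w. chart_inv \<kappa>' (x0, w)"
    have pV: "p \<in> V" "p \<in> W" "p \<in> W'" "p \<in> fst \<kappa>'" using V z by (auto simp: p_def)
    have lim: "limitin X ?q p (at 0)"
      using limitin_chart_path[OF a2(1) pV(4), where q = "\<lambda>w. (x0, w)" and z = 0] x0 by (auto intro!: continuous_intros)
    have L: "((\<lambda>w. Y w / w * k' (?q w)) \<longlongrightarrow> d * k' p) (at 0)"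
      by (intro tendsto_mult Ylim continuous_map_tendsto[OF a2(9,3) pV(3) lim])
    have R: "((\<lambda>w. k (?q w) * e (?q w)) \<longlongrightarrow> k p * e p) (at 0)"
      using continuous_map_tendsto[OF a1(9,3) pV(2) lim]
        continuous_map_tendsto[OF e(1)[folded V_def] V(1) pV(1) lim] by (rule tendsto_mult)
    have "eventually (\<lambda>w. Y w / w * k' (?q w) = k (?q w) * e (?q w)) (at 0)"
    proof -
      have "((\<lambda>w. (x0, w)) \<longlongrightarrow> (x0, 0)) (at (0::complex))" by (intro tendsto_intros)
      then have "eventually (\<lambda>w. (x0, w) \<in> G) (at 0)" using G topological_tendstoD by blast
      moreover have "eventually (\<lambda>w. w \<noteq> 0) (at (0::complex))" by (simp add: eventually_at_filter)
      ultimately show ?thesis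
      proof eventually_elim
        case (elim w)
        then obtain q where q: "q \<in> V" "snd \<kappa>' q = (x0, w)" by (auto simp: G_def)
        then have q': "q \<in> W" "q \<in> W'" "q \<in> fst \<kappa>'" using V(3) by (auto simp: V_def)
        have qq: "?q w = q" using chart_inv_chart[OF a2(1) q'(3)] q(2) by simp
        have "Y w = k q * h D q" using TV[OF q(1)] q(2) a1(11)[OF q'(1)] by (simp add: Y_def)
        moreover have "w = k' q * h' D q" using a2(11)[OF q'(2)] q(2) by simp
        ultimately have "Y w * k' q = k q * e q * w" using e(2)[of q] q' by simp
        then show ?case unfolding qq using elim by (simp add: field_simps)
      qed
    qed
    from tendsto_unique[OF at_neq_bot Lim_transform_eventually[OF L this] R] show ?thesis .
  qed
  moreover have "jacobian \<kappa> \<kappa>' p = a * d"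
    using \<open>c = 0\<close> x0 by (simp add: jacobian_def Let_def a_def b_def c_def d_def T_def)
  ultimately show ?thesis by (simp add: p_def x'_def mult_ac)
qed

lemma ratio_unique:
  assumes 1: "adapted D \<kappa> W h \<epsilon> k" and 2: "adapted D \<kappa>' W' h' \<epsilon>' k'" and z: "u z \<in> W" "u z \<in> W'"
  shows "ratio \<kappa> W h \<epsilon> k z = ratio \<kappa>' W' h' \<epsilon>' k' z"
proof -
  note a1 = adaptedD[OF 1] and a2 = adaptedD[OF 2]
  have zz: "u z \<in> W \<inter> W'" using z by simp
  let ?p = "u z" and ?J = "jacobian \<kappa> \<kappa>' (u z)"
  obtain e where e: "\<And>C. C \<in> RC \<Longrightarrow> continuous_map (subtopology X (W \<inter> W')) euclidean (e C)"
    "\<And>C x. C \<in> RC \<Longrightarrow> x \<in> W \<inter> W' \<Longrightarrow> h C x = e C x * h' C x"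
    "(\<And>C. C \<in> RC \<Longrightarrow> e C ?p \<noteq> 0) \<Longrightarrow> \<epsilon> ?p * (\<Prod>C\<in>RC. e C ?p powi n C) = ?J ^ N * \<epsilon>' ?p"
    using trivializes_change[OF a1(4) a2(4) zz] by blast
  have s: "s C (W, h C) z = e C ?p * s C (W', h' C) z" if "C \<in> RC" for C
    by (rule frame_change[OF that a1(5)[OF that] a2(5)[OF that] e(1)[OF that] e(2)[OF that] zz])
  have "e C ?p \<noteq> 0" if "C \<in> RC" for C
    using frame_nonzero[OF that a1(5)[OF that] z(1)] s[OF that] by auto
  then have num: "\<epsilon> ?p * (\<Prod>C\<in>RC. s C (W, h C) z powi n C) =
      ?J ^ N * (\<epsilon>' ?p * (\<Prod>C\<in>RC. s C (W', h' C) z powi n C))"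
    using e(3) by (simp add: s power_int_mult_distrib prod.distrib mult_ac cong: prod.cong)
  have den: "deriv (\<lambda>w. fst (snd \<kappa> (u w))) z * k ?p * s D (W, h D) z =
      ?J * (deriv (\<lambda>w. fst (snd \<kappa>' (u w))) z * k' ?p * s D (W', h' D) z)"
    using conormal_change[OF 1 2 zz e(1)[OF curve] e(2)[OF curve]] s[OF curve] by (simp add: mult_ac)
  have "?J \<noteq> 0" using jacobian_nonzero[OF a1(1) a2(1), of ?p] z a1(2) a2(2) by blast
  then show ?thesis unfolding ratio_def num den by (simp add: power_mult_distrib)
qed

text \<open>The common value of the ratios in all adapted charts around \<open>u z\<close>.\<close>

definition \<phi> :: "complex \<Rightarrow> complex" where
  "\<phi> z = (SOME r. \<exists>\<kappa> W h \<epsilon> k. adapted D \<kappa> W h \<epsilon> k \<and> u z \<in> W \<and> r = ratio \<kappa> W h \<epsilon> k z)"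

lemma \<phi>_eq:
  assumes "adapted D \<kappa> W h \<epsilon> k" "u z \<in> W"
  shows "\<phi> z = ratio \<kappa> W h \<epsilon> k z"
proof -
  have "\<exists>\<kappa>' W' h' \<epsilon>' k'. adapted D \<kappa>' W' h' \<epsilon>' k' \<and> u z \<in> W' \<and> \<phi> z = ratio \<kappa>' W' h' \<epsilon>' k' z"
    unfolding \<phi>_def by (rule someI_ex) (use assms in blast)
  then show ?thesis using ratio_unique assms by metis
qed

lemma \<phi>_smooth_point:
  assumes "smooth_at S D (u z)"
  shows "\<phi> z \<noteq> 0" "isCont \<phi> z"
proof -
  have "u z \<in> D" using range_u by blast
  then obtain \<kappa> W h \<epsilon> k where ad: "u z \<in> W" "adapted D \<kappa> W h \<epsilon> k"
    by (rule adapted_exists[OF curve _ assms])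
  show "\<phi> z \<noteq> 0" using \<phi>_eq[OF ad(2,1)] ratio_nonzero[OF ad(2,1)] by simp
  have "eventually (\<lambda>w. \<phi> w = ratio \<kappa> W h \<epsilon> k w) (nhds z)"
    unfolding eventually_nhds
    by (rule exI[of _ "u -` W"]) (use adapted_path(1)[OF ad(2)] ad(1) \<phi>_eq[OF ad(2)] in simp)
  then show "isCont \<phi> z"
    using ratio_isCont[OF ad(2,1)] isCont_cong by blast
qed

text \<open>Near a node \<open>{x y = 0}\<close> let \<open>u\<close> run in the axis \<open>{y = 0}\<close>. For \<open>z \<noteq> 0\<close> the unit \<open>k\<close> with
  \<open>y = k h\<close> is \<open>K/x\<close>, with a unit \<open>K\<close> such that \<open>x y = K h\<close>. Since \<open>x (u z)\<close> has a simple zero at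
  \<open>z = 0\<close>, the denominator of the ratio has a pole of order \<open>N\<close>.\<close>

lemma \<phi>_node:
  assumes node: "node_at S D (u 0)"
  shows "\<exists>L. L \<noteq> 0 \<and> ((\<lambda>z. \<phi> z / z ^ N) \<longlongrightarrow> L) (at 0)"
proof -
  define p where "p = u 0"
  obtain \<kappa>0 where \<kappa>0: "\<kappa>0 \<in> charts S" "p \<in> fst \<kappa>0" "snd \<kappa>0 p = (0, 0)"
    "D \<inter> fst \<kappa>0 = {x \<in> fst \<kappa>0. fst (snd \<kappa>0 x) * snd (snd \<kappa>0 x) = 0}"
    using node unfolding node_at_def p_def by blast
  have "open (u -` fst \<kappa>0)" "0 \<in> u -` fst \<kappa>0"
    using path_open_vimage[OF path chart_open[OF \<kappa>0(1)]] \<kappa>0(2) by (auto simp: p_def)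
  then obtain r where r: "r > 0" "ball 0 r \<subseteq> u -` fst \<kappa>0" by (metis open_contains_ball)
  define B0 where "B0 = ball (0::complex) r"
  have "(\<forall>z\<in>B0. fst (snd \<kappa>0 (u z)) = 0) \<or> (\<forall>z\<in>B0. snd (snd \<kappa>0 (u z)) = 0)"
  proof (rule holomorphic_product_zero)
    show "(\<lambda>z. fst (snd \<kappa>0 (u z))) holomorphic_on B0" "(\<lambda>z. snd (snd \<kappa>0 (u z))) holomorphic_on B0"
      using path_coordinates_holomorphic[OF path \<kappa>0(1) order_refl] r(2) holomorphic_on_subset
      unfolding B0_def by blast+
    show "open B0" "connected B0" by (auto simp: B0_def)
    fix z assume "z \<in> B0"
    then have "u z \<in> fst \<kappa>0" "u z \<in> D" using r(2) range_u by (auto simp: B0_def)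
    then show "fst (snd \<kappa>0 (u z)) * snd (snd \<kappa>0 (u z)) = 0" using \<kappa>0(4) by blast
  qed
  \<comment> \<open>Exchanging the coordinates if necessary, the branch parametrized near the origin is the first axis.\<close>
  then obtain \<kappa> where \<kappa>: "\<kappa> \<in> charts S" "fst \<kappa> = fst \<kappa>0" "snd \<kappa> p = (0, 0)"
    "D \<inter> fst \<kappa> = {x \<in> fst \<kappa>. fst (snd \<kappa> x) * snd (snd \<kappa> x) = 0}"
    and y0: "\<And>z. z \<in> B0 \<Longrightarrow> snd (snd \<kappa> (u z)) = 0"
  proof
    assume *: "\<forall>z\<in>B0. fst (snd \<kappa>0 (u z)) = 0"
    show thesis
      by (rule that[OF swapped_chart[OF \<kappa>0(1)]]) (use \<kappa>0 * in \<open>auto simp: mult.commute\<close>)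
  next
    assume *: "\<forall>z\<in>B0. snd (snd \<kappa>0 (u z)) = 0"
    show thesis by (rule that[OF \<kappa>0(1)]) (use \<kappa>0 * in auto)
  qed
  have "p \<in> fst \<kappa>" using \<kappa> \<kappa>0 by simp
  then obtain W h \<epsilon> where W: "p \<in> W" "trivializes \<kappa> W h \<epsilon>"
    using trivializes_in_chart[OF \<kappa>(1)] by blast
  then have W': "openin X W" "W \<subseteq> fst \<kappa>" and h: "\<And>C. C \<in> RC \<Longrightarrow> local_eq S C W (h C)"
    and \<epsilon>: "continuous_map (subtopology X W) euclidean \<epsilon>" "\<And>x. x \<in> W \<Longrightarrow> \<epsilon> x \<noteq> 0"
    by (auto simp: trivializes_def)
  have hD: "local_eq S D W (h D)" by (rule h[OF curve])
  have DW: "D \<inter> W = {x \<in> W. fst (snd \<kappa> x) * snd (snd \<kappa> x) = 0}" using \<kappa>(4) W'(2) by blast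
  note coords = holomorphic_fun_coordinates[OF \<kappa>(1) W'(2)]
  obtain k where k: "holomorphic_fun S W k" "continuous_map (subtopology X W) euclidean k"
    "\<And>x. x \<in> W \<Longrightarrow> fst (snd \<kappa> x) * snd (snd \<kappa> x) = k x * h D x"
    by (rule local_eq_divides[OF hD W'(1) _ holomorphic_fun_mult[OF coords] _ \<kappa>(1) W'(2)])
      (use DW in auto)
  have k0: "k x \<noteq> 0" if "x \<in> W" for x
    by (rule node_quotient_nonzero[OF \<kappa>(1) W'(2) hD DW k(1,3) that])

  \<comment> \<open>Away from the node the first axis is the zero set of the second coordinate alone.\<close>
  define W1 where "W1 = {x \<in> W. fst (snd \<kappa> x) \<noteq> 0}"
  have cx: "continuous_map (subtopology X W) euclidean (\<lambda>x. fst (snd \<kappa> x))"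
    by (rule holomorphic_fun_continuous[OF coords(1) \<kappa>(1) W'])
  have W1: "openin X W1" "W1 \<subseteq> W"
  proof -
    have "openin (subtopology X W) {x \<in> topspace (subtopology X W). fst (snd \<kappa> x) \<in> - {0}}"
      by (rule openin_continuous_map_preimage[OF cx]) auto
    moreover have "topspace (subtopology X W) = W" using openin_subset[OF W'(1)] by auto
    ultimately have "openin (subtopology X W) W1" by (simp only: W1_def Compl_iff singleton_iff)
    then show "openin X W1" using openin_open_subtopology[OF W'(1)] by blast
    show "W1 \<subseteq> W" by (auto simp: W1_def)
  qed
  define k1 where "k1 x = k x / fst (snd \<kappa> x)" for x
  have ad: "adapted D \<kappa> W1 h \<epsilon> k1"
    unfolding adapted_def
  proof (intro conjI ballI)
    show "trivializes \<kappa> W1 h \<epsilon>" by (rule trivializes_subset[OF W(2) W1])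
    show "D \<inter> W1 = {x \<in> W1. snd (snd \<kappa> x) = 0}"
      using DW by (auto simp: W1_def set_eq_iff)
    have "continuous_map (subtopology X W1) euclidean k"
      "continuous_map (subtopology X W1) euclidean (\<lambda>x. fst (snd \<kappa> x))"
      using continuous_map_from_subtopology_mono[OF _ W1(2)] k(2) cx by auto
    then show "continuous_map (subtopology X W1) euclidean k1"
      unfolding continuous_map_atin k1_def by (auto intro!: tendsto_divide simp: W1_def)
    fix x assume x: "x \<in> W1"
    then show "k1 x \<noteq> 0" using k0 by (auto simp: k1_def W1_def)
    show "snd (snd \<kappa> x) = k1 x * h D x"
      using x k(3)[of x] by (auto simp: k1_def W1_def field_simps)
  qed

  define x where "x w = fst (snd \<kappa> (u w))" for w
  define B where "B = B0 \<inter> u -` W"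
  have B: "open B" "0 \<in> B" "B \<subseteq> u -` fst \<kappa>" "B \<subseteq> B0"
    using path_open_vimage[OF path W'(1)] W(1) W'(2) r(1) by (auto simp: B_def B0_def p_def)
  have yB: "snd (snd \<kappa> (u w)) = 0" if "w \<in> B" for w using y0 that B(4) by blast
  have x_inj: "inj_on x B" and x'0: "deriv x 0 \<noteq> 0"
    using first_coordinate_deriv_nonzero[OF \<kappa>(1) B(3,1,2) yB] by (auto simp: x_def[abs_def])
  have x0: "x 0 = 0" using \<kappa>(3) by (simp add: x_def p_def)
  have x_nz: "x w \<noteq> 0" if "w \<in> B" "w \<noteq> 0" for w
    using inj_onD[OF x_inj, of w 0] x0 that B(2) by auto
  have "x holomorphic_on B"
    using path_coordinates_holomorphic(1)[OF path \<kappa>(1) order_refl] B(3) holomorphic_on_subset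
    unfolding x_def[abs_def] by blast
  then have "(x has_field_derivative deriv x 0) (at 0)"
    using B by (intro holomorphic_derivI) auto
  then have xlim: "((\<lambda>w. x w / w) \<longlongrightarrow> deriv x 0) (at 0)"
    using x0 by (simp add: has_field_derivative_iff)
  define R where "R w = \<epsilon> (u w) * (\<Prod>C\<in>RC. s C (W, h C) w powi n C) /
     (deriv x w * k (u w) * inverse (x w / w) * s D (W, h D) w) ^ N" for w
  define L where "L = \<epsilon> (u 0) * (\<Prod>C\<in>RC. s C (W, h C) 0 powi n C) /
     (deriv x 0 * k (u 0) * inverse (deriv x 0) * s D (W, h D) 0) ^ N"
  have u0: "u 0 \<in> W" using W(1) by (simp add: p_def)
  have s0: "s C (W, h C) 0 \<noteq> 0" if "C \<in> RC" for C by (rule frame_nonzero[OF that h[OF that] u0])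
  have L0: "L \<noteq> 0"
    using \<epsilon>(2) k0 s0 curve x'0 u0 finite_curves by (auto simp: L_def prod_zero_iff)
  have lim: "(R \<longlongrightarrow> L) (at 0)"
  proof -
    have u0\<kappa>: "u 0 \<in> fst \<kappa>" using u0 W'(2) by blast
    have sC: "(s C (W, h C) \<longlongrightarrow> s C (W, h C) 0) (at 0)" if "C \<in> RC" for C
      using frame_isCont[OF that h[OF that] u0] by (simp add: isCont_def)
    have "((\<lambda>w. \<epsilon> (u w)) \<longlongrightarrow> \<epsilon> (u 0)) (at 0)" "((\<lambda>w. k (u w)) \<longlongrightarrow> k (u 0)) (at 0)"
      "(deriv x \<longlongrightarrow> deriv x 0) (at 0)"
      using function_isCont[OF \<epsilon>(1) W'(1) u0] function_isCont[OF k(2) W'(1) u0]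
        first_coordinate_deriv_isCont[OF \<kappa>(1) u0\<kappa>]
      by (simp_all add: isCont_def x_def[abs_def])
    then show ?thesis
      unfolding R_def[abs_def] L_def using x'0 k0[OF u0] s0 curve xlim sC
      by (intro tendsto_intros) auto
  qed
  have "eventually (\<lambda>w. R w = \<phi> w / w ^ N) (at 0)"
  proof -
    have "eventually (\<lambda>w. w \<in> B) (at 0)" using B by (intro eventually_at_in_open') auto
    moreover have "eventually (\<lambda>w. w \<noteq> 0) (at (0::complex))" by (simp add: eventually_at_filter)
    ultimately show ?thesis
    proof eventually_elim
      case (elim w)
      have w1: "u w \<in> W1" using elim x_nz by (auto simp: W1_def B_def x_def)
      have s1: "s C (W1, h C) w = s C (W, h C) w" if "C \<in> RC" for C
        using frame_change[OF that local_eq_subset[OF h[OF that] W1] h[OF that], of "\<lambda>_. 1" w] w1 W1(2)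
        by auto
      have "\<phi> w = ratio \<kappa> W1 h \<epsilon> k1 w" by (rule \<phi>_eq[OF ad w1])
      also have "\<dots> = \<epsilon> (u w) * (\<Prod>C\<in>RC. s C (W, h C) w powi n C) /
          (deriv x w * (k (u w) / x w) * s D (W, h D) w) ^ N"
        by (simp add: ratio_def k1_def x_def[abs_def] s1 curve)
      finally show ?case
        using elim by (simp add: R_def power_mult_distrib power_divide power_inverse mult_ac)
    qed
  qed
  from Lim_transform_eventually[OF lim this] L0 show ?thesis by blast
qed

lemma \<phi>_nodal_curve:
  assumes node: "node_at S D (u 0)" and smooth: "\<And>z. z \<noteq> 0 \<Longrightarrow> smooth_at S D (u z)"
  obtains \<Phi> where "continuous_on UNIV \<Phi>" "\<And>z. \<Phi> z \<noteq> 0" "\<And>z. z \<noteq> 0 \<Longrightarrow> \<phi> z = z ^ N * \<Phi> z"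
proof -
  obtain L where L: "L \<noteq> 0" "((\<lambda>z. \<phi> z / z ^ N) \<longlongrightarrow> L) (at 0)"
    using \<phi>_node[OF node] by blast
  define \<Phi> where "\<Phi> z = (if z = 0 then L else \<phi> z / z ^ N)" for z
  have "isCont \<Phi> z" for z
  proof (cases "z = 0")
    case True
    have "eventually (\<lambda>z. \<phi> z / z ^ N = \<Phi> z) (at 0)"
      by (simp add: \<Phi>_def eventually_at_filter)
    from Lim_transform_eventually[OF L(2) this] show ?thesis
      using True by (simp add: isCont_def \<Phi>_def[of 0])
  next
    case False
    then have "isCont (\<lambda>z. \<phi> z / z ^ N) z"
      using \<phi>_smooth_point(2)[OF smooth[OF False]] by (intro continuous_intros) auto
    moreover have "eventually (\<lambda>w. \<Phi> w = \<phi> w / w ^ N) (nhds z)"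
    proof -
      have "eventually (\<lambda>w. w \<in> - {0}) (nhds z)"
        by (rule eventually_nhds_in_open) (use False in auto)
      then show ?thesis by eventually_elim (simp add: \<Phi>_def)
    qed
    ultimately show ?thesis using isCont_cong[of \<Phi> "\<lambda>w. \<phi> w / w ^ N" z] by blast
  qed
  then have "continuous_on UNIV \<Phi>" by (simp add: continuous_at_imp_continuous_on)
  moreover have "\<Phi> z \<noteq> 0" for z using L(1) \<phi>_smooth_point(1)[OF smooth] by (simp add: \<Phi>_def)
  moreover have "\<phi> z = z ^ N * \<Phi> z" if "z \<noteq> 0" for z using that by (simp add: \<Phi>_def)
  ultimately show thesis using that by blast
qed

end

section \<open>The adjunction formula\<close>

context det_tangent_section
begin

text \<open>In the exponent, the frames contribute the intersection numbers and the derivative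
  of \<open>z \<mapsto> 1/z\<close> contributes the degree 2 of the tangent bundle of the projective line.\<close>

lemma \<phi>_at_infinity:
  assumes U: "parametrized_curve S N n \<tau> D u s" and V: "parametrized_curve S N n \<tau> D v t"
    and uv: "\<forall>z. z \<noteq> 0 \<longrightarrow> u z = v (1 / z)"
    and deg: "\<forall>C\<in>RC. \<forall>W h z. local_eq S C W h \<and> z \<noteq> 0 \<and> u z \<in> W \<longrightarrow>
        t C (W, h) (1 / z) = z powi m C * s C (W, h) z"
    and z: "z \<noteq> 0" and sm: "smooth_at S D (u z)"
  shows "parametrized_curve.\<phi> S N n \<tau> D v t (1 / z) =
    (- 1) ^ N * z powi ((\<Sum>C\<in>RC. n C * m C) - int N * (m D + 2)) * parametrized_curve.\<phi> S N n \<tau> D u s z"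
proof -
  interpret U: parametrized_curve S N n \<tau> D u s by (rule U)
  interpret V: parametrized_curve S N n \<tau> D v t by (rule V)
  have "u z \<in> D" using U.range_u by blast
  then obtain \<kappa> W h \<epsilon> k where ad: "u z \<in> W" "adapted D \<kappa> W h \<epsilon> k"
    by (rule adapted_exists[OF U.curve _ sm])
  have ad': "v (1 / z) \<in> W" using ad(1) uv z by simp
  have t: "t C (W, h C) (1 / z) = z powi m C * s C (W, h C) z" if "C \<in> RC" for C
    using deg that adaptedD(5)[OF ad(2) that] z ad(1) by blast
  define x' where "x' = deriv (\<lambda>w. fst (snd \<kappa> (u w))) z"
  have "((\<lambda>w. fst (snd \<kappa> (u w))) has_field_derivative x') (at z)"
    unfolding x'_def using U.adapted_path(1,2)[OF ad(2)] ad(1) by (intro holomorphic_derivI) auto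
  then have d1: "((\<lambda>w. fst (snd \<kappa> (u w))) has_field_derivative x') (at (1 / (1 / z)))" by simp
  have d2: "((\<lambda>w. 1 / w) has_field_derivative - (z ^ 2)) (at (1 / z))"
    using z by (auto intro!: derivative_eq_intros simp: power2_eq_square)
  have "((\<lambda>w. fst (snd \<kappa> (u (1 / w)))) has_field_derivative x' * - (z ^ 2)) (at (1 / z))"
    by (rule DERIV_chain2[OF d1 d2])
  then have "((\<lambda>w. fst (snd \<kappa> (v w))) has_field_derivative x' * - (z ^ 2)) (at (1 / z))"
    by (rule has_field_derivative_transform_within_open[of _ _ _ "- {0}"]) (use z uv in auto)
  then have v': "deriv (\<lambda>w. fst (snd \<kappa> (v w))) (1 / z) = x' * - (z ^ 2)" by (rule DERIV_imp_deriv)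
  let ?P = "\<Prod>C\<in>RC. s C (W, h C) z powi n C" and ?\<Sigma> = "\<Sum>C\<in>RC. n C * m C"
  have P: "(\<Prod>C\<in>RC. t C (W, h C) (1 / z) powi n C) = z powi ?\<Sigma> * ?P"
  proof -
    have "(\<Prod>C\<in>RC. t C (W, h C) (1 / z) powi n C) =
        (\<Prod>C\<in>RC. z powi (n C * m C) * s C (W, h C) z powi n C)"
      by (rule prod.cong) (auto simp: t power_int_mult_distrib mult.commute[of "n _"] power_int_mult)
    then show ?thesis using z finite_curves by (simp add: prod.distrib prod_power_int)
  qed
  have "x' * - (z ^ 2) * k (u z) * (z powi m D * s D (W, h D) z) =
      - 1 * z powi (m D + 2) * (x' * k (u z) * s D (W, h D) z)"
    using z by (simp add: power_int_add)
  then have "(x' * - (z ^ 2) * k (u z) * (z powi m D * s D (W, h D) z)) ^ N =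
      (- 1) ^ N * z powi (int N * (m D + 2)) * (x' * k (u z) * s D (W, h D) z) ^ N"
    by (simp only: power_mult_distrib mult.commute[of "int N"] power_int_mult power_int_of_nat)
  then have "V.ratio \<kappa> W h \<epsilon> k (1 / z) = \<epsilon> (u z) * (z powi ?\<Sigma> * ?P) /
      ((- 1) ^ N * z powi (int N * (m D + 2)) * (x' * k (u z) * s D (W, h D) z) ^ N)"
    unfolding V.ratio_def v' P t[OF U.curve] using uv z by simp
  also have "\<dots> = (- 1) ^ N * z powi (?\<Sigma> - int N * (m D + 2)) * U.ratio \<kappa> W h \<epsilon> k z"
    using z by (cases "even N") (simp_all add: U.ratio_def x'_def power_int_diff)
  finally show ?thesis
    unfolding V.\<phi>_eq[OF ad(2) ad'] U.\<phi>_eq[OF ad(2) ad(1)] .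
qed

lemma frames_exist:
  assumes "D \<in> RC" and nrm: "normalization S D u v" and "inj u" and "v 0 \<notin> range u \<or> v 0 = u 0"
    and m: "\<And>C. C \<in> RC \<Longrightarrow> intersection_number S C D (m C)"
  obtains s t where "parametrized_curve S N n \<tau> D u s" "parametrized_curve S N n \<tau> D v t"
    "\<forall>z. z \<noteq> 0 \<longrightarrow> u z = v (1 / z)"
    "\<forall>C\<in>RC. \<forall>W h z. local_eq S C W h \<and> z \<noteq> 0 \<and> u z \<in> W \<longrightarrow>
        t C (W, h) (1 / z) = z powi m C * s C (W, h) z"
proof -
  have hol: "holomorphic_path S u" "holomorphic_path S v" and uv: "\<And>z. z \<noteq> 0 \<Longrightarrow> u z = v (1 / z)"
    and D: "D = range u \<union> range v"
    using nrm unfolding normalization_def holomorphic_sphere_def by auto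
  have vu: "v z = u (1 / z)" if "z \<noteq> 0" for z using uv[of "1 / z"] that by simp
  have inj_v: "inj v"
  proof (rule injI)
    have *: "w = 0" if "v w = v 0" for w
    proof (rule ccontr)
      assume "w \<noteq> 0"
      then have "v 0 = u (1 / w)" using vu that by simp
      then show False using assms(3,4) \<open>w \<noteq> 0\<close> by (auto simp: inj_eq)
    qed
    fix a b assume ab: "v a = v b"
    show "a = b"
    proof (cases "a = 0 \<or> b = 0")
      case True
      then show ?thesis using ab * by metis
    next
      case False
      then show ?thesis using ab assms(3) by (simp add: vu inj_eq)
    qed
  qed
  have "\<forall>C\<in>RC. \<exists>s t. frame_of_divisor S C u s \<and> frame_of_divisor S C v t \<and>
      (\<forall>W h z. local_eq S C W h \<and> z \<noteq> 0 \<and> u z \<in> W \<longrightarrow> t (W, h) (1 / z) = z powi m C * s (W, h) z)"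
    using m nrm unfolding intersection_number_def pullback_degree_def by blast
  then obtain s t where st: "\<And>C. C \<in> RC \<Longrightarrow> frame_of_divisor S C u (s C)"
    "\<And>C. C \<in> RC \<Longrightarrow> frame_of_divisor S C v (t C)"
    "\<forall>C\<in>RC. \<forall>W h z. local_eq S C W h \<and> z \<noteq> 0 \<and> u z \<in> W \<longrightarrow>
        t C (W, h) (1 / z) = z powi m C * s C (W, h) z"
    by metis
  have "parametrized_curve S N n \<tau> D u s" "parametrized_curve S N n \<tau> D v t"
    using assms(1,3) hol inj_v st D by (unfold_locales; auto)+
  then show thesis using uv st(3) by (intro that) auto
qed

theorem adjunction_smooth:
  assumes D: "D \<in> RC" "smooth_rational_curve S D"
    and m: "\<And>C. C \<in> RC \<Longrightarrow> intersection_number S C D (m C)"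
  shows "(\<Sum>C\<in>RC. n C * m C) = int N * (m D + 2)"
proof -
  obtain u v where uv: "normalization S D u v" "inj u" "v 0 \<notin> range u"
    and sm: "\<And>p. p \<in> D \<Longrightarrow> smooth_at S D p"
    using D(2) unfolding smooth_rational_curve_def by blast
  obtain s t where U: "parametrized_curve S N n \<tau> D u s" and V: "parametrized_curve S N n \<tau> D v t"
    and inf: "\<forall>z. z \<noteq> 0 \<longrightarrow> u z = v (1 / z)"
    "\<forall>C\<in>RC. \<forall>W h z. local_eq S C W h \<and> z \<noteq> 0 \<and> u z \<in> W \<longrightarrow>
        t C (W, h) (1 / z) = z powi m C * s C (W, h) z"
    by (rule frames_exist[OF D(1) uv(1,2) disjI1[OF uv(3)] m])
  interpret U: parametrized_curve S N n \<tau> D u s by (rule U)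
  interpret V: parametrized_curve S N n \<tau> D v t by (rule V)
  have smu: "smooth_at S D (u z)" and smv: "smooth_at S D (v z)" for z
    using sm U.range_u V.range_u by blast+
  have "(\<Sum>C\<in>RC. n C * m C) - int N * (m D + 2) = 0"
    by (rule clutching_exponent_zero[of U.\<phi> V.\<phi>])
      (use U.\<phi>_smooth_point[OF smu] V.\<phi>_smooth_point[OF smv] \<phi>_at_infinity[OF U V inf _ smu] in
        \<open>auto intro!: continuous_at_imp_continuous_on\<close>)
  then show ?thesis by simp
qed

theorem adjunction_nodal:
  assumes D: "D \<in> RC" "nodal_rational_curve S D"
    and m: "\<And>C. C \<in> RC \<Longrightarrow> intersection_number S C D (m C)"
  shows "(\<Sum>C\<in>RC. n C * m C) = int N * m D"
proof -
  obtain u v where uv: "normalization S D u v" "inj u" "v 0 = u 0"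
    and node: "node_at S D (u 0)" and sm: "\<And>p. p \<in> D - {u 0} \<Longrightarrow> smooth_at S D p"
    using D(2) unfolding nodal_rational_curve_def by blast
  obtain s t where U: "parametrized_curve S N n \<tau> D u s" and V: "parametrized_curve S N n \<tau> D v t"
    and inf: "\<forall>z. z \<noteq> 0 \<longrightarrow> u z = v (1 / z)"
    "\<forall>C\<in>RC. \<forall>W h z. local_eq S C W h \<and> z \<noteq> 0 \<and> u z \<in> W \<longrightarrow>
        t C (W, h) (1 / z) = z powi m C * s C (W, h) z"
    by (rule frames_exist[OF D(1) uv(1,2) disjI2[OF uv(3)] m])
  interpret U: parametrized_curve S N n \<tau> D u s by (rule U)
  interpret V: parametrized_curve S N n \<tau> D v t by (rule V)
  have smu: "smooth_at S D (u z)" if "z \<noteq> 0" for z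
  proof (rule sm)
    have "u z \<noteq> u 0" using that U.inj by (simp add: inj_eq)
    then show "u z \<in> D - {u 0}" using U.range_u by blast
  qed
  have smv: "smooth_at S D (v z)" if "z \<noteq> 0" for z
  proof (rule sm)
    have "v z \<noteq> v 0" using that V.inj by (simp add: inj_eq)
    then show "v z \<in> D - {u 0}" using V.range_u uv(3) by auto
  qed
  obtain \<Phi> where \<Phi>: "continuous_on UNIV \<Phi>" "\<And>z. \<Phi> z \<noteq> 0" "\<And>z. z \<noteq> 0 \<Longrightarrow> U.\<phi> z = z ^ N * \<Phi> z"
    using U.\<phi>_nodal_curve[OF node smu] by blast
  obtain \<Psi> where \<Psi>: "continuous_on UNIV \<Psi>" "\<And>z. \<Psi> z \<noteq> 0" "\<And>z. z \<noteq> 0 \<Longrightarrow> V.\<phi> z = z ^ N * \<Psi> z"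
    using V.\<phi>_nodal_curve[OF _ smv] node uv(3) by auto
  have "(\<Sum>C\<in>RC. n C * m C) - int N * (m D + 2) + int N + int N = 0"
  proof (rule clutching_exponent_zero[OF \<Phi>(1) \<Psi>(1) \<Phi>(2) \<Psi>(2)])
    fix z :: complex assume z: "z \<noteq> 0"
    let ?e = "(\<Sum>C\<in>RC. n C * m C) - int N * (m D + 2)"
    have "(1 / z) ^ N * \<Psi> (1 / z) = (- 1) ^ N * z powi ?e * (z ^ N * \<Phi> z)"
      using \<phi>_at_infinity[OF U V inf z smu[OF z]] \<Phi>(3)[OF z] \<Psi>(3)[of "1 / z"] z by simp
    then have "\<Psi> (1 / z) = (- 1) ^ N * (z powi ?e * z ^ N * z ^ N) * \<Phi> z"
      using z by (simp add: power_divide field_simps)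
    also have "z powi ?e * z ^ N * z ^ N = z powi (?e + int N + int N)"
      by (simp only: power_int_add[OF disjI1[OF z]] power_int_of_nat)
    finally show "\<Psi> (1 / z) = (- 1) ^ N * z powi (?e + int N + int N) * \<Phi> z" .
  qed
  then show ?thesis by (simp add: algebra_simps)
qed

end

text \<open>Both forms start from the same intersection numbers. So they also show that a curve with such
  numbers is not smooth and nodal at the same time.\<close>

lemma adjunction:
  fixes S :: "'a surface" and E :: "'i \<Rightarrow> 'a set" and \<mu> :: "'i \<Rightarrow> int"
  assumes S: "intermediate_Kato_surface S" and d: "anticanonical_multiplicities S d"
    and I: "finite I" "bij_betw E I (rational_curves S)" and j: "j \<in> I"
    and \<mu>: "\<And>i. i \<in> I \<Longrightarrow> intersection_number S (E i) (E j) (\<mu> i)"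
  shows "smooth_rational_curve S (E j) \<Longrightarrow> (\<Sum>i\<in>I. d (E i) * of_int (\<mu> i)) = of_int (\<mu> j) + 2"
    and "nodal_rational_curve S (E j) \<Longrightarrow> (\<Sum>i\<in>I. d (E i) * of_int (\<mu> i)) = of_int (\<mu> j)"
proof -
  obtain N n where N: "N > 0" and n: "\<And>C. C \<in> rational_curves S \<Longrightarrow> of_int (n C) = of_nat N * d C"
    and det: "det_tangent_power_has_divisor S N n"
    using d unfolding anticanonical_multiplicities_def by blast
  have surface: "complex_surface S" "finite (rational_curves S)"
    "\<forall>p\<in>maximal_curve S. smooth_at S (maximal_curve S) p \<or> node_at S (maximal_curve S) p"
    using S unfolding intermediate_Kato_surface_def Kato_surface_def Let_def by blast+
  have "\<exists>\<tau>. det_tangent_section S N n \<tau>"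
    by (rule ex_forward[OF det[unfolded det_tangent_power_has_divisor_def]], unfold_locales)
      (use surface in blast)+
  then obtain \<tau> where \<tau>: "det_tangent_section S N n \<tau>" by blast
  interpret det_tangent_section S N n \<tau> by (rule \<tau>)
  define m where "m C = \<mu> (inv_into I E C)" for C
  have mE: "m (E i) = \<mu> i" if "i \<in> I" for i
    using that I(2) by (simp add: m_def bij_betw_def)
  have m: "intersection_number S C (E j) (m C)" if "C \<in> rational_curves S" for C
  proof -
    obtain i where "i \<in> I" "C = E i" using \<open>C \<in> _\<close> I(2) by (auto simp: bij_betw_def)
    then show ?thesis using \<mu> mE by simp
  qed
  have Ej: "E j \<in> rational_curves S" using j I(2) by (auto simp: bij_betw_def)
  have "rat_of_int (\<Sum>C\<in>rational_curves S. n C * m C) = (\<Sum>C\<in>rational_curves S. of_nat N * (d C * of_int (m C)))"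
    by (simp add: n mult.assoc)
  also have "\<dots> = of_nat N * (\<Sum>i\<in>I. d (E i) * of_int (m (E i)))"
    by (simp add: sum_distrib_left sum.reindex_bij_betw[OF I(2), symmetric])
  also have "\<dots> = of_nat N * (\<Sum>i\<in>I. d (E i) * of_int (\<mu> i))" by (simp add: mE)
  finally have sum: "rat_of_int (\<Sum>C\<in>rational_curves S. n C * m C) =
      of_nat N * (\<Sum>i\<in>I. d (E i) * of_int (\<mu> i))" .
  show "(\<Sum>i\<in>I. d (E i) * of_int (\<mu> i)) = of_int (\<mu> j) + 2" if "smooth_rational_curve S (E j)"
  proof -
    have "rat_of_int (int N * (m (E j) + 2)) = of_nat N * (\<Sum>i\<in>I. d (E i) * of_int (\<mu> i))"
      using sum adjunction_smooth[OF Ej that m] by (simp only:)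
    then show ?thesis using N mE[OF j] by simp
  qed
  show "(\<Sum>i\<in>I. d (E i) * of_int (\<mu> i)) = of_int (\<mu> j)" if "nodal_rational_curve S (E j)"
  proof -
    have "rat_of_int (int N * (m (E j))) = of_nat N * (\<Sum>i\<in>I. d (E i) * of_int (\<mu> i))"
      using sum adjunction_nodal[OF Ej that m] by (simp only:)
    then show ?thesis using N mE[OF j] by simp
  qed
qed

section \<open>Multiplicities along a chain attached to a cycle\<close>

lemma f_poly_snoc2: "f_poly (xs @ [x, y]) = y * f_poly (xs @ [x]) + f_poly xs"
  by (simp add: f_poly_def)

lemma P_poly_snoc: "P_poly (xs @ [x]) = x * f_poly xs + P_poly xs"
  by (simp add: f_poly_def P_poly_def)

lemma ksum_even_Suc: "ksum_even ks (Suc j) = ksum_even ks j + ks ! (2 * j)"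
  and ksum_odd_Suc: "ksum_odd ks (Suc j) = ksum_odd ks j + ks ! (2 * j + 1)"
  by (simp_all add: ksum_even_def ksum_odd_def)

lemma ksum_0 [simp]: "ksum_even ks 0 = 0" "ksum_odd ks 0 = 0"
  by (simp_all add: ksum_even_def ksum_odd_def)

lemma ksum_even_mono: "i \<le> j \<Longrightarrow> ksum_even ks i \<le> ksum_even ks j"
  and ksum_odd_mono: "i \<le> j \<Longrightarrow> ksum_odd ks i \<le> ksum_odd ks j"
  unfolding ksum_even_def ksum_odd_def by (auto intro!: sum_mono2)

lemma alpha_eq_ksum: "alpha ks = ksum_even ks ((length ks + 1) div 2)"
proof -
  have "{i. i < length ks \<and> even i} = (\<lambda>l. 2 * l) ` {..<(length ks + 1) div 2}"
    by (auto elim!: evenE simp: image_iff)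
  then show ?thesis
    by (simp add: alpha_def ksum_even_def sum.reindex inj_on_def)
qed

lemma beta_eq_ksum: "beta ks = ksum_odd ks (length ks div 2)"
proof -
  have "{i. i < length ks \<and> odd i} = (\<lambda>l. 2 * l + 1) ` {..<length ks div 2}"
    by (auto elim!: oddE simp: image_iff)
  then show ?thesis
    by (simp add: beta_def ksum_odd_def sum.reindex inj_on_def)
qed

text \<open>The continuant recursion with arbitrary initial values. For initial values \<open>- 1\<close> and \<open>t\<close>, its term
  with index \<open>j + 1\<close> is the slope with index \<open>j\<close>.\<close>

fun euler_seq :: "nat list \<Rightarrow> rat \<Rightarrow> rat \<Rightarrow> nat \<Rightarrow> rat" where
  "euler_seq ks x y 0 = x"
| "euler_seq ks x y (Suc 0) = y"
| "euler_seq ks x y (Suc (Suc n)) = of_nat (ks ! n) * euler_seq ks x y (Suc n) + euler_seq ks x y n"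

lemma euler_seq_closed_form:
  "j \<le> length ks \<Longrightarrow> euler_seq ks (- 1) t (Suc j) =
     of_nat (f_poly (take j ks)) * t - (if j = 0 then 0 else of_nat (f_poly (tl (take j ks))))"
proof (induction j rule: less_induct)
  case (less j)
  consider "j = 0" | "j = 1" | i where "j = Suc (Suc i)"
    by (metis One_nat_def not0_implies_Suc)
  then show ?case
  proof cases
    case 1
    then show ?thesis by (simp add: f_poly_def)
  next
    case 2
    then show ?thesis using less.prems by (cases ks) (auto simp: f_poly_def)
  next
    case (3 i)
    have take2: "take (Suc (Suc i)) xs = take i xs @ [xs ! i, xs ! Suc i]"
      if "Suc (Suc i) \<le> length xs" for xs :: "nat list" and i
      using that by (simp add: take_Suc_conv_app_nth)
    have f: "f_poly (take (Suc (Suc i)) xs) = xs ! Suc i * f_poly (take (Suc i) xs) + f_poly (take i xs)"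
      if "Suc (Suc i) \<le> length xs" for xs :: "nat list" and i
      using that by (simp add: take2 f_poly_snoc2 take_Suc_conv_app_nth)
    obtain x xs where ks: "ks = x # xs" using less.prems 3 by (cases ks) auto
    have IH: "euler_seq ks (- 1) t (Suc (Suc i)) =
        of_nat (f_poly (take (Suc i) ks)) * t - of_nat (f_poly (tl (take (Suc i) ks)))"
      "euler_seq ks (- 1) t (Suc i) =
        of_nat (f_poly (take i ks)) * t - (if i = 0 then 0 else of_nat (f_poly (tl (take i ks))))"
      using less.IH[of "Suc i"] less.IH[of i] less.prems 3 by auto
    have e: "euler_seq ks (- 1) t (Suc j) =
        of_nat (ks ! Suc i) * euler_seq ks (- 1) t (Suc (Suc i)) + euler_seq ks (- 1) t (Suc i)"
      unfolding 3 by (rule euler_seq.simps)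
    show ?thesis
    proof (cases i)
      case 0
      then show ?thesis unfolding e IH using 3 less.prems f[of 0 ks] ks
        by (cases xs) (auto simp: f_poly_def algebra_simps)
    next
      case (Suc l)
      have "f_poly (tl (take (Suc (Suc i)) ks)) =
          ks ! Suc i * f_poly (tl (take (Suc i) ks)) + f_poly (tl (take i ks))"
        using f[of l xs] less.prems 3 Suc ks by simp
      then show ?thesis
        unfolding e IH using 3 less.prems f[of i ks] Suc by (simp add: algebra_simps)
    qed
  qed
qed

lemma euler_seq_sum_closed_form:
  "0 < j \<Longrightarrow> j \<le> length ks \<Longrightarrow> euler_seq ks (- 1) t j + euler_seq ks (- 1) t (Suc j) + 1 =
     (of_nat (P_poly (take j ks)) + 1) * t - of_nat (P_poly (tl (take j ks)))"
proof (induction j rule: nat_induct_non_zero)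
  case 1
  then show ?case by (cases ks) (auto simp: P_poly_def algebra_simps)
next
  case (Suc n)
  have IH: "euler_seq ks (- 1) t n + euler_seq ks (- 1) t (Suc n) + 1 =
     (of_nat (P_poly (take n ks)) + 1) * t - of_nat (P_poly (tl (take n ks)))"
    using Suc by simp
  obtain x xs where ks: "ks = x # xs" using Suc.prems by (cases ks) auto
  obtain l where l: "n = Suc l" using Suc.hyps by (cases n) auto
  have P: "P_poly (take (Suc n) ks) = ks ! n * f_poly (take n ks) + P_poly (take n ks)"
    using Suc.prems by (simp add: take_Suc_conv_app_nth P_poly_snoc)
  have "P_poly (take (Suc l) xs) = xs ! l * f_poly (take l xs) + P_poly (take l xs)"
    using Suc.prems ks l by (simp add: take_Suc_conv_app_nth P_poly_snoc)
  then have Ptl: "P_poly (tl (take (Suc n) ks)) = ks ! n * f_poly (tl (take n ks)) + P_poly (tl (take n ks))"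
    using ks l by simp
  have cf: "euler_seq ks (- 1) t (Suc n) = of_nat (f_poly (take n ks)) * t - of_nat (f_poly (tl (take n ks)))"
    using euler_seq_closed_form[of n ks t] Suc.hyps Suc.prems by simp
  have "euler_seq ks (- 1) t (Suc n) + euler_seq ks (- 1) t (Suc (Suc n)) + 1
      = of_nat (ks ! n) * euler_seq ks (- 1) t (Suc n)
        + (euler_seq ks (- 1) t n + euler_seq ks (- 1) t (Suc n) + 1)" by simp
  also have "\<dots> = (of_nat (P_poly (take (Suc n) ks)) + 1) * t - of_nat (P_poly (tl (take (Suc n) ks)))"
    unfolding IH unfolding P Ptl cf by (simp add: algebra_simps)
  finally show ?case .
qed

lemma linear_run:
  fixes b :: "nat \<Rightarrow> rat"
  assumes "\<And>i. n < i \<Longrightarrow> i < n + L \<Longrightarrow> b (i + 1) - b i = b i - b (i - 1)"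
  shows "l < L \<Longrightarrow> b (n + l + 1) - b (n + l) = b (n + 1) - b n"
    and "l \<le> L \<Longrightarrow> b (n + l) = b n + of_nat l * (b (n + 1) - b n)"
proof -
  show *: "b (n + l + 1) - b (n + l) = b (n + 1) - b n" if "l < L" for l
    using that
  proof (induction l)
    case (Suc l)
    then show ?case using assms[of "n + Suc l"] by simp
  qed simp
  show "b (n + l) = b n + of_nat l * (b (n + 1) - b n)" if "l \<le> L" for l
    using that
  proof (induction l)
    case (Suc l)
    then show ?case using *[of l] by (simp add: algebra_simps)
  qed simp
qed

text \<open>Run backwards from \<open>\<delta> (p + 1) = - \<delta> p\<close>, the recursion produces terms with alternating signs, so
  their absolute values add up and \<open>\<bar>\<delta> 0\<bar>\<close> would be at least twice \<open>\<bar>\<delta> p\<bar>\<close>; but \<open>first\<close> makes them equal.\<close>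

lemma recurrence_rigidity:
  fixes \<delta> :: "nat \<Rightarrow> rat" and k :: "nat \<Rightarrow> nat"
  assumes p: "p > 0" and k: "\<And>n. n < p \<Longrightarrow> k n \<ge> 1"
    and rec: "\<And>n. n < p \<Longrightarrow> \<delta> (Suc (Suc n)) = of_nat (k n) * \<delta> (Suc n) + \<delta> n"
    and last: "\<delta> p + \<delta> (Suc p) = 0" and first: "\<delta> 0 = (if even p then \<delta> p else \<delta> (Suc p))"
    and n: "n \<le> Suc p"
  shows "\<delta> n = 0"
proof -
  have backward: "\<exists>A B. \<delta> (p - i) = (- 1) ^ i * A * \<delta> p \<and> \<delta> (Suc p - i) = - ((- 1) ^ i) * B * \<delta> p \<and>
      1 \<le> B \<and> (if i = 0 then 1 else 2) \<le> A" if "i \<le> p" for i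
    using that
  proof (induction i)
    case 0
    show ?case using last by (intro exI[of _ 1]) auto
  next
    case (Suc i)
    then obtain A B where AB: "\<delta> (p - i) = (- 1) ^ i * A * \<delta> p"
      "\<delta> (Suc p - i) = - ((- 1) ^ i) * B * \<delta> p" "1 \<le> B" "1 \<le> A"
      by (force split: if_splits)
    define n where "n = p - Suc i"
    have n: "n < p" "Suc n = p - i" "Suc (Suc n) = Suc p - i" using Suc.prems by (auto simp: n_def)
    have k1: "(1::rat) \<le> of_nat (k n)" using k[OF n(1)] by (simp add: of_nat_le_iff[of 1, simplified])
    have "\<delta> n = \<delta> (Suc p - i) - of_nat (k n) * \<delta> (p - i)" using rec[OF n(1)] n by simp
    then have "\<delta> (p - Suc i) = (- 1) ^ Suc i * (B + of_nat (k n) * A) * \<delta> p"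
      unfolding AB n_def[symmetric] by (simp add: algebra_simps)
    moreover have "\<delta> (Suc p - Suc i) = - ((- 1) ^ Suc i) * A * \<delta> p" using AB by simp
    moreover have "2 \<le> B + of_nat (k n) * A"
      using AB k1 mult_mono[of 1 "of_nat (k n)" 1 A] by simp
    ultimately have "\<delta> (p - Suc i) = (- 1) ^ Suc i * (B + of_nat (k n) * A) * \<delta> p \<and>
        \<delta> (Suc p - Suc i) = - ((- 1) ^ Suc i) * A * \<delta> p \<and> 1 \<le> A \<and>
        (if Suc i = 0 then 1 else 2) \<le> B + of_nat (k n) * A"
      using AB by simp
    then show ?case by blast
  qed
  obtain A where A: "\<delta> 0 = (- 1) ^ p * A * \<delta> p" "2 \<le> A"
    using backward[of p] p by auto
  have "\<delta> 0 = (- 1) ^ p * \<delta> p" using first last by (auto simp: add_eq_0_iff)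
  then have "(A - 1) * \<delta> p = 0" using A by (auto simp: algebra_simps)
  then have "\<delta> p = 0" using A by auto
  then show ?thesis
  proof (cases "n = Suc p")
    case True
    then show ?thesis using last \<open>\<delta> p = 0\<close> by simp
  next
    case False
    then show ?thesis using backward[of "p - n"] n \<open>\<delta> p = 0\<close> by auto
  qed
qed

text \<open>The chain visits the states (value - 1, outgoing slope) = \<open>(x(2j), x(2j + 1))\<close>, and the cycle the
  states (incoming slope, value - 1) = \<open>(y(2j), y(2j + 1))\<close>; both sequences satisfy the continuant recursion. The sequence
  \<open>y\<close> starts with the slope \<open>\<sigma>\<close> with which the cycle arrives at \<open>C\<^sub>0\<close> once the branch is discounted. Equality of the multiplicity of the
  root in both systems gives \<open>last\<close>, and the drop of the slope at the root gives \<open>first\<close>, for the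
  difference of \<open>y\<close> and \<open>x\<close>.\<close>

lemma multiplicities_of_chain_and_cycle:
  fixes a c :: "nat \<Rightarrow> rat"
  assumes ks: "ks \<noteq> []" "\<And>k. k \<in> set ks \<Longrightarrow> k \<ge> 1"
    and a0: "a 0 = 0"
    and a_bend: "\<And>i j. 2 * j + 1 < length ks \<Longrightarrow> i = ksum_even ks (Suc j) \<Longrightarrow>
        a (i + 1) - a i = a i - a (i - 1) + of_nat (ks ! (2 * j + 1)) * (a i - 1)"
    and a_straight: "\<And>i. i \<in> {1..alpha ks} \<Longrightarrow> (\<And>j. 2 * j + 1 < length ks \<Longrightarrow> i \<noteq> ksum_even ks (Suc j)) \<Longrightarrow>
        a (i + 1) - a i = a i - a (i - 1)"
    and c_bend: "\<And>i j. 0 < j \<Longrightarrow> 2 * j < length ks \<Longrightarrow> i = ksum_odd ks j \<Longrightarrow>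
        c (i + 1) - c i = c i - c (i - 1) + of_nat (ks ! (2 * j)) * (c i - 1)"
    and c_straight: "\<And>i. i \<in> {1..beta ks} \<Longrightarrow> (\<And>j. 2 * j < length ks \<Longrightarrow> i \<noteq> ksum_odd ks j) \<Longrightarrow>
        c (i + 1) - c i = c i - c (i - 1)"
    and root: "a (alpha ks + 1) = c (beta ks + 1)"
    and start: "c 1 - c 0 = (c (beta ks + 1) - c (beta ks)) - a (alpha ks) + of_nat (ks ! 0) * (c 0 - 1)"
  shows "2 * j \<le> length ks \<Longrightarrow>
      a (ksum_even ks j + 1) - a (ksum_even ks j) = euler_seq ks (- 1) (a 1) (Suc (2 * j))"
    and "2 * j < length ks \<Longrightarrow>
      c (ksum_odd ks j + 1) - c (ksum_odd ks j) = euler_seq ks (- 1) (a 1) (Suc (2 * j + 1))"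
    and "c (beta ks + 1) = euler_seq ks (- 1) (a 1) (length ks) + euler_seq ks (- 1) (a 1) (Suc (length ks)) + 1"
proof -
  define p where "p = length ks"
  have p0: "p > 0" using ks by (simp add: p_def)
  have k1: "ks ! n \<ge> 1" if "n < p" for n using ks that by (simp add: p_def)
  \<comment> \<open>The slope by which the cycle leaves the root, that is, enters \<open>C\<^sub>0\<close>. If \<open>C\<^sub>0\<close> itself is the root,
    it is the slope entering \<open>C\<^sub>0\<close> minus the multiplicity of the branch component.\<close>
  define \<sigma> where "\<sigma> = (c (beta ks + 1) - c (beta ks)) - a (alpha ks)"
  define x where "x = euler_seq ks (- 1) (a 1)"
  define y where "y = euler_seq ks \<sigma> (c 0 - 1)"
  have x_rec: "x (Suc (Suc n)) = of_nat (ks ! n) * x (Suc n) + x n"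
    and y_rec: "y (Suc (Suc n)) = of_nat (ks ! n) * y (Suc n) + y n" for n
    by (simp_all add: x_def y_def)
  let ?E = "ksum_even ks" and ?O = "ksum_odd ks"
  have E_le: "?E (Suc j) \<le> alpha ks" if "2 * j < p" for j
    unfolding alpha_eq_ksum using that by (intro ksum_even_mono) (auto simp: p_def)
  have O_le: "?O (Suc j) \<le> beta ks" if "2 * j + 1 < p" for j
    unfolding beta_eq_ksum using that by (intro ksum_odd_mono) (auto simp: p_def)

  have a_gap: "a (i + 1) - a i = a i - a (i - 1)" if "2 * j < p" "?E j < i" "i < ?E (Suc j)" for i j
  proof (rule a_straight)
    show "i \<in> {1..alpha ks}" using that E_le[of j] by auto
    fix l show "i \<noteq> ?E (Suc l)"
      using that ksum_even_mono[of "Suc l" j ks] ksum_even_mono[of "Suc j" "Suc l" ks]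
      by (cases "l < j") auto
  qed
  have a_tail: "a (i + 1) - a i = a i - a (i - 1)" if "2 * j + 1 = p" "?E j < i" "i \<le> ?E (Suc j)" for i j
  proof (rule a_straight)
    show "i \<in> {1..alpha ks}" using that E_le[of j] by auto
    fix l assume "2 * l + 1 < length ks"
    then show "i \<noteq> ?E (Suc l)"
      using that ksum_even_mono[of "Suc l" j ks] by (auto simp: p_def)
  qed
  have a_value: "a (?E (Suc j)) = a (?E j) + of_nat (ks ! (2 * j)) * (a (?E j + 1) - a (?E j))"
    and a_slope: "a (?E (Suc j)) - a (?E (Suc j) - 1) = a (?E j + 1) - a (?E j)" if "2 * j < p" for j
  proof -
    have gap: "a (i + 1) - a i = a i - a (i - 1)" if "?E j < i" "i < ?E j + ks ! (2 * j)" for i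
      using a_gap[OF \<open>2 * j < p\<close>] that by (simp add: ksum_even_Suc)
    show "a (?E (Suc j)) = a (?E j) + of_nat (ks ! (2 * j)) * (a (?E j + 1) - a (?E j))"
      using linear_run(2)[where b = a and n = "?E j" and L = "ks ! (2 * j)" and l = "ks ! (2 * j)", OF gap]
      by (simp add: ksum_even_Suc)
    show "a (?E (Suc j)) - a (?E (Suc j) - 1) = a (?E j + 1) - a (?E j)"
      using linear_run(1)[where b = a and n = "?E j" and L = "ks ! (2 * j)" and l = "ks ! (2 * j) - 1", OF gap]
        k1[OF that] by (simp add: ksum_even_Suc)
  qed
  have a_state: "a (?E j) - 1 = x (2 * j) \<and> a (?E j + 1) - a (?E j) = x (Suc (2 * j))" if "2 * j \<le> p" for j
    using that
  proof (induction j)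
    case 0
    then show ?case by (simp add: a0 x_def)
  next
    case (Suc j)
    then have j: "2 * j < p" "2 * j + 1 < length ks" by (auto simp: p_def)
    have IH: "a (?E j) - 1 = x (2 * j)" "a (?E j + 1) - a (?E j) = x (Suc (2 * j))"
      using Suc by auto
    have 1: "a (?E (Suc j)) - 1 = x (Suc (Suc (2 * j)))"
      using a_value[OF j(1)] IH x_rec[of "2 * j"] by simp
    have "a (?E (Suc j) + 1) - a (?E (Suc j)) = x (Suc (Suc (Suc (2 * j))))"
      using a_bend[OF j(2) refl] a_slope[OF j(1)] IH 1 x_rec[of "Suc (2 * j)"] by simp
    with 1 show ?case by simp
  qed
  have a_end: "a (alpha ks + 1) - 1 = x p + x (Suc p)"
    "a (alpha ks) - 1 = (if even p then x p else x (Suc p))"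
  proof -
    have "a (alpha ks + 1) - 1 = x p + x (Suc p) \<and> a (alpha ks) - 1 = (if even p then x p else x (Suc p))"
    proof (cases "even p")
      case True
      then obtain q where q: "p = 2 * q" by blast
      then have "alpha ks = ?E q" by (simp add: alpha_eq_ksum flip: p_def)
      then show ?thesis using a_state[of q] q by simp
    next
      case False
      then obtain q where q: "p = 2 * q + 1" using oddE by blast
      then have E: "alpha ks = ?E (Suc q)" by (simp add: alpha_eq_ksum flip: p_def)
      have "?E q < ?E (Suc q)" using k1[of "2 * q"] q by (simp add: ksum_even_Suc)
      then have "a (?E (Suc q) + 1) - a (?E (Suc q)) = a (?E q + 1) - a (?E q)"
        using a_tail[of q "?E (Suc q)"] a_slope[of q] q by simp
      then show ?thesis
        using a_state[of q] a_value[of q] x_rec[of "2 * q"] q unfolding E by simp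
    qed
    then show "a (alpha ks + 1) - 1 = x p + x (Suc p)"
      "a (alpha ks) - 1 = (if even p then x p else x (Suc p))" by auto
  qed

  have c_gap: "c (i + 1) - c i = c i - c (i - 1)" if "2 * j + 1 < p" "?O j < i" "i < ?O (Suc j)" for i j
  proof (rule c_straight)
    show "i \<in> {1..beta ks}" using that O_le[of j] by auto
    fix l show "i \<noteq> ?O l"
      using that ksum_odd_mono[of l j ks] ksum_odd_mono[of "Suc j" l ks]
      by (cases "l \<le> j") auto
  qed
  have c_tail: "c (i + 1) - c i = c i - c (i - 1)" if "2 * j + 2 = p" "?O j < i" "i \<le> ?O (Suc j)" for i j
  proof (rule c_straight)
    show "i \<in> {1..beta ks}" using that O_le[of j] by auto
    fix l assume "2 * l < length ks"
    then show "i \<noteq> ?O l"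
      using that ksum_odd_mono[of l j ks] by (auto simp: p_def)
  qed
  have c_value: "c (?O (Suc j)) = c (?O j) + of_nat (ks ! (2 * j + 1)) * (c (?O j + 1) - c (?O j))"
    and c_slope: "c (?O (Suc j)) - c (?O (Suc j) - 1) = c (?O j + 1) - c (?O j)" if "2 * j + 1 < p" for j
  proof -
    have gap: "c (i + 1) - c i = c i - c (i - 1)" if "?O j < i" "i < ?O j + ks ! (2 * j + 1)" for i
      using c_gap[OF \<open>2 * j + 1 < p\<close>] that by (simp add: ksum_odd_Suc)
    show "c (?O (Suc j)) = c (?O j) + of_nat (ks ! (2 * j + 1)) * (c (?O j + 1) - c (?O j))"
      using linear_run(2)[where b = c and n = "?O j" and L = "ks ! (2 * j + 1)" and l = "ks ! (2 * j + 1)", OF gap]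
      by (simp add: ksum_odd_Suc)
    show "c (?O (Suc j)) - c (?O (Suc j) - 1) = c (?O j + 1) - c (?O j)"
      using linear_run(1)[where b = c and n = "?O j" and L = "ks ! (2 * j + 1)" and l = "ks ! (2 * j + 1) - 1", OF gap]
        k1[OF that] by (simp add: ksum_odd_Suc)
  qed
  have c_state: "c (?O j) - 1 = y (Suc (2 * j)) \<and> c (?O j + 1) - c (?O j) = y (Suc (Suc (2 * j)))"
    if "2 * j < p" for j
    using that
  proof (induction j)
    case 0
    then show ?case using start by (simp add: y_def \<sigma>_def)
  next
    case (Suc j)
    then have j: "2 * j + 1 < p" "2 * Suc j < length ks" by (auto simp: p_def)
    have IH: "c (?O j) - 1 = y (Suc (2 * j))" "c (?O j + 1) - c (?O j) = y (Suc (Suc (2 * j)))"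
      using Suc by auto
    have 1: "c (?O (Suc j)) - 1 = y (Suc (Suc (Suc (2 * j))))"
      using c_value[OF j(1)] IH y_rec[of "Suc (2 * j)"] by simp
    have "c (?O (Suc j) + 1) - c (?O (Suc j)) = y (Suc (Suc (Suc (Suc (2 * j)))))"
      using c_bend[OF _ j(2) refl] c_slope[OF j(1)] IH 1 y_rec[of "Suc (Suc (2 * j))"] by simp
    with 1 show ?case by simp
  qed
  have c_end: "c (beta ks + 1) - 1 = y p + y (Suc p) \<and>
      c (beta ks + 1) - c (beta ks) = (if even p then y p else y (Suc p))"
  proof (cases "even p")
    case True
    then obtain q where "p = 2 * q" by blast
    then obtain q where q: "p = 2 * q + 2" using p0 by (cases q) auto
    then have O: "beta ks = ?O (Suc q)" by (simp add: beta_eq_ksum flip: p_def)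
    have "?O q < ?O (Suc q)" using k1[of "2 * q + 1"] q by (simp add: ksum_odd_Suc)
    then have "c (?O (Suc q) + 1) - c (?O (Suc q)) = c (?O q + 1) - c (?O q)"
      using c_tail[of q "?O (Suc q)"] c_slope[of q] q by simp
    then show ?thesis
      using c_state[of q] c_value[of q] y_rec[of "Suc (2 * q)"] q unfolding O by simp
  next
    case False
    then obtain q where q: "p = 2 * q + 1" using oddE by blast
    then have O: "beta ks = ?O q" by (simp add: beta_eq_ksum flip: p_def)
    then show ?thesis using c_state[of q] q by simp
  qed

  have eq: "y n = x n" if "n \<le> Suc p" for n
  proof -
    have "y n - x n = 0"
    proof (rule recurrence_rigidity[where p = p and k = "\<lambda>n. ks ! n"])
      show "y (Suc (Suc n)) - x (Suc (Suc n)) = of_nat (ks ! n) * (y (Suc n) - x (Suc n)) + (y n - x n)" for n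
        by (simp add: x_rec y_rec algebra_simps)
      show "y p - x p + (y (Suc p) - x (Suc p)) = 0" using c_end a_end root by simp
      have "y 0 = (c (beta ks + 1) - c (beta ks)) - a (alpha ks)" "x 0 = - 1"
        by (simp_all add: y_def x_def \<sigma>_def)
      then show "y 0 - x 0 = (if even p then y p - x p else y (Suc p) - x (Suc p))"
        using c_end a_end by (auto split: if_splits)
    qed (use p0 k1 that in auto)
    then show ?thesis by simp
  qed
  show "a (?E j + 1) - a (?E j) = euler_seq ks (- 1) (a 1) (Suc (2 * j))" if "2 * j \<le> length ks" for j
    using a_state[of j] that by (simp add: p_def x_def)
  show "c (?O j + 1) - c (?O j) = euler_seq ks (- 1) (a 1) (Suc (2 * j + 1))" if "2 * j < length ks" for j
    using c_state[of j] eq[of "Suc (Suc (2 * j))"] that by (simp add: p_def x_def)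
  show "c (beta ks + 1) = euler_seq ks (- 1) (a 1) (length ks) + euler_seq ks (- 1) (a 1) (Suc (length ks)) + 1"
    using a_end(1) root by (simp add: x_def p_def algebra_simps)
qed

section \<open>Slopes and the multiplicity of the root\<close>

lemma sum_neighbours_in_chain:
  fixes x :: "nat \<Rightarrow> rat"
  assumes "i \<in> {1..n}"
  shows "(\<Sum>l\<in>{1..n}. x l * of_int (if l = i then - e else if l = Suc i \<or> i = Suc l then 1 else 0)) =
    (if i = n then 0 else x (i + 1)) + (if i = 1 then 0 else x (i - 1)) - of_int e * x i"
proof -
  have "(\<Sum>l\<in>{1..n}. x l * of_int (if l = i then - e else if l = Suc i \<or> i = Suc l then 1 else 0)) =
    (\<Sum>l\<in>{1..n}. (if l = i then - of_int e * x l else 0) + (if l = Suc i then x l else 0)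
       + (if l = i - 1 then x l else 0))"
    using assms by (intro sum.cong) auto
  then show ?thesis using assms by (auto simp: sum.distrib sum.delta)
qed

text \<open>Both summands are 1 exactly if \<open>r = 2\<close>, where the two curves meet twice.\<close>

lemma cyclic_adjacency:
  assumes "l \<noteq> j" "l < r" "j < r"
  shows "card {q. q < r \<and> {q, Suc q mod r} = {l, j}} =
    (if l = Suc j mod r then 1 else 0) + (if j = Suc l mod r then 1 else 0)"
proof -
  have "{q. q < r \<and> {q, Suc q mod r} = {l, j}} =
      (if l = Suc j mod r then {j} else {}) \<union> (if j = Suc l mod r then {l} else {})"
    using assms by (auto simp: doubleton_eq_iff)
  then show ?thesis using assms(1) by (simp add: card_insert_if)
qed

lemma sum_neighbours_in_cycle:
  fixes x :: "nat \<Rightarrow> rat"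
  assumes j: "j < r" and r: "r \<ge> 2"
  shows "(\<Sum>l<r. x l * of_int (if l = j then - e else int (card {q. q < r \<and> {q, Suc q mod r} = {l, j}}))) =
    x (Suc j mod r) + x (if j = 0 then r - 1 else j - 1) - of_int e * x j"
proof -
  let ?p = "if j = 0 then r - 1 else j - 1"
  have pred: "j = Suc l mod r \<longleftrightarrow> l = ?p" if "l < r" for l
  proof (cases "Suc l = r")
    case True
    then show ?thesis using j that by auto
  next
    case False
    then have "Suc l mod r = Suc l" using that by simp
    then show ?thesis using j that False by auto
  qed
  have neq: "Suc j mod r \<noteq> j" "?p \<noteq> j" using j r by (auto simp: mod_Suc)
  have "(\<Sum>l<r. x l * of_int (if l = j then - e else int (card {q. q < r \<and> {q, Suc q mod r} = {l, j}}))) =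
    (\<Sum>l<r. (if l = j then - of_int e * x l else 0) + (if l = Suc j mod r then x l else 0)
      + (if l = ?p then x l else 0))"
  proof (rule sum.cong[OF refl])
    fix l assume "l \<in> {..<r}"
    then have l: "l < r" by simp
    show "x l * of_int (if l = j then - e else int (card {q. q < r \<and> {q, Suc q mod r} = {l, j}})) =
      (if l = j then - of_int e * x l else 0) + (if l = Suc j mod r then x l else 0) + (if l = ?p then x l else 0)"
    proof (cases "l = j")
      case True
      then show ?thesis using neq by simp
    next
      case False
      show ?thesis unfolding cyclic_adjacency[OF False l j] pred[OF l] using False by auto
    qed
  qed
  also have "\<dots> = - of_int e * x j + x (Suc j mod r) + x ?p"
    using j r by (auto simp: sum.distrib sum.delta)
  finally show ?thesis by simp
qed

text \<open>The adjunction formula written as a second difference equation. Setting \<open>a 0 = 0\<close> extends it to the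
  tip. A cycle with one component obeys the same equation: both neighbours of the nodal curve are
  the curve itself, which accounts for the self-intersection \<open>2 - e\<close> instead of \<open>- e\<close>, and \<open>2 - e\<close> is
  also the right hand side of the adjunction formula.\<close>

lemma labelled_adjunction_equations:
  fixes S :: "'a surface" and a c :: "nat \<Rightarrow> rat"
  assumes S: "intermediate_Kato_surface S" and d: "anticanonical_multiplicities S d"
    and lab: "labelling S ks m A C" and m: "m \<ge> 1" and \<alpha>: "alpha ks \<ge> 1"
    and a: "\<And>i. i \<in> {1..alpha ks} \<Longrightarrow> a i = d (A i)" "a 0 = 0" "a (alpha ks + 1) = d (C (beta ks + 1))"
    and c: "\<And>j. j \<le> beta ks + m \<Longrightarrow> c j = d (C j)"
  shows "\<And>i e. i \<in> {1..alpha ks} \<Longrightarrow> self_intersection_entry S (A i) e \<Longrightarrow>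
      a (i + 1) - a i = a i - a (i - 1) + (of_nat e - 2) * (a i - 1)"
    and "\<And>j e. j < beta ks + m \<Longrightarrow> self_intersection_entry S (C j) e \<Longrightarrow>
      c (j + 1) - c j = c j - c (if j = 0 then beta ks + m - 1 else j - 1)
        - (if j = (if m = 1 then 0 else beta ks + 1) then a (alpha ks) else 0) + (of_nat e - 2) * (c j - 1)"
proof -
  define \<alpha> r \<rho> where "\<alpha> = alpha ks" and "r = beta ks + m" and "\<rho> = (if m = 1 then 0 else beta ks + 1)"
  define R where "R = C (beta ks + 1)"
  have L: "inj_on A {1..\<alpha>}" "A ` {1..\<alpha>} \<inter> C ` {..<r} = {}"
    "A ` {1..\<alpha>} \<union> C ` {..<r} = rational_curves S"
    "cycle_of_curves S r C" "C r = C 0"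
    "\<And>i. i \<in> {1..\<alpha>} \<Longrightarrow> smooth_rational_curve S (A i)"
    "\<And>i j. i \<in> {1..\<alpha>} \<Longrightarrow> j \<in> {1..\<alpha>} \<Longrightarrow> i \<noteq> j \<Longrightarrow>
        intersection_number S (A i) (A j) (if i = Suc j \<or> j = Suc i then 1 else 0)"
    "\<And>i j. i \<in> {1..\<alpha>} \<Longrightarrow> j < r \<Longrightarrow> intersection_number S (A i) (C j) (if i = \<alpha> \<and> C j = R then 1 else 0)"
    "\<And>i j. i \<in> {1..\<alpha>} \<Longrightarrow> j < r \<Longrightarrow> intersection_number S (C j) (A i) (if i = \<alpha> \<and> C j = R then 1 else 0)"
    using lab unfolding labelling_def Let_def \<alpha>_def r_def R_def by auto
  have r0: "r > 0" and Cinj: "inj_on C {..<r}"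
    and Ckind: "if r = 1 then nodal_rational_curve S (C 0) else \<forall>i<r. smooth_rational_curve S (C i)"
    and CC: "\<And>i j. i < r \<Longrightarrow> j < r \<Longrightarrow> i \<noteq> j \<Longrightarrow>
        intersection_number S (C i) (C j) (int (card {l. l < r \<and> {l, Suc l mod r} = {i, j}}))"
    using L(4) unfolding cycle_of_curves_def by auto
  have \<rho>: "\<rho> < r" "C \<rho> = R"
  proof -
    show "\<rho> < r" using m by (simp add: \<rho>_def r_def)
    have "R = C r" if "m = 1" using that by (simp add: R_def r_def)
    then show "C \<rho> = R" using L(5) by (simp add: \<rho>_def R_def)
  qed
  have R_iff: "C j = R \<longleftrightarrow> j = \<rho>" if "j < r" for j
    using inj_onD[OF Cinj, of j \<rho>] \<rho> that by auto
  let ?E = "case_sum A C" and ?I = "{1..\<alpha>} <+> {..<r}"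
  have fin: "finite ?I" by simp
  have bij: "bij_betw ?E ?I (rational_curves S)"
    unfolding bij_betw_def
  proof
    have ne: "A i \<noteq> C j" "C j \<noteq> A i" if "i \<in> {1..\<alpha>}" "j < r" for i j using L(2) that by blast+
    show "inj_on ?E ?I"
    proof (rule inj_onI)
      fix p q assume pq: "p \<in> ?I" "q \<in> ?I" "?E p = ?E q"
      show "p = q"
      proof (cases p; cases q)
        fix i l assume "p = Inl i" "q = Inl l"
        then show ?thesis using pq inj_onD[OF L(1), of i l] by (simp add: Plus_def image_iff)
      next
        fix i l assume "p = Inl i" "q = Inr l"
        then show ?thesis using pq ne(1)[of i l] by (simp add: Plus_def image_iff)
      next
        fix i l assume "p = Inr i" "q = Inl l"
        then show ?thesis using pq ne(2)[of l i] by (simp add: Plus_def image_iff)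
      next
        fix i l assume "p = Inr i" "q = Inr l"
        then show ?thesis using pq inj_onD[OF Cinj, of i l] by (simp add: Plus_def image_iff)
      qed
    qed
    show "?E ` ?I = rational_curves S"
      unfolding L(3)[symmetric] by (simp add: Plus_def image_Un image_image)
  qed
  note adj = adjunction[OF S d fin bij]
  have sumE: "(\<Sum>i\<in>?I. d (?E i) * of_int (\<mu> i)) =
      (\<Sum>l\<in>{1..\<alpha>}. d (A l) * of_int (\<mu> (Inl l))) + (\<Sum>l<r. d (C l) * of_int (\<mu> (Inr l)))" for \<mu>
    by (simp add: sum.Plus comp_def)

  show "a (i + 1) - a i = a i - a (i - 1) + (of_nat e - 2) * (a i - 1)"
    if "i \<in> {1..alpha ks}" and self: "self_intersection_entry S (A i) e" for i e
  proof -
    have i: "i \<in> {1..\<alpha>}" using that by (simp add: \<alpha>_def)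
    define \<mu> where "\<mu> e' = case_sum (\<lambda>l. if l = i then - e' else if l = Suc i \<or> i = Suc l then 1 else 0)
      (\<lambda>j. if i = \<alpha> \<and> C j = R then 1 else 0)" for e' :: int
    have \<mu>: "intersection_number S (?E q) (?E (Inl i)) (\<mu> e' q)"
      if "q \<in> ?I" and "intersection_number S (A i) (A i) (- e')" for q e'
      using that(1)
    proof (cases q)
      case (Inl l)
      then have "l \<in> {1..\<alpha>}" using that(1) by auto
      then show ?thesis using that(2) L(7)[OF _ i, of l] by (simp add: \<mu>_def Inl)
    next
      case (Inr l)
      then have "l < r" using that(1) by auto
      then show ?thesis using L(9)[OF i, of l] by (simp add: \<mu>_def Inr)
    qed
    have iI: "Inl i \<in> ?I" using i by auto
    have smooth: "smooth_rational_curve S (?E (Inl i))" using L(6) i by simp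
    \<comment> \<open>The two forms of the adjunction formula contradict each other on a curve that is both
      smooth and nodal.\<close>
    have "\<not> nodal_rational_curve S (A i)"
    proof
      assume nodal: "nodal_rational_curve S (A i)"
      then have "intersection_number S (A i) (A i) (- (int e - 2))"
        using self unfolding self_intersection_entry_def by (simp add: algebra_simps)
      from adj(1)[OF iI \<mu>[OF _ this] smooth] adj(2)[OF iI \<mu>[OF _ this]] nodal
      show False by simp
    qed
    then have "intersection_number S (A i) (A i) (- int e)"
      using self unfolding self_intersection_entry_def by simp
    from adj(1)[OF iI \<mu>[OF _ this] smooth]
    have eq: "(\<Sum>l\<in>{1..\<alpha>}. d (A l) * of_int (\<mu> (int e) (Inl l))) + (\<Sum>l<r. d (C l) * of_int (\<mu> (int e) (Inr l)))
        = 2 - of_nat e" unfolding sumE using i by (simp add: \<mu>_def)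
    have "(\<Sum>l\<in>{1..\<alpha>}. d (A l) * of_int (\<mu> (int e) (Inl l))) =
        (if i = \<alpha> then 0 else d (A (i + 1))) + (if i = 1 then 0 else d (A (i - 1))) - of_nat e * d (A i)"
      using sum_neighbours_in_chain[OF i, of "\<lambda>l. d (A l)" "int e"] by (simp add: \<mu>_def)
    moreover have "(\<Sum>l<r. d (C l) * of_int (\<mu> (int e) (Inr l))) = (if i = \<alpha> then d R else 0)"
    proof -
      have "(\<Sum>l<r. d (C l) * of_int (\<mu> (int e) (Inr l))) = (\<Sum>l<r. if l = \<rho> then (if i = \<alpha> then d R else 0) else 0)"
        using R_iff \<rho> by (intro sum.cong) (auto simp: \<mu>_def)
      then show ?thesis using \<rho> by simp
    qed
    moreover have "a (i + 1) = (if i = \<alpha> then d R else d (A (i + 1)))"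
      using i a(1)[of "i + 1"] a(3) by (auto simp: \<alpha>_def R_def)
    moreover have "a (i - 1) = (if i = 1 then 0 else d (A (i - 1)))"
    proof (cases "i = 1")
      case False
      then have "i - 1 \<in> {1..alpha ks}" using i by (auto simp: \<alpha>_def)
      then show ?thesis using a(1) False by simp
    qed (simp add: a(2))
    moreover have "a i = d (A i)" using i a(1) by (simp add: \<alpha>_def)
    ultimately have "a (i + 1) + a (i - 1) - of_nat e * a i = 2 - of_nat e"
      using eq by (auto split: if_splits)
    then show ?thesis by (simp add: algebra_simps)
  qed

  show "c (j + 1) - c j = c j - c (if j = 0 then beta ks + m - 1 else j - 1)
        - (if j = (if m = 1 then 0 else beta ks + 1) then a (alpha ks) else 0) + (of_nat e - 2) * (c j - 1)"
    if "j < beta ks + m" and self: "self_intersection_entry S (C j) e" for j e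
  proof -
    have j: "j < r" using that by (simp add: r_def)
    define \<mu> where "\<mu> e' = case_sum (\<lambda>i. if i = \<alpha> \<and> C j = R then 1 else 0)
      (\<lambda>l. if l = j then - e' else int (card {q. q < r \<and> {q, Suc q mod r} = {l, j}}))" for e' :: int
    have \<mu>: "intersection_number S (?E q) (?E (Inr j)) (\<mu> e' q)"
      if "q \<in> ?I" and "intersection_number S (C j) (C j) (- e')" for q e'
      using that(1)
    proof (cases q)
      case (Inl l)
      then have "l \<in> {1..\<alpha>}" using that(1) by auto
      then show ?thesis using L(8)[OF _ j, of l] by (simp add: \<mu>_def Inl)
    next
      case (Inr l)
      then have "l < r" using that(1) by auto
      then show ?thesis using that(2) CC[OF _ j, of l] by (simp add: \<mu>_def Inr)
    qed
    have jI: "Inr j \<in> ?I" using j by auto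
    have root: "(\<Sum>l\<in>{1..\<alpha>}. d (A l) * of_int (\<mu> e' (Inl l))) = (if j = \<rho> then a (alpha ks) else 0)" for e'
    proof -
      have "(\<Sum>l\<in>{1..\<alpha>}. d (A l) * of_int (\<mu> e' (Inl l))) =
          (\<Sum>l\<in>{1..\<alpha>}. if l = \<alpha> then (if j = \<rho> then a \<alpha> else 0) else 0)"
        using R_iff[OF j] a(1)[of \<alpha>] \<open>alpha ks \<ge> 1\<close> by (intro sum.cong) (auto simp: \<mu>_def \<alpha>_def)
      then show ?thesis using \<open>alpha ks \<ge> 1\<close> by (simp add: \<alpha>_def)
    qed
    have cr: "c r = d (C 0)" using c[of r] L(5) by (simp add: r_def)
    have cj: "c l = d (C l)" if "l < r" for l using c[of l] that by (simp add: r_def)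
    have cn: "c (j + 1) = d (C (Suc j mod r))"
      using cr cj[of "j + 1"] j by (cases "Suc j = r") auto
    have "c (j + 1) + c (if j = 0 then r - 1 else j - 1) + (if j = \<rho> then a (alpha ks) else 0)
        - of_nat e * c j = 2 - of_nat e"
    proof (cases "r = 1")
      case True
      then have j0: "j = 0" and nodal: "nodal_rational_curve S (?E (Inr j))" using j Ckind by auto
      then have "intersection_number S (C j) (C j) (- (int e - 2))"
        using self unfolding self_intersection_entry_def by (simp add: algebra_simps)
      from adj(2)[OF jI \<mu>[OF _ this] nodal]
      have "(if j = \<rho> then a (alpha ks) else 0) + d (C 0) * (2 - of_nat e) = 2 - of_nat e"
        unfolding sumE root by (simp add: \<mu>_def True j0)
      then show ?thesis using True j0 cr cj[of 0] r0 by (simp add: algebra_simps)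
    next
      case False
      then have r2: "r \<ge> 2" using r0 by simp
      have smooth: "smooth_rational_curve S (?E (Inr j))" using False Ckind j by simp
      have "\<not> nodal_rational_curve S (C j)"
      proof
        assume nodal: "nodal_rational_curve S (C j)"
        then have "intersection_number S (C j) (C j) (- (int e - 2))"
          using self unfolding self_intersection_entry_def by (simp add: algebra_simps)
        from adj(1)[OF jI \<mu>[OF _ this] smooth] adj(2)[OF jI \<mu>[OF _ this]] nodal
        show False by simp
      qed
      then have "intersection_number S (C j) (C j) (- int e)"
        using self unfolding self_intersection_entry_def by simp
      from adj(1)[OF jI \<mu>[OF _ this] smooth]
      have "(if j = \<rho> then a (alpha ks) else 0) + (\<Sum>l<r. d (C l) * of_int (\<mu> (int e) (Inr l))) = 2 - of_nat e"
        unfolding sumE root by (simp add: \<mu>_def)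
      moreover have "(\<Sum>l<r. d (C l) * of_int (\<mu> (int e) (Inr l))) =
          d (C (Suc j mod r)) + d (C (if j = 0 then r - 1 else j - 1)) - of_nat e * d (C j)"
        using sum_neighbours_in_cycle[OF j r2, of "\<lambda>l. d (C l)" "int e"] by (simp add: \<mu>_def)
      moreover have "c (if j = 0 then r - 1 else j - 1) = d (C (if j = 0 then r - 1 else j - 1))"
        using cj r0 j by auto
      ultimately show ?thesis using cn cj[OF j] by simp
    qed
    then show ?thesis unfolding r_def[symmetric] \<rho>_def[symmetric] by (simp add: algebra_simps)
  qed
qed

theorem proposition3p2:
  fixes S :: "'a surface" and ks :: "nat list" and m :: nat
    and E A C :: "nat \<Rightarrow> 'a set" and d :: "'a set \<Rightarrow> rat"
    and a c :: "nat \<Rightarrow> rat" and t :: rat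
  assumes "intermediate_Kato_surface S"
    and "ks \<noteq> []" and "\<forall>k\<in>set ks. k \<ge> 1" and "m \<ge> 1"
    and "Dloussky_sequence S E (simple_sequence ks m)"
    and "labelling S ks m A C"
    and "anticanonical_multiplicities S d"
    and "\<forall>i\<in>{1..alpha ks}. a i = d (A i)"
    and "a (alpha ks + 1) = d (C (beta ks + 1))"
    and "\<forall>j\<le>beta ks + m. c j = d (C j)"
    and "t = a 1"
  shows "(\<forall>j\<le>length ks. slope ks a c j =
            of_nat (f_poly (take j ks)) * t
            - (if j = 0 then 0 else of_nat (f_poly (tl (take j ks))))) \<and>
         c (beta ks + 1) = (of_nat (P_poly ks) + 1) * t - of_nat (P_poly (tl ks))"
proof -
  define b where "b i = (if i = 0 then 0 else a i)" for i
  define r where "r = beta ks + m"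
  have p: "length ks > 0" using assms(2) by simp
  have k1: "ks ! i \<ge> 1" if "i < length ks" for i using assms(3) that by simp
  have E1: "ksum_even ks 1 \<ge> 1" using k1[of 0] p by (simp add: ksum_even_def)
  have \<alpha>: "alpha ks \<ge> 1"
    using ksum_even_mono[of 1 "(length ks + 1) div 2" ks] E1 p unfolding alpha_eq_ksum by linarith
  note eqs = labelled_adjunction_equations[OF assms(1,7,6,4) \<alpha>, of b c]
  have b_eq: "b (i + 1) - b i = b i - b (i - 1) + (of_nat e - 2) * (b i - 1)"
    if "i \<in> {1..alpha ks}" "self_intersection_entry S (A i) e" for i e
    by (rule eqs(1)) (use that assms(8-10) in \<open>auto simp: b_def\<close>)
  have c_eq: "c (j + 1) - c j = c j - c (if j = 0 then r - 1 else j - 1)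
        - (if j = (if m = 1 then 0 else beta ks + 1) then b (alpha ks) else 0) + (of_nat e - 2) * (c j - 1)"
    if "j < r" "self_intersection_entry S (C j) e" for j e
    unfolding r_def by (rule eqs(2)) (use that assms(8-10) in \<open>auto simp: b_def r_def\<close>)
  have entries: "\<And>j. 2 * j + 1 < length ks \<Longrightarrow>
      self_intersection_entry S (A (ksum_even ks (Suc j))) (ks ! (2 * j + 1) + 2)"
    "\<And>i. i \<in> {1..alpha ks} \<Longrightarrow> (\<nexists>j. 2 * j + 1 < length ks \<and> i = ksum_even ks (Suc j)) \<Longrightarrow>
      self_intersection_entry S (A i) 2"
    "\<And>j. 2 * j < length ks \<Longrightarrow> self_intersection_entry S (C (ksum_odd ks j)) (ks ! (2 * j) + 2)"
    "\<And>i. i < r \<Longrightarrow> (\<nexists>j. 2 * j < length ks \<and> i = ksum_odd ks j) \<Longrightarrow> self_intersection_entry S (C i) 2"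
    and Cr: "C r = C 0"
    using assms(6) unfolding labelling_def Let_def r_def by auto
  have E_range: "ksum_even ks (Suc j) \<in> {1..alpha ks}" if "2 * j + 1 < length ks" for j
    using ksum_even_mono[of 1 "Suc j" ks] ksum_even_mono[of "Suc j" "(length ks + 1) div 2" ks] E1 that
    unfolding alpha_eq_ksum by auto
  have O_le: "ksum_odd ks j \<le> beta ks" if "2 * j < length ks" for j
    unfolding beta_eq_ksum by (rule ksum_odd_mono) (use that in auto)
  have O_pos: "ksum_odd ks j \<ge> 1" if "0 < j" "2 * j < length ks" for j
    using ksum_odd_mono[of 1 j ks] k1[of 1] that by (simp add: ksum_odd_def)
  have cr: "c r = c 0" using assms(10) Cr by (simp add: r_def)

  have start: "c 1 - c 0 = (c (beta ks + 1) - c (beta ks)) - b (alpha ks) + of_nat (ks ! 0) * (c 0 - 1)"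
  proof (cases "m = 1")
    case True
    then show ?thesis
      using c_eq[of 0, OF _ entries(3)[of 0, simplified]] p cr by (simp add: r_def)
  next
    case False
    then have m2: "m \<ge> 2" using assms(4) by simp
    \<comment> \<open>From the root onwards the slope is constant until the cycle closes up.\<close>
    have "c (beta ks + 1 + 1) - c (beta ks + 1) = c (beta ks + 1) - c (beta ks) - b (alpha ks)"
    proof -
      have "self_intersection_entry S (C (beta ks + 1)) 2"
        using m2 O_le by (intro entries(4)) (fastforce simp: r_def)+
      then show ?thesis using c_eq[of "beta ks + 1" 2] m2 by (simp add: r_def)
    qed
    moreover have "c (beta ks + 1 + (m - 2) + 1) - c (beta ks + 1 + (m - 2)) = c (beta ks + 1 + 1) - c (beta ks + 1)"
    proof (rule linear_run(1)[where L = "m - 1"])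
      fix i assume i: "beta ks + 1 < i" "i < beta ks + 1 + (m - 1)"
      then have "self_intersection_entry S (C i) 2"
        using O_le by (intro entries(4)) (fastforce simp: r_def)+
      then show "c (i + 1) - c i = c i - c (i - 1)" using c_eq[of i 2] i m2 by (simp add: r_def)
    qed (use m2 in simp)
    moreover have "beta ks + 1 + (m - 2) + 1 = r" "beta ks + 1 + (m - 2) = r - 1" using m2 by (auto simp: r_def)
    moreover have "c 1 - c 0 = c 0 - c (r - 1) + of_nat (ks ! 0) * (c 0 - 1)"
      using c_eq[of 0, OF _ entries(3)[of 0, simplified]] p False m2 by (simp add: r_def)
    ultimately show ?thesis using cr by simp
  qed

  have bend: "b (i + 1) - b i = b i - b (i - 1) + of_nat (ks ! (2 * j + 1)) * (b i - 1)"
    if "2 * j + 1 < length ks" "i = ksum_even ks (Suc j)" for i j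
    using b_eq[OF E_range[OF that(1)] entries(1)[OF that(1)]] that(2) by simp
  have straight: "b (i + 1) - b i = b i - b (i - 1)"
    if "i \<in> {1..alpha ks}" "\<And>j. 2 * j + 1 < length ks \<Longrightarrow> i \<noteq> ksum_even ks (Suc j)" for i
    using b_eq[OF that(1) entries(2)[OF that(1)]] that(2) by auto
  have c_bend: "c (i + 1) - c i = c i - c (i - 1) + of_nat (ks ! (2 * j)) * (c i - 1)"
    if "0 < j" "2 * j < length ks" "i = ksum_odd ks j" for i j
    using c_eq[OF _ entries(3)[OF that(2)]] O_le[OF that(2)] O_pos[OF that(1,2)] assms(4) that(3)
    by (auto simp: r_def)
  have c_straight: "c (i + 1) - c i = c i - c (i - 1)"
    if "i \<in> {1..beta ks}" "\<And>j. 2 * j < length ks \<Longrightarrow> i \<noteq> ksum_odd ks j" for i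
  proof -
    have "i < r" using that(1) assms(4) by (auto simp: r_def)
    then show ?thesis using c_eq[OF _ entries(4)[of i]] that by auto
  qed
  have root: "b (alpha ks + 1) = c (beta ks + 1)"
    using assms(4,9,10) by (simp add: b_def)
  have b0: "b 0 = 0" and b1: "b 1 = t" by (simp_all add: b_def assms(11))
  have ks1: "\<And>k. k \<in> set ks \<Longrightarrow> k \<ge> 1" using assms(3) by blast
  note main = multiplicities_of_chain_and_cycle[of ks b c, OF assms(2) ks1 b0 bend straight c_bend c_straight root start]
  have slopes: "2 * i \<le> length ks \<Longrightarrow>
      b (ksum_even ks i + 1) - b (ksum_even ks i) = euler_seq ks (- 1) t (Suc (2 * i))"
    "2 * i < length ks \<Longrightarrow>
      c (ksum_odd ks i + 1) - c (ksum_odd ks i) = euler_seq ks (- 1) t (Suc (2 * i + 1))"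
    and multiplicity: "c (beta ks + 1) =
      euler_seq ks (- 1) t (length ks) + euler_seq ks (- 1) t (Suc (length ks)) + 1" for i
    using main unfolding b1 by blast+
  have "slope ks a c j = euler_seq ks (- 1) t (Suc j)" if j: "j \<le> length ks" for j
  proof (cases "even j")
    case True
    then obtain i where i: "j = 2 * i" by blast
    have "slope ks a c j = b (ksum_even ks i + 1) - b (ksum_even ks i)"
    proof (cases "i = 0")
      case True
      then show ?thesis using i by (simp add: slope_def b_def)
    next
      case False
      then have "ksum_even ks i \<ge> 1" using ksum_even_mono[of 1 i ks] E1 by linarith
      then show ?thesis using i False by (simp add: slope_def b_def)
    qed
    also have "\<dots> = euler_seq ks (- 1) t (Suc j)" using slopes(1)[of i] j unfolding i by simp
    finally show ?thesis .
  next
    case False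
    then obtain i where i: "j = 2 * i + 1" using oddE by blast
    have "slope ks a c j = c (ksum_odd ks i + 1) - c (ksum_odd ks i)" by (simp add: slope_def i)
    also have "\<dots> = euler_seq ks (- 1) t (Suc j)"
      unfolding i by (rule slopes(2)) (use j i in simp)
    finally show ?thesis .
  qed
  moreover have "c (beta ks + 1) = (of_nat (P_poly ks) + 1) * t - of_nat (P_poly (tl ks))"
    using multiplicity euler_seq_sum_closed_form[of "length ks" ks t] p by (simp only: take_all order_refl)
  ultimately show ?thesis using euler_seq_closed_form by simp
qed

end
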